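(* Let $0<\epsilon<2^{-100}$ and let $f:\mathbb{N}\to(0,1)$ be a decreasing function with $f(1)\le 2^{-100}\epsilon^{6}$. Define $W_\ell$ recursively by $W_1=1$ and $W_{\ell+1}=T\left(2^{-70}\epsilon^5/f(W_\ell)\right)$, and let $W=W_{t-1}$ with $t=2^{-20}\epsilon^{-1}$. Then there is a graph $G$ such that whenever $\mathcal{A},\mathcal{B}$ are equitable partitions of the vertex set of $G$ with $q(\mathcal{B})\le q(\mathcal{A})+\epsilon$ and $\mathcal{B}$ is $f(|\mathcal{A}|)$-regular, we have $|\mathcal{A}|\ge W$ and $|\mathcal{B}|\ge W$.
   Context: The tower function is $T(1)=2$, $T(n)=2^{T(n-1)}$ (non-integer arguments and quantities such as $t$ are rounded to integers). For vertex subsets $X,Y$, $d(X,Y)$ is the number of pairs $(x,y)\in X\times Y$ that are edges divided by $|X||Y|$. A partition $V_1\cup\dots\cup V_k$ of $V$ is equitable if $||V_i|-|V_j||\le1$ for all $i,j$; $|\mathcal{P}|$ denotes the number of parts. The mean square density of a partition $\mathcal{P}: V=V_1\cup\dots\cup V_k$ is $q(\mathcal{P})=\sum_{i,j=1}^k d^2(V_i,V_j)p_ip_j$ with $p_i=|V_i|/|V|$. A pair $(X,Y)$ is $(\epsilon,\delta)$-regular if for some $\alpha$, all $X'\subset X$, $Y'\subset Y$ with $|X'|\ge\delta|X|$, $|Y'|\ge\delta|Y|$ satisfy $\alpha<d(X',Y')<\alpha+\epsilon$. An equitable partition into $k$ parts is $\gamma$-regular if all but at most a $\gamma$ fraction of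 the pairs $(V_i,V_j)$ are $(\gamma,\gamma)$-regular. *)

theory Defs
  imports "HOL-Analysis.Analysis" "HOL-Library.Disjoint_Sets" "Graph_Theory.Pair_Digraph"
begin

text \<open>
  A finite simple graph is a \<open>pair_graph\<close>: a finite vertex set \<open>pverts G\<close> together with a
  symmetric irreflexive set \<open>parcs G\<close> of ordered pairs, so that \<open>(x, y) \<in> parcs G\<close> says that
  \<open>x\<close> and \<open>y\<close> are adjacent.
\<close>

text \<open>The value at \<open>0\<close> is only a convenient start of the recursion; it gives \<open>tower 1 = 2\<close>.\<close>

primrec tower :: "nat \<Rightarrow> nat" where
  "tower 0 = 1"
| "tower (Suc n) = 2 ^ tower n"

definition density :: "'a pair_pre_digraph \<Rightarrow> 'a set \<Rightarrow> 'a set \<Rightarrow> real" where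
  "density G X Y = real (card {(x, y) \<in> X \<times> Y. (x, y) \<in> parcs G}) / (real (card X) * real (card Y))"

text \<open>Partitions have nonempty parts (\<open>partition_on\<close>), hence the densities between parts are
  never \<open>0 / 0\<close> and the number of parts is the cardinality of the partition.\<close>

definition equitable_partition :: "'a set \<Rightarrow> 'a set set \<Rightarrow> bool" where
  "equitable_partition V P \<longleftrightarrow>
     partition_on V P \<and> (\<forall>X\<in>P. \<forall>Y\<in>P. \<bar>int (card X) - int (card Y)\<bar> \<le> 1)"

definition mean_square_density :: "'a pair_pre_digraph \<Rightarrow> 'a set set \<Rightarrow> real" where
  "mean_square_density G P =
     (\<Sum>X\<in>P. \<Sum>Y\<in>P. (density G X Y)\<^sup>2 *
        (real (card X) / real (card (pverts G))) * (real (card Y) / real (card (pverts G))))"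

definition regular_pair ::
  "'a pair_pre_digraph \<Rightarrow> real \<Rightarrow> real \<Rightarrow> 'a set \<Rightarrow> 'a set \<Rightarrow> bool" where
  "regular_pair G \<epsilon> \<delta> X Y \<longleftrightarrow>
     (\<exists>\<alpha>::real. \<forall>X' Y'. X' \<subseteq> X \<and> Y' \<subseteq> Y \<and>
        real (card X') \<ge> \<delta> * real (card X) \<and> real (card Y') \<ge> \<delta> * real (card Y) \<longrightarrow>
        \<alpha> < density G X' Y' \<and> density G X' Y' < \<alpha> + \<epsilon>)"

text \<open>The fraction is taken among all \<open>k\<^sup>2\<close> ordered pairs of parts, including the pairs of a part
  with itself.\<close>

definition regular_partition :: "'a pair_pre_digraph \<Rightarrow> real \<Rightarrow> 'a set set \<Rightarrow> bool" where
  "regular_partition G \<gamma> P \<longleftrightarrow>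
     equitable_partition (pverts G) P \<and>
     real (card {(X, Y) \<in> P \<times> P. \<not> regular_pair G \<gamma> \<gamma> X Y}) \<le> \<gamma> * (real (card P))\<^sup>2"

end

theory Submission
  imports Defs "HOL-Library.Discrete_Functions"
begin

text \<open>
  A vertex carries a path of labels (a type, then one label per stage) and a key, a set of initial paths.
  Only a sparse symmetric relation on the paths of stage \<open>i\<close> is devoted to stage \<open>i + 1\<close>: on a related pair
  the two vertices are adjacent iff the bits read off two codewords agree, where the codewords of
  different labels differ in a quarter of all coordinates. If a part of a regular partition is concentrated on
  a path of stage \<open>i\<close> but not on one label of stage \<open>i + 1\<close>, a positive fraction of the coordinates splits it,
  which makes it irregular to too many other parts. Hence a \<open>\<gamma>\<close>-regular partition almost refines the paths
  through about \<open>\<epsilon>\<^sup>5 / \<gamma>\<close> stages, each of them exponentially larger than the preceding one.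

  Moreover, for every level \<open>l\<close> a constant multiple of \<open>1 / t\<close> of all pairs of types is decided by the keys at the
  last stage that an \<open>f (W l)\<close>-regular partition has to see. By orthogonality a partition into fewer than \<open>W (l + 1)\<close>
  parts finds density close to \<open>1 / 2\<close> on these pairs, while a refinement of the stage finds only densities \<open>0\<close> and \<open>1\<close>.
  So the mean square density of \<open>B\<close> exceeds that of \<open>A\<close> by more than \<open>\<epsilon>\<close> as soon as \<open>A\<close> has fewer than \<open>W (l + 1)\<close> parts and
  \<open>B\<close> is \<open>f (W l)\<close>-regular. If \<open>B\<close> is small, the same applied to \<open>B\<close> in both roles is already contradictory.
\<close>

section \<open>Regularity and splitting\<close>

text \<open>Two budgets shape the construction. A stage must touch enough pairs for a
  \<gamma>-regular partition to notice a split, yet the touched proportions of all stages may add up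
  to at most one half, since later stages live on what is left. Level \<open>l\<close> has about
  \<kappa> / f(W l) stages and demands a proportion of order t^2 f(W l) from each, so its total
  demand is free of \<open>f\<close>; over \<open>t\<close> levels this costs t^3 \<kappa>, which is
  tiny for \<kappa> of order \<epsilon>^5. A second obstacle: a few badly placed vertices might fill
  the neighbourhood of a path and hide a split there. The touching relation is therefore
  pseudorandom: any small set of exceptional vertices spoils only a proportion of order 1 / Q of the
  paths, which is summable over the stages. Finally, pairs of role 0 are written off as unresolved.
  This is why a level owns two roles: one compensates role 0, and the other, a share 1 / (16 t) of
  all pairs, yields the gain 1 / (64 t), because a density 1/2 in place of 0 or 1 costs 1/4 per
  pair.\<close>

lemma density_complete:
  assumes "finite X" "finite Y" "X \<noteq> {}" "Y \<noteq> {}"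
    and "\<And>x y. x \<in> X \<Longrightarrow> y \<in> Y \<Longrightarrow> (x, y) \<in> parcs G"
  shows "density G X Y = 1"
proof -
  have "{(x, y) \<in> X \<times> Y. (x, y) \<in> parcs G} = X \<times> Y"
    using assms(5) by auto
  then show ?thesis
    using assms by (simp add: density_def card_cartesian_product)
qed

lemma density_empty:
  assumes "\<And>x y. x \<in> X \<Longrightarrow> y \<in> Y \<Longrightarrow> (x, y) \<notin> parcs G"
  shows "density G X Y = 0"
proof -
  have "{(x, y) \<in> X \<times> Y. (x, y) \<in> parcs G} = {}"
    using assms by auto
  then show ?thesis
    unfolding density_def by (simp only: card.empty of_nat_0 div_0)
qed

text \<open>Densities 1 and 0 cannot both lie in an open window of length \<gamma> < 1. All
  irregularity below is certified by such a full and such an empty rectangle; \<gamma> > 0 makes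
  their sides nonempty, so no density 0 / 0 intervenes.\<close>

lemma not_regular_pairI:
  fixes \<gamma> :: real
  assumes "finite U" "finite U'" "U \<noteq> {}" "U' \<noteq> {}" "0 < \<gamma>" "\<gamma> < 1"
    and "X\<^sub>1 \<subseteq> U" "\<gamma> * card U \<le> card X\<^sub>1" "Y\<^sub>1 \<subseteq> U'" "\<gamma> * card U' \<le> card Y\<^sub>1"
    and "X\<^sub>0 \<subseteq> U" "\<gamma> * card U \<le> card X\<^sub>0" "Y\<^sub>0 \<subseteq> U'" "\<gamma> * card U' \<le> card Y\<^sub>0"
    and "\<And>x y. x \<in> X\<^sub>1 \<Longrightarrow> y \<in> Y\<^sub>1 \<Longrightarrow> (x, y) \<in> parcs G"
    and "\<And>x y. x \<in> X\<^sub>0 \<Longrightarrow> y \<in> Y\<^sub>0 \<Longrightarrow> (x, y) \<notin> parcs G"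
  shows "\<not> regular_pair G \<gamma> \<gamma> U U'"
proof
  assume "regular_pair G \<gamma> \<gamma> U U'"
  then obtain \<alpha> where \<alpha>: "\<And>X' Y'. X' \<subseteq> U \<and> Y' \<subseteq> U' \<and> real (card X') \<ge> \<gamma> * real (card U) \<and>
      real (card Y') \<ge> \<gamma> * real (card U') \<Longrightarrow> \<alpha> < density G X' Y' \<and> density G X' Y' < \<alpha> + \<gamma>"
    unfolding regular_pair_def by blast
  have pos: "0 < \<gamma> * card U" "0 < \<gamma> * card U'"
    using assms by (auto simp: card_gt_0_iff)
  have "X\<^sub>1 \<noteq> {}" "Y\<^sub>1 \<noteq> {}"
    using pos assms(8,10) by auto
  moreover have "finite X\<^sub>1" "finite Y\<^sub>1"
    using assms finite_subset by blast+
  ultimately have "density G X\<^sub>1 Y\<^sub>1 = 1"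
    using assms(15) by (intro density_complete) auto
  moreover have "density G X\<^sub>0 Y\<^sub>0 = 0"
    using assms(16) by (intro density_empty) auto
  ultimately show False
    using \<alpha>[of X\<^sub>1 Y\<^sub>1] \<alpha>[of X\<^sub>0 Y\<^sub>0] assms by auto
qed

text \<open>Nonempty parts whose sizes differ by at most one are within a factor two, the worst case
  being sizes 1 and 2. Beyond being a partition, equitability is used only through these two
  bounds.\<close>

lemma equitable_partition_card_le:
  assumes "equitable_partition V P" "finite V" "U \<in> P"
  shows "real (card U) * real (card P) \<le> 2 * real (card V)"
    and "real (card V) \<le> 2 * real (card U) * real (card P)"
proof -
  have part: "partition_on V P" and eq: "\<And>X Y. X \<in> P \<Longrightarrow> Y \<in> P \<Longrightarrow> \<bar>int (card X) - int (card Y)\<bar> \<le> 1"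
    using assms by (auto simp: equitable_partition_def)
  have fin: "finite X" if "X \<in> P" for X
    using partition_onD1[OF part] that assms(2) by (auto intro: finite_subset)
  have ne: "1 \<le> card X" if "X \<in> P" for X
    using fin[OF that] partition_onD3[OF part] that by (metis One_nat_def Suc_leI card_gt_0_iff)
  have le: "card X \<le> 2 * card Y" if "X \<in> P" "Y \<in> P" for X Y
    using eq[OF that] ne[OF that(2)] by linarith
  have sum: "card V = (\<Sum>X\<in>P. card X)"
    using product_partition[OF part] fin by blast
  have "card P * card U = (\<Sum>X\<in>P. card U)"
    by simp
  also have "\<dots> \<le> (\<Sum>X\<in>P. 2 * card X)"
    using le assms(3) by (intro sum_mono) auto
  also have "\<dots> = 2 * card V"
    by (simp add: sum sum_distrib_left)
  finally show "real (card U) * real (card P) \<le> 2 * real (card V)"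
    by (metis mult.commute of_nat_le_iff of_nat_mult of_nat_numeral)
  have "card V \<le> (\<Sum>X\<in>P. 2 * card U)"
    unfolding sum using le assms(3) by (intro sum_mono) auto
  also have "\<dots> = 2 * card U * card P"
    by simp
  finally show "real (card V) \<le> 2 * real (card U) * real (card P)"
    by (metis of_nat_le_iff of_nat_mult of_nat_numeral)
qed

text \<open>Double counting of pairs of points against the coordinates that tell them apart: a
  coordinate that does not cut off \<open>g\<close> points on both sides separates few pairs, while
  points of different classes are separated by a quarter of all coordinates. The slack 8 g and the
  size 32 g are matched so that both cases of the proof give the constant 7.\<close>

lemma code_splits_many_coordinates:
  fixes s :: "'v \<Rightarrow> 'p \<Rightarrow> bool" and ch :: "'v \<Rightarrow> 'c" and g :: real
  assumes "finite U" "finite N" "0 < g"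
    and small: "\<And>c. real (card {x \<in> U. ch x = c}) \<le> card U - 8 * g"
    and large: "32 * g \<le> card U"
    and dist: "\<And>x x'. x \<in> U \<Longrightarrow> x' \<in> U \<Longrightarrow> ch x \<noteq> ch x' \<Longrightarrow> card N \<le> 4 * card {Y \<in> N. s x Y \<noteq> s x' Y}"
    and const: "\<And>x x' Y. x \<in> U \<Longrightarrow> x' \<in> U \<Longrightarrow> ch x = ch x' \<Longrightarrow> Y \<in> N \<Longrightarrow> s x Y = s x' Y"
  shows "real (card N) \<le> 7 * card {Y \<in> N. g \<le> card {x \<in> U. s x Y} \<and> g \<le> card {x \<in> U. \<not> s x Y}}"
proof -
  define Gd where "Gd = {Y \<in> N. g \<le> card {x \<in> U. s x Y} \<and> g \<le> card {x \<in> U. \<not> s x Y}}"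
  define S where "S = real (card U)"
  define D where "D = real (card N)"
  have finG: "finite Gd" "Gd \<subseteq> N"
    using assms by (auto simp: Gd_def)
  have split: "(\<Sum>Y\<in>N. F Y) \<le> real (card Gd) * a + (D - real (card Gd)) * b"
    if "\<And>Y. Y \<in> Gd \<Longrightarrow> F Y \<le> a" "\<And>Y. Y \<in> N - Gd \<Longrightarrow> F Y \<le> b" for F :: "'p \<Rightarrow> real" and a b
  proof -
    have "(\<Sum>Y\<in>N. F Y) = (\<Sum>Y\<in>N - Gd. F Y) + (\<Sum>Y\<in>Gd. F Y)"
      using finG assms(2) by (metis sum.subset_diff)
    also have "\<dots> \<le> of_nat (card (N - Gd)) * b + of_nat (card Gd) * a"
      using that by (intro add_mono sum_bounded_above) auto
    also have "real (card (N - Gd)) = D - card Gd"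
      using finG assms(2) card_mono[of N Gd] by (simp add: D_def card_Diff_subset)
    finally show ?thesis by simp
  qed
  have Spos: "0 < S" using large \<open>0 < g\<close> by (simp add: S_def)
  have dist': "D / 4 \<le> (\<Sum>Y\<in>N. of_bool (s x Y \<noteq> s x' Y))" if "x \<in> U" "x' \<in> U" "ch x \<noteq> ch x'" for x x'
  proof -
    have "real (card {Y \<in> N. s x Y \<noteq> s x' Y}) = (\<Sum>Y\<in>N. of_bool (s x Y \<noteq> s x' Y))"
      using assms(2) by (simp add: Int_def)
    moreover have "D \<le> 4 * real (card {Y \<in> N. s x Y \<noteq> s x' Y})"
      using dist[OF that] unfolding D_def by linarith
    ultimately show ?thesis by simp
  qed
  \<comment> \<open>If one class dominates, pairs of different classes may be rare among all pairs,
    so only the points outside it are compared, each with a single representative \<open>x0\<close>.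
    Otherwise all ordered pairs are counted.\<close>
  have "D \<le> 7 * real (card Gd)"
  proof (cases "\<exists>x0\<in>U. S / 2 \<le> card {x \<in> U. ch x = ch x0}")
    case True
    then obtain x0 where x0: "x0 \<in> U" "S / 2 \<le> card {x \<in> U. ch x = ch x0}" by blast
    define O' where "O' = {x \<in> U. ch x \<noteq> ch x0}"
    have finO: "finite O'" using assms(1) by (simp add: O'_def)
    have "U = {x \<in> U. ch x = ch x0} \<union> O'" by (auto simp: O'_def)
    then have "card U = card {x \<in> U. ch x = ch x0} + card O'"
      using assms(1) finO by (subst card_Un_disjoint[symmetric]) (auto simp: O'_def)
    then have O8: "8 * g \<le> card O'"
      using small[of "ch x0"] by linarith
    have "card O' * (D / 4) = (\<Sum>x\<in>O'. D / 4)"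
      by (simp only: sum_constant)
    also have "\<dots> \<le> (\<Sum>x\<in>O'. \<Sum>Y\<in>N. of_bool (s x Y \<noteq> s x0 Y))"
      using dist' x0 by (intro sum_mono) (auto simp: O'_def)
    also have "\<dots> = (\<Sum>Y\<in>N. \<Sum>x\<in>O'. of_bool (s x Y \<noteq> s x0 Y))"
      by (rule sum.swap)
    also have "\<dots> = (\<Sum>Y\<in>N. real (card {x\<in>O'. s x Y \<noteq> s x0 Y}))"
      using finO by (simp add: Int_def)
    also have "\<dots> \<le> real (card Gd) * card O' + (D - card Gd) * (card O' / 8)"
    proof (rule split)
      fix Y assume "Y \<in> Gd"
      show "real (card {x\<in>O'. s x Y \<noteq> s x0 Y}) \<le> card O'"
        using finO by (auto intro!: card_mono)
    next
      fix Y assume Y: "Y \<in> N - Gd"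
      have sub0: "{x \<in> U. ch x = ch x0} \<subseteq> {x \<in> U. s x Y = s x0 Y}"
        using const[OF _ x0(1)] Y by auto
      have sub1: "{x \<in> O'. s x Y \<noteq> s x0 Y} \<subseteq> {x \<in> U. s x Y \<noteq> s x0 Y}"
        by (auto simp: O'_def)
      \<comment> \<open>The dominating class agrees with \<open>x0\<close> at \<open>Y\<close>, so
        the agreeing side is always large and a coordinate outside \<open>Gd\<close> must fail on
        the disagreeing side.\<close>
      have 0: "g \<le> card {x \<in> U. s x Y = s x0 Y}"
      proof -
        have "card {x \<in> U. ch x = ch x0} \<le> card {x \<in> U. s x Y = s x0 Y}"
          using sub0 assms(1) by (intro card_mono) auto
        then show ?thesis using x0(2) large \<open>0 < g\<close> unfolding S_def by linarith
      qed
      have "\<not> g \<le> card {x \<in> O'. s x Y \<noteq> s x0 Y}"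
      proof
        assume "g \<le> card {x \<in> O'. s x Y \<noteq> s x0 Y}"
        then have 1: "g \<le> card {x \<in> U. s x Y \<noteq> s x0 Y}"
          using card_mono[OF _ sub1] assms(1) by force
        have "Y \<in> Gd"
          unfolding Gd_def using Y 0 1 by (cases "s x0 Y") simp_all
        then show False using Y by simp
      qed
      then show "real (card {x\<in>O'. s x Y \<noteq> s x0 Y}) \<le> card O' / 8"
        using O8 by simp
    qed
    finally have "0 \<le> card O' * (real (card Gd) * (7/8) - D / 8)"
      by (simp add: algebra_simps diff_divide_distrib)
    moreover have "0 < real (card O')" using O8 \<open>0 < g\<close> by linarith
    ultimately have "0 \<le> real (card Gd) * (7/8) - D / 8"
      by (simp add: zero_le_mult_iff)
    then show ?thesis by simp
  next
    case False
    have cls: "card U - card {x' \<in> U. ch x' = ch x} = card {x' \<in> U. ch x' \<noteq> ch x}" for x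
    proof -
      have "{x' \<in> U. ch x' \<noteq> ch x} = U - {x' \<in> U. ch x' = ch x}" by auto
      then show ?thesis using assms(1) by (simp add: card_Diff_subset)
    qed
    have big: "S / 2 \<le> card {x' \<in> U. ch x' \<noteq> ch x}" if "x \<in> U" for x
    proof -
      have "real (card {x' \<in> U. ch x' = ch x}) < S / 2" using False that by force
      then show ?thesis using cls[of x] unfolding S_def by linarith
    qed
    have "S * (S / 2 * (D / 4)) = (\<Sum>x\<in>U. S / 2 * (D / 4))"
      by (simp add: S_def)
    also have "\<dots> \<le> (\<Sum>x\<in>U. real (card {x' \<in> U. ch x' \<noteq> ch x}) * (D / 4))"
      using big by (intro sum_mono mult_right_mono) (auto simp: D_def)
    also have "\<dots> = (\<Sum>x\<in>U. \<Sum>x'\<in>{x' \<in> U. ch x' \<noteq> ch x}. D / 4)"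
      by simp
    also have "\<dots> \<le> (\<Sum>x\<in>U. \<Sum>x'\<in>{x' \<in> U. ch x' \<noteq> ch x}. \<Sum>Y\<in>N. of_bool (s x Y \<noteq> s x' Y))"
      using dist' by (intro sum_mono) auto
    also have "\<dots> \<le> (\<Sum>x\<in>U. \<Sum>x'\<in>U. \<Sum>Y\<in>N. of_bool (s x Y \<noteq> s x' Y))"
      using assms(1) by (intro sum_mono sum_mono2) (auto intro: sum_nonneg)
    also have "\<dots> = (\<Sum>x\<in>U. \<Sum>Y\<in>N. \<Sum>x'\<in>U. of_bool (s x Y \<noteq> s x' Y))"
      by (intro sum.cong refl sum.swap)
    also have "\<dots> = (\<Sum>Y\<in>N. \<Sum>x\<in>U. \<Sum>x'\<in>U. of_bool (s x Y \<noteq> s x' Y))"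
      by (rule sum.swap)
    also have "\<dots> = (\<Sum>Y\<in>N. 2 * (real (card {x \<in> U. s x Y}) * real (card {x \<in> U. \<not> s x Y})))"
    proof (intro sum.cong refl)
      fix Y
      have "(\<Sum>x\<in>U. \<Sum>x'\<in>U. of_bool (s x Y \<noteq> s x' Y) :: real) =
        (\<Sum>x\<in>U. \<Sum>x'\<in>U. of_bool (s x Y) * of_bool (\<not> s x' Y) + of_bool (\<not> s x Y) * of_bool (s x' Y))"
        by (intro sum.cong refl) auto
      also have "\<dots> = (\<Sum>x\<in>U. of_bool (s x Y)) * (\<Sum>x\<in>U. of_bool (\<not> s x Y)) +
         (\<Sum>x\<in>U. of_bool (\<not> s x Y)) * (\<Sum>x\<in>U. of_bool (s x Y))"
        by (simp only: sum.distrib sum_product)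
      also have "\<dots> = 2 * (real (card {x \<in> U. s x Y}) * real (card {x \<in> U. \<not> s x Y}))"
        using assms(1) by (simp add: Int_def)
      finally show "(\<Sum>x\<in>U. \<Sum>x'\<in>U. of_bool (s x Y \<noteq> s x' Y) :: real) = \<dots>" .
    qed
    \<comment> \<open>A coordinate in \<open>Gd\<close> separates at most S^2 / 2 ordered pairs; any
      other has a side of at most S / 32 points and separates at most S^2 / 16.\<close>
    also have "\<dots> \<le> real (card Gd) * (S\<^sup>2 / 2) + (D - card Gd) * (S\<^sup>2 / 16)"
    proof -
      have tot: "real (card {x \<in> U. s x Y}) + real (card {x \<in> U. \<not> s x Y}) = S" for Y
      proof -
        have "U = {x \<in> U. s x Y} \<union> {x \<in> U. \<not> s x Y}" by auto
        then have "card U = card {x \<in> U. s x Y} + card {x \<in> U. \<not> s x Y}"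
          using assms(1) by (subst card_Un_disjoint[symmetric]) auto
        then show ?thesis by (simp add: S_def)
      qed
      have amgm: "2 * (a * b) \<le> S\<^sup>2 / 2" if "a + b = S" for a b :: real
      proof -
        have "S\<^sup>2 - 4 * (a * b) = (a - b)\<^sup>2" by (simp add: that[symmetric] power2_eq_square algebra_simps)
        then have "0 \<le> S\<^sup>2 - 4 * (a * b)" by simp
        then show ?thesis by simp
      qed
      have sm: "2 * (a * b) \<le> S\<^sup>2 / 16" if "a + b = S" "0 \<le> a" "0 \<le> b" "a \<le> S / 32" for a b :: real
      proof -
        have "a * b \<le> S / 32 * S" using that by (intro mult_mono) auto
        then show ?thesis by (simp add: power2_eq_square)
      qed
      show ?thesis
      proof (rule split)
        fix Y show "2 * (real (card {x \<in> U. s x Y}) * real (card {x \<in> U. \<not> s x Y})) \<le> S\<^sup>2 / 2"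
          using amgm tot by blast
      next
        fix Y assume "Y \<in> N - Gd"
        then have "real (card {x \<in> U. s x Y}) < g \<or> real (card {x \<in> U. \<not> s x Y}) < g"
          by (auto simp: Gd_def)
        then have "real (card {x \<in> U. s x Y}) \<le> S / 32 \<or> real (card {x \<in> U. \<not> s x Y}) \<le> S / 32"
          using large unfolding S_def by linarith
        then show "2 * (real (card {x \<in> U. s x Y}) * real (card {x \<in> U. \<not> s x Y})) \<le> S\<^sup>2 / 16"
          using sm[OF tot[of Y]] sm[of "real (card {x \<in> U. \<not> s x Y})" "real (card {x \<in> U. s x Y})"] tot[of Y]
          by (auto simp: mult.commute add.commute)
      qed
    qed
    finally have "S * (S / 2 * (D / 4)) \<le> real (card Gd) * (S\<^sup>2 / 2) + (D - card Gd) * (S\<^sup>2 / 16)" .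
    moreover have "real (card Gd) * (S\<^sup>2 / 2) + (D - card Gd) * (S\<^sup>2 / 16) - S * (S / 2 * (D / 4))
       = S\<^sup>2 * (real (card Gd) * (7/16) - D / 16)"
      by (simp add: field_simps power2_eq_square)
    ultimately have "0 \<le> S\<^sup>2 * (real (card Gd) * (7/16) - D / 16)"
      by linarith
    moreover have "0 < S\<^sup>2" using Spos by simp
    ultimately have "0 \<le> real (card Gd) * (7/16) - D / 16"
      by (meson not_le mult_pos_neg)
    then show ?thesis by simp
  qed
  then show ?thesis by (simp add: D_def Gd_def)
qed

lemma card_fibres:
  assumes "finite V" "finite P" "\<And>X. X \<in> P \<Longrightarrow> card {x \<in> V. pt x = X} = h"
  shows "card {x \<in> V. pt x \<in> P} = h * card P"
proof -
  have "{x \<in> V. pt x \<in> P} = (\<Union>X\<in>P. {x \<in> V. pt x = X})" by auto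
  also have "card \<dots> = (\<Sum>X\<in>P. card {x \<in> V. pt x = X})"
    using assms by (intro card_UN_disjoint) auto
  finally show ?thesis using assms(3) by simp
qed

text \<open>Counting goes by vertices, not by parts. The splitting coordinates carry a seventh of
  the vertices over \<open>N\<close>; by \<open>few\<close> at most half of these lie in
  \<open>Z\<close>, and each of the others lies in a part concentrated on its own path, hence
  irregular to \<open>U\<close>. A part has at most 2 |V| / |B| vertices, which turns 14 into
  28.\<close>

lemma irregular_partners_of_split_part:
  fixes G :: "'v pair_pre_digraph" and pt :: "'v \<Rightarrow> 'p" and ch :: "'v \<Rightarrow> 'c"
    and N :: "'p set" and s :: "'v \<Rightarrow> 'p \<Rightarrow> bool" and \<gamma> \<beta> :: real
  defines "V \<equiv> pverts G"
  assumes B: "equitable_partition V B" "finite V"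
    and P: "finite P" "pt ` V \<subseteq> P" "\<And>X. X \<in> P \<Longrightarrow> card {x \<in> V. pt x = X} = h"
    and N: "N \<subseteq> P"
    and edge: "\<And>x y. x \<in> V \<Longrightarrow> y \<in> V \<Longrightarrow> pt x = X \<Longrightarrow> pt y \<in> N \<Longrightarrow>
      (x, y) \<in> parcs G \<longleftrightarrow> s x (pt y) = s y X"
    and dist: "\<And>x x'. x \<in> V \<Longrightarrow> x' \<in> V \<Longrightarrow> pt x = X \<Longrightarrow> pt x' = X \<Longrightarrow> ch x \<noteq> ch x' \<Longrightarrow>
      card N \<le> 4 * card {Y \<in> N. s x Y \<noteq> s x' Y}"
    and const: "\<And>x x' Y. x \<in> V \<Longrightarrow> x' \<in> V \<Longrightarrow> pt x = X \<Longrightarrow> pt x' = X \<Longrightarrow> ch x = ch x' \<Longrightarrow>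
      Y \<in> N \<Longrightarrow> s x Y = s x' Y"
    and \<gamma>: "0 < \<gamma>" "\<gamma> \<le> 1 / 64" and \<beta>: "\<beta> \<le> 1 / 4"
    and U: "U \<in> B" "(1 - \<beta>) * card U \<le> card {x \<in> U. pt x = X}"
    and split: "\<And>c. real (card {x \<in> U. pt x = X \<and> ch x = c}) < (1 - \<beta> - 8 * \<gamma>) * card U"
    and Z: "Z = {y \<in> V. \<exists>U'\<in>B. y \<in> U' \<and> card {y' \<in> U'. pt y' = pt y} < (1 - \<beta>) * card U'}"
    and few: "14 * card {y \<in> Z. pt y \<in> N} \<le> card N * h"
  shows "card N * card B \<le> 28 * card P * card {U' \<in> B. \<not> regular_pair G \<gamma> \<gamma> U U'}"
proof -
  have part: "partition_on V B" using B(1) by (simp add: equitable_partition_def)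
  have sub: "U' \<subseteq> V" "finite U'" "U' \<noteq> {}" if "U' \<in> B" for U'
    using partition_onD1[OF part] partition_onD3[OF part] B(2) that by (auto intro: finite_subset)
  have finB: "finite B" using partition_onD1[OF part] B(2) by (metis finite_UnionD)
  have finN: "finite N" using N P finite_subset by auto
  have Upos: "0 < real (card U)" using sub[OF U(1)] by (simp add: card_gt_0_iff)
  define U0 where "U0 = {x \<in> U. pt x = X}"
  have U0: "U0 \<subseteq> V" "finite U0" using sub[OF U(1)] by (auto simp: U0_def)
  have "(3/4) * card U \<le> (1 - \<beta>) * card U"
    using \<beta> by (intro mult_right_mono) auto
  then have U0big: "(3/4) * card U \<le> card U0" using U(2) by (simp add: U0_def)
  have \<gamma>U: "\<gamma> * card U \<le> (1/64) * card U" using \<gamma> by (intro mult_right_mono) auto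
  define Gd where "Gd = {Y \<in> N. \<gamma> * card U \<le> card {x \<in> U0. s x Y} \<and> \<gamma> * card U \<le> card {x \<in> U0. \<not> s x Y}}"
  have many: "real (card N) \<le> 7 * card Gd"
    unfolding Gd_def
  proof (rule code_splits_many_coordinates[where ch = ch])
    fix c
    have "{x \<in> U0. ch x = c} = {x \<in> U. pt x = X \<and> ch x = c}" by (auto simp: U0_def)
    then have "real (card {x \<in> U0. ch x = c}) \<le> (1 - \<beta> - 8 * \<gamma>) * card U"
      using split[of c] by simp
    then show "real (card {x \<in> U0. ch x = c}) \<le> card U0 - 8 * (\<gamma> * card U)"
      using U(2) unfolding U0_def by (simp add: algebra_simps)
  next
    show "32 * (\<gamma> * card U) \<le> card U0" using U0big \<gamma>U by linarith
    fix x x' assume x: "x \<in> U0" "x' \<in> U0"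
    then have "x \<in> V" "x' \<in> V" "pt x = X" "pt x' = X" using U0 by (auto simp: U0_def)
    note 1 = this
    show "card N \<le> 4 * card {Y \<in> N. s x Y \<noteq> s x' Y}" if "ch x \<noteq> ch x'"
      using dist[OF 1 that] .
    show "s x Y = s x' Y" if "ch x = ch x'" "Y \<in> N" for Y
      using const[OF 1 that] .
  qed (use U0 finN \<gamma> Upos in auto)
  define Irr where "Irr = {U' \<in> B. \<not> regular_pair G \<gamma> \<gamma> U U'}"
  define W where "W = {y \<in> V. pt y \<in> Gd} - Z"
  have GdN: "Gd \<subseteq> N" by (auto simp: Gd_def)
  have "W \<subseteq> \<Union>Irr"
  proof
    fix y assume y: "y \<in> W"
    then obtain U' where U': "U' \<in> B" "y \<in> U'"
      using partition_onD1[OF part] by (auto simp: W_def)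
    define Y where "Y = pt y"
    have Y: "Y \<in> Gd" using y by (simp add: W_def Y_def)
    define C where "C = {y' \<in> U'. pt y' = Y}"
    have finC: "finite C" using sub[OF U'(1)] by (simp add: C_def)
    have "(1 - \<beta>) * card U' \<le> card C"
      using y U' by (force simp: W_def Z C_def Y_def)
    moreover have "(3/4) * card U' \<le> (1 - \<beta>) * card U'"
      using \<beta> by (intro mult_right_mono) auto
    ultimately have C: "(3/4) * card U' \<le> card C" by linarith
    have "C = {y' \<in> C. s y' X} \<union> {y' \<in> C. \<not> s y' X}" by auto
    then have "card C = card {y' \<in> C. s y' X} + card {y' \<in> C. \<not> s y' X}"
      using finC by (subst card_Un_disjoint[symmetric]) auto
    \<comment> \<open>The codewords inside \<open>U'\<close> need not agree at \<open>X\<close>.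
      Restricting to their more frequent bit costs a factor two; that set is then completely joined
      to one side of the split of \<open>U\<close> and not joined at all to the other.\<close>
    then have "\<exists>b. (3/8) * card U' \<le> card {y' \<in> C. s y' X = b}"
    proof (cases "(3/8) * card U' \<le> card {y' \<in> C. s y' X}")
      case True then show ?thesis by (intro exI[of _ True]) simp
    next
      case False
      then show ?thesis using C \<open>card C = _\<close> by (intro exI[of _ False]) simp
    qed
    then obtain b where b: "(3/8) * card U' \<le> card {y' \<in> C. s y' X = b}" ..
    have "\<gamma> * card U' \<le> (3/8) * card U'" using \<gamma> by (intro mult_right_mono) auto
    then have b': "\<gamma> * card U' \<le> card {y' \<in> C. s y' X = b}" using b by linarith
    have splitY: "\<gamma> * card U \<le> card {x \<in> U0. s x Y = d}" for d
      using Y by (cases d) (simp_all add: Gd_def)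
    have e: "(x, y') \<in> parcs G \<longleftrightarrow> s x Y = s y' X" if "x \<in> U0" "y' \<in> C" for x y'
    proof -
      have "pt y' = Y" "y' \<in> V" "x \<in> V" "pt x = X"
        using that U0 sub[OF U'(1)] by (auto simp: C_def U0_def)
      then show ?thesis using edge[of x y'] Y GdN by auto
    qed
    have "\<not> regular_pair G \<gamma> \<gamma> U U'"
    proof (rule not_regular_pairI[where X\<^sub>1 = "{x \<in> U0. s x Y = b}" and X\<^sub>0 = "{x \<in> U0. s x Y = (\<not> b)}"
          and Y\<^sub>1 = "{y' \<in> C. s y' X = b}" and Y\<^sub>0 = "{y' \<in> C. s y' X = b}"])
      show "(x, y') \<in> parcs G" if "x \<in> {x \<in> U0. s x Y = b}" "y' \<in> {y' \<in> C. s y' X = b}" for x y'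
        using that e by auto
      show "(x, y') \<notin> parcs G" if "x \<in> {x \<in> U0. s x Y = (\<not> b)}" "y' \<in> {y' \<in> C. s y' X = b}" for x y'
        using that e by auto
    qed (use \<gamma> sub[OF U(1)] sub[OF U'(1)] splitY b' in \<open>auto simp: U0_def C_def\<close>)
    then show "y \<in> \<Union>Irr" using U' by (auto simp: Irr_def)
  qed
  then have "card W \<le> card (\<Union>Irr)"
    using sub finB by (intro card_mono) (auto simp: Irr_def)
  also have "\<dots> \<le> (\<Sum>U'\<in>Irr. card U')"
    by (rule card_Union_le_sum_card)
  finally have "card W * card B \<le> (\<Sum>U'\<in>Irr. card U') * card B" by simp
  then have "real (card W) * card B \<le> (\<Sum>U'\<in>Irr. real (card U')) * card B"
    by (metis of_nat_le_iff of_nat_mult of_nat_sum)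
  also have "\<dots> = (\<Sum>U'\<in>Irr. real (card U') * card B)"
    by (simp add: sum_distrib_right)
  also have "\<dots> \<le> (\<Sum>U'\<in>Irr. 2 * real (card V))"
    using equitable_partition_card_le(1)[OF B] by (intro sum_mono) (auto simp: Irr_def)
  also have "\<dots> = 2 * real (card Irr) * real (card V)" by simp
  finally have W1: "real (card W) * card B \<le> 2 * real (card Irr) * real (card V)" .
  have V: "card V = h * card P"
  proof -
    have "{x \<in> V. pt x \<in> P} = V" using P by auto
    then show ?thesis using card_fibres[OF B(2) P(1,3)] by simp
  qed
  have Gc: "card {x \<in> V. pt x \<in> Gd} = h * card Gd"
    using GdN N finite_subset[OF GdN finN] P by (intro card_fibres B) auto
  have "card {x \<in> V. pt x \<in> Gd} \<le> card (W \<union> {y \<in> Z. pt y \<in> N})"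
    using GdN B(2) by (intro card_mono) (auto simp: W_def Z)
  also have "\<dots> \<le> card W + card {y \<in> Z. pt y \<in> N}" by (rule card_Un_le)
  finally have "h * card Gd \<le> card W + card {y \<in> Z. pt y \<in> N}" by (simp add: Gc)
  moreover have "card N \<le> 7 * card Gd" using many by linarith
  then have "h * card N \<le> 7 * (h * card Gd)" using mult_le_mono2[of "card N" "7 * card Gd" h] by (simp only: ac_simps)
  moreover have "14 * card {y \<in> Z. pt y \<in> N} \<le> h * card N" using few by (simp only: mult.commute)
  ultimately have "h * card N \<le> 14 * card W" by linarith
  then have "real h * card N \<le> 14 * card W"
    by (metis of_nat_le_iff of_nat_mult of_nat_numeral)
  then have "real h * card N * card B \<le> 14 * real (card W) * real (card B)" by (intro mult_right_mono) auto
  also have "\<dots> \<le> 28 * real (card Irr) * real (card V)" using W1 by linarith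
  finally have "real h * (card N * card B) \<le> real h * (28 * card P * card Irr)"
    by (simp add: V algebra_simps)
  moreover have "0 < h"
  proof -
    have "0 < real (card U0)" using U0big Upos by linarith
    then obtain x where "x \<in> U0" by (metis card.empty ex_in_conv of_nat_0 less_irrefl)
    then have x: "x \<in> {x' \<in> V. pt x' = X}" "X \<in> P" using U0 P by (auto simp: U0_def)
    have "finite {x' \<in> V. pt x' = X}" using B(2) by simp
    then have "0 < card {x' \<in> V. pt x' = X}" using x(1) unfolding card_gt_0_iff by blast
    then show ?thesis using P(3)[OF x(2)] by simp
  qed
  ultimately have "real (card N * card B) \<le> 28 * card P * card Irr" by simp
  then show ?thesis unfolding Irr_def by (metis of_nat_le_iff of_nat_mult of_nat_numeral)
qed

text \<open>A vertex is exceptional either because its part has no centre, which costs 2 \<delta>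
  since a part has at most twice the average size, or because it lies off the centre of a
  concentrated part, which costs \<beta>.\<close>

lemma card_exceptional_vertices_le:
  fixes \<beta> \<delta> :: real
  assumes B: "equitable_partition V B" "finite V" and "0 \<le> \<beta>" "0 \<le> \<delta>"
    and Z: "Z = {y \<in> V. \<exists>U'\<in>B. y \<in> U' \<and> card {y' \<in> U'. pt y' = pt y} < (1 - \<beta>) * card U'}"
    and few: "card {U \<in> B. \<forall>X. card {x \<in> U. pt x = X} < (1 - \<beta>) * card U} \<le> \<delta> * card B"
  shows "card Z \<le> (2 * \<delta> + \<beta>) * card V"
proof -
  have part: "partition_on V B" using B(1) by (simp add: equitable_partition_def)
  have sub: "U' \<subseteq> V" "finite U'" "U' \<noteq> {}" if "U' \<in> B" for U'
    using partition_onD1[OF part] partition_onD3[OF part] B(2) that by (auto intro: finite_subset)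
  have finB: "finite B" using partition_onD1[OF part] B(2) by (metis finite_UnionD)
  have sumV: "card V = (\<Sum>X\<in>B. card X)"
    using product_partition[OF part] sub by blast
  define Bd where "Bd = {U \<in> B. \<forall>X. card {x \<in> U. pt x = X} < (1 - \<beta>) * card U}"
  define z where "z U = {y \<in> U. card {y' \<in> U. pt y' = pt y} < (1 - \<beta>) * card U}" for U
  have zU: "z U \<subseteq> U" for U by (auto simp: z_def)
  have "Z \<subseteq> (\<Union>U\<in>B. z U)" by (auto simp: Z z_def)
  then have "card Z \<le> card (\<Union>U\<in>B. z U)"
    using finB finite_subset[OF zU sub(2)] by (intro card_mono) auto
  also have "\<dots> \<le> (\<Sum>U\<in>B. card (z U))"
    using finB by (rule card_UN_le)
  finally have "real (card Z) \<le> (\<Sum>U\<in>B. real (card (z U)))"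
    by (metis of_nat_le_iff of_nat_sum)
  also have "\<dots> \<le> (\<Sum>U\<in>B. \<beta> * card U + (if U \<in> Bd then real (card U) else 0))"
  proof (rule sum_mono)
    fix U assume U: "U \<in> B"
    show "real (card (z U)) \<le> \<beta> * card U + (if U \<in> Bd then real (card U) else 0)"
    proof (cases "U \<in> Bd")
      case True
      have "real (card (z U)) \<le> card U" using card_mono[OF sub(2)[OF U] zU] by simp
      moreover have "0 \<le> \<beta> * card U" using assms by simp
      ultimately show ?thesis using True by simp
    next
      case False
      then obtain X where X: "(1 - \<beta>) * card U \<le> card {x \<in> U. pt x = X}"
        using U unfolding Bd_def by (auto simp: not_less)
      have "z U \<subseteq> U - {x \<in> U. pt x = X}"
      proof
        fix y assume y: "y \<in> z U"
        have "pt y \<noteq> X"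
        proof
          assume "pt y = X"
          with y X show False by (simp add: z_def)
        qed
        then show "y \<in> U - {x \<in> U. pt x = X}" using y zU by auto
      qed
      then have "card (z U) \<le> card (U - {x \<in> U. pt x = X})"
        using sub[OF U] by (intro card_mono) auto
      also have "\<dots> = card U - card {x \<in> U. pt x = X}"
        using sub[OF U] by (intro card_Diff_subset) auto
      finally have "card (z U) \<le> card U - card {x \<in> U. pt x = X}" .
      moreover have "card {x \<in> U. pt x = X} \<le> card U"
        using sub[OF U] by (intro card_mono) auto
      ultimately have "real (card (z U)) \<le> real (card U) - card {x \<in> U. pt x = X}" by linarith
      also have "\<dots> \<le> \<beta> * card U" using X by (simp add: algebra_simps)
      finally show ?thesis using False by simp
    qed
  qed
  also have "\<dots> = \<beta> * card V + (\<Sum>U\<in>Bd. real (card U))"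
  proof -
    have "(\<Sum>U\<in>B. (if U \<in> Bd then real (card U) else 0)) = (\<Sum>U\<in>Bd. real (card U))"
      using finB by (subst sum.inter_restrict[symmetric]) (auto simp: Bd_def Int_def intro!: sum.cong)
    then show ?thesis by (simp add: sum.distrib sumV sum_distrib_left)
  qed
  also have "(\<Sum>U\<in>Bd. real (card U)) \<le> 2 * \<delta> * card V"
  proof (cases "B = {}")
    case True then show ?thesis using assms(4) by (simp add: Bd_def)
  next
    case False
    then have b: "0 < real (card B)" using finB by (simp add: card_gt_0_iff)
    have "(\<Sum>U\<in>Bd. real (card U)) * card B = (\<Sum>U\<in>Bd. real (card U) * card B)"
      by (simp add: sum_distrib_right)
    also have "\<dots> \<le> (\<Sum>U\<in>Bd. 2 * real (card V))"
      using equitable_partition_card_le(1)[OF B] by (intro sum_mono) (auto simp: Bd_def)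
    also have "\<dots> = real (card Bd) * (2 * real (card V))" by simp
    also have "\<dots> \<le> (\<delta> * real (card B)) * (2 * real (card V))"
      using few unfolding Bd_def by (intro mult_right_mono) auto
    also have "\<dots> = (2 * \<delta> * card V) * card B" by simp
    finally show ?thesis using b by (simp only: mult_le_cancel_right_pos)
  qed
  finally show ?thesis by (simp add: algebra_simps)
qed

lemma sum_irregular_partners_le:
  assumes "finite B" "A \<subseteq> B"
    and "card {(U, U') \<in> B \<times> B. \<not> regular_pair G \<gamma> \<gamma> U U'} \<le> \<gamma> * (real (card B))\<^sup>2"
  shows "(\<Sum>U\<in>A. real (card {U' \<in> B. \<not> regular_pair G \<gamma> \<gamma> U U'})) \<le> \<gamma> * (real (card B))\<^sup>2"
proof -
  have "(\<Sum>U\<in>A. real (card {U' \<in> B. \<not> regular_pair G \<gamma> \<gamma> U U'})) \<le>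
    (\<Sum>U\<in>B. real (card {U' \<in> B. \<not> regular_pair G \<gamma> \<gamma> U U'}))"
    using assms by (intro sum_mono2) auto
  also have "\<dots> = card (SIGMA U:B. {U' \<in> B. \<not> regular_pair G \<gamma> \<gamma> U U'})"
    using assms by simp
  also have "(SIGMA U:B. {U' \<in> B. \<not> regular_pair G \<gamma> \<gamma> U U'}) = {(U, U') \<in> B \<times> B. \<not> regular_pair G \<gamma> \<gamma> U U'}"
    by auto
  finally show ?thesis using assms(3) by linarith
qed

text \<open>The start of the induction, where no earlier concentration is available. A part without
  a centre has two classes of share \<gamma> each, and a class \<open>b\<close> that separates them
  completely makes it irregular to every part with a share \<gamma> of \<open>b\<close>. Such parts
  must hold half of the fibre of \<open>b\<close>, so there are at least |B| / (4 |P|) of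
  them.\<close>

lemma card_unconcentrated_parts_le:
  fixes G :: "'v pair_pre_digraph" and pt :: "'v \<Rightarrow> 'p" and \<gamma> :: real
  defines "V \<equiv> pverts G"
  assumes B: "equitable_partition V B" "finite V" "V \<noteq> {}"
    and reg: "card {(U, U') \<in> B \<times> B. \<not> regular_pair G \<gamma> \<gamma> U U'} \<le> \<gamma> * (real (card B))\<^sup>2"
    and P: "finite P" "pt ` V \<subseteq> P" "\<And>X. X \<in> P \<Longrightarrow> card {x \<in> V. pt x = X} = h"
    and \<gamma>: "0 < \<gamma>" "2 * card P * \<gamma> \<le> 1"
    and sep: "\<And>a a'. a \<in> P \<Longrightarrow> a' \<in> P \<Longrightarrow> a \<noteq> a' \<Longrightarrow> \<exists>b\<in>P. \<exists>c.
      (\<forall>x\<in>V. \<forall>y\<in>V. pt x = a \<longrightarrow> pt y = b \<longrightarrow> ((x, y) \<in> parcs G \<longleftrightarrow> c)) \<and>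
      (\<forall>x\<in>V. \<forall>y\<in>V. pt x = a' \<longrightarrow> pt y = b \<longrightarrow> ((x, y) \<in> parcs G \<longleftrightarrow> \<not> c))"
  shows "card {U \<in> B. \<forall>X. card {x \<in> U. pt x = X} < (1 - card P * \<gamma>) * card U} \<le> 4 * card P * \<gamma> * card B"
proof -
  have part: "partition_on V B" using B(1) by (simp add: equitable_partition_def)
  have sub: "U' \<subseteq> V" "finite U'" "U' \<noteq> {}" if "U' \<in> B" for U'
    using partition_onD1[OF part] partition_onD3[OF part] B(2) that by (auto intro: finite_subset)
  have finB: "finite B" using partition_onD1[OF part] B(2) by (metis finite_UnionD)
  have Bne: "B \<noteq> {}" using partition_onD1[OF part] B(3) by auto
  define m n b where "m = real (card P)" and "n = real (card V)" and "b = real (card B)"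
  have b: "0 < b" using finB Bne by (simp add: b_def card_gt_0_iff)
  have n: "0 < n" using B by (simp add: n_def card_gt_0_iff)
  have "P \<noteq> {}" using P B(3) by auto
  then have m: "0 < m" using P by (simp add: m_def card_gt_0_iff)
  have nh: "n = m * h"
  proof -
    have "{x \<in> V. pt x \<in> P} = V" using P by auto
    then show ?thesis using card_fibres[OF B(2) P(1,3)] by (simp add: n_def m_def)
  qed
  have m1: "1 \<le> m" using m by (simp add: m_def)
  have "\<gamma> * 1 \<le> \<gamma> * m" using m1 \<gamma>(1) by (intro mult_left_mono) auto
  moreover have "2 * (\<gamma> * m) \<le> 1" using \<gamma>(2) by (simp add: m_def mult.commute mult.left_commute)
  ultimately have \<gamma>1: "\<gamma> < 1" using \<gamma>(1) by linarith
  define Bd where "Bd = {U \<in> B. \<forall>X. card {x \<in> U. pt x = X} < (1 - m * \<gamma>) * card U}"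
  have irr: "b / (4 * m) \<le> card {U' \<in> B. \<not> regular_pair G \<gamma> \<gamma> U U'}" if U: "U \<in> Bd" for U
  proof -
    have UB: "U \<in> B" and small: "\<And>X. card {x \<in> U. pt x = X} < (1 - m * \<gamma>) * card U"
      using U by (auto simp: Bd_def)
    note sU = sub[OF UB]
    have sumU: "real (card U) = (\<Sum>X\<in>P. real (card {x \<in> U. pt x = X}))"
    proof -
      have "U = (\<Union>X\<in>P. {x \<in> U. pt x = X})" using sU P by auto
      then have "card U = card (\<Union>X\<in>P. {x \<in> U. pt x = X})" by simp
      also have "\<dots> = (\<Sum>X\<in>P. card {x \<in> U. pt x = X})"
        using sU P by (intro card_UN_disjoint) auto
      finally show ?thesis by simp
    qed
    define H where "H = {X \<in> P. \<gamma> * card U \<le> card {x \<in> U. pt x = X}}"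
    \<comment> \<open>If all classes but \<open>a\<close> were below the share \<gamma>, they would
      total at most m \<gamma> |U|, while \<open>a\<close> alone misses more than that.\<close>
    have notsing: "\<not> H \<subseteq> {a}" if a: "a \<in> P" for a
    proof
      assume Ha: "H \<subseteq> {a}"
      have "real (card U) = real (card {x \<in> U. pt x = a}) + (\<Sum>X\<in>P - {a}. real (card {x \<in> U. pt x = X}))"
        unfolding sumU using a P(1) by (subst sum.remove[of P a]) auto
      also have "\<dots> \<le> real (card {x \<in> U. pt x = a}) + (\<Sum>X\<in>P - {a}. \<gamma> * card U)"
        using Ha by (intro add_left_mono sum_mono) (auto simp: H_def not_le)
      also have "\<dots> = real (card {x \<in> U. pt x = a}) + real (card P - 1) * (\<gamma> * card U)"
        using a P(1) by simp
      also have "\<dots> \<le> real (card {x \<in> U. pt x = a}) + m * (\<gamma> * card U)"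
        using \<gamma>(1) by (intro add_left_mono mult_right_mono) (auto simp: m_def)
      also have "\<dots> < card U" using small[of a] by (simp add: algebra_simps)
      finally show False by simp
    qed
    obtain p where "p \<in> P" using \<open>P \<noteq> {}\<close> by auto
    then obtain a where a: "a \<in> H" using notsing[of p] by auto
    then have aP: "a \<in> P" by (simp add: H_def)
    then obtain a' where a': "a' \<in> H" "a \<noteq> a'" using notsing[of a] by auto
    then have a'P: "a' \<in> P" by (simp add: H_def)
    from sep[OF aP a'P a'(2)] obtain q c where q: "q \<in> P"
      and ac': "\<forall>x\<in>V. \<forall>y\<in>V. pt x = a \<longrightarrow> pt y = q \<longrightarrow> ((x, y) \<in> parcs G \<longleftrightarrow> c)"
      and a'c': "\<forall>x\<in>V. \<forall>y\<in>V. pt x = a' \<longrightarrow> pt y = q \<longrightarrow> ((x, y) \<in> parcs G \<longleftrightarrow> \<not> c)"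
      by (elim bexE exE conjE)
    have ac: "(x, y) \<in> parcs G \<longleftrightarrow> c" if "x \<in> V" "y \<in> V" "pt x = a" "pt y = q" for x y
      using ac'[rule_format, OF that] .
    have a'c: "(x, y) \<in> parcs G \<longleftrightarrow> \<not> c" if "x \<in> V" "y \<in> V" "pt x = a'" "pt y = q" for x y
      using a'c'[rule_format, OF that] .
    define Q where "Q = {U' \<in> B. \<gamma> * card U' \<le> card {y \<in> U'. pt y = q}}"
    have "Q \<subseteq> {U' \<in> B. \<not> regular_pair G \<gamma> \<gamma> U U'}"
    proof
      fix U' assume U': "U' \<in> Q"
      then have U'B: "U' \<in> B" by (simp add: Q_def)
      note sU' = sub[OF U'B]
      define a1 a0 where "a1 = (if c then a else a')" and "a0 = (if c then a' else a)"
      have e1: "(x, y) \<in> parcs G" if "x \<in> V" "y \<in> V" "pt x = a1" "pt y = q" for x y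
        using ac[of x y] a'c[of x y] that by (cases c) (auto simp: a1_def)
      have e0: "(x, y) \<notin> parcs G" if "x \<in> V" "y \<in> V" "pt x = a0" "pt y = q" for x y
        using ac[of x y] a'c[of x y] that by (cases c) (auto simp: a0_def)
      have h10: "a1 \<in> H" "a0 \<in> H" using a a' by (auto simp: a1_def a0_def)
      have "\<not> regular_pair G \<gamma> \<gamma> U U'"
      proof (rule not_regular_pairI[where X\<^sub>1 = "{x \<in> U. pt x = a1}" and X\<^sub>0 = "{x \<in> U. pt x = a0}"
            and Y\<^sub>1 = "{y \<in> U'. pt y = q}" and Y\<^sub>0 = "{y \<in> U'. pt y = q}"])
        show "(x, y) \<in> parcs G" if "x \<in> {x \<in> U. pt x = a1}" "y \<in> {y \<in> U'. pt y = q}" for x y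
          using that e1 sU sU' by blast
        show "(x, y) \<notin> parcs G" if "x \<in> {x \<in> U. pt x = a0}" "y \<in> {y \<in> U'. pt y = q}" for x y
          using that e0 sU sU' by blast
      qed (use \<gamma> \<gamma>1 sU sU' h10 U' in \<open>auto simp: H_def Q_def\<close>)
      then show "U' \<in> {U' \<in> B. \<not> regular_pair G \<gamma> \<gamma> U U'}" using U'B by simp
    qed
    then have Qle: "card Q \<le> card {U' \<in> B. \<not> regular_pair G \<gamma> \<gamma> U U'}"
      using finB by (intro card_mono) auto
    have sumB: "card V = (\<Sum>X\<in>B. card X)"
      using product_partition[OF part] sub by blast
    have "{y \<in> V. pt y = q} = (\<Union>U'\<in>B. {y \<in> U'. pt y = q})"
      using partition_onD1[OF part] by auto
    then have "card {y \<in> V. pt y = q} \<le> (\<Sum>U'\<in>B. card {y \<in> U'. pt y = q})"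
      using card_UN_le[OF finB, of "\<lambda>U'. {y \<in> U'. pt y = q}"] by simp
    then have "h \<le> (\<Sum>U'\<in>B. card {y \<in> U'. pt y = q})"
      using P(3)[OF q] by simp
    then have "real h \<le> (\<Sum>U'\<in>B. real (card {y \<in> U'. pt y = q}))"
      unfolding of_nat_sum[symmetric] of_nat_le_iff .
    \<comment> \<open>Parts outside \<open>Q\<close> contribute at most \<gamma> n altogether, which
      is at most half of the fibre size n / m.\<close>
    also have "\<dots> \<le> (\<Sum>U'\<in>B. \<gamma> * card U' + (if U' \<in> Q then 2 * n / b else 0))"
    proof (rule sum_mono)
      fix U' assume U': "U' \<in> B"
      have "card {y \<in> U'. pt y = q} \<le> card U'" using sub[OF U'] by (intro card_mono) auto
      moreover have "real (card U') \<le> 2 * n / b"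
        using equitable_partition_card_le(1)[OF B(1,2) U'] b by (simp add: n_def b_def field_simps)
      moreover have "0 \<le> \<gamma> * card U'" using \<gamma> by simp
      ultimately show "real (card {y \<in> U'. pt y = q}) \<le> \<gamma> * card U' + (if U' \<in> Q then 2 * n / b else 0)"
        using U' by (auto simp: Q_def not_le)
    qed
    also have "\<dots> = \<gamma> * n + card Q * (2 * n / b)"
    proof -
      have "{U' \<in> B. U' \<in> Q} = Q" by (auto simp: Q_def)
      then have "(\<Sum>U'\<in>B. (if U' \<in> Q then 2 * n / b else 0)) = card Q * (2 * n / b)"
        using finB by (simp add: sum.inter_filter[symmetric])
      then show ?thesis by (simp add: sum.distrib sumB sum_distrib_left n_def)
    qed
    finally have 1: "n / m \<le> \<gamma> * n + card Q * (2 * n / b)" using m by (simp add: nh)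
    have "m * (\<gamma> * n) \<le> n / 2" using mult_right_mono[OF \<gamma>(2), of n] n by (simp add: m_def)
    then have "\<gamma> * n \<le> n / (2 * m)" using m by (simp add: field_simps)
    with 1 have "n / m \<le> n / (2 * m) + card Q * (2 * n / b)" by linarith
    then have "n * (1 / (2 * m)) \<le> n * (card Q * (2 / b))" using m b by (simp add: field_simps)
    then have "1 / (2 * m) \<le> card Q * (2 / b)" using n by (simp only: mult_le_cancel_left_pos)
    then have "b / (4 * m) \<le> card Q" using m b by (simp add: field_simps)
    then show ?thesis using Qle by linarith
  qed
  have "card Bd * (b / (4 * m)) = (\<Sum>U\<in>Bd. b / (4 * m))" by simp
  also have "\<dots> \<le> (\<Sum>U\<in>Bd. real (card {U' \<in> B. \<not> regular_pair G \<gamma> \<gamma> U U'}))"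
    using irr by (intro sum_mono) auto
  also have "\<dots> \<le> \<gamma> * (real (card B))\<^sup>2"
    using finB reg by (intro sum_irregular_partners_le) (auto simp: Bd_def)
  finally have "card Bd * (b / (4 * m)) \<le> \<gamma> * b * b" by (simp add: b_def power2_eq_square)
  then have "b * card Bd \<le> b * (4 * m * \<gamma> * b)" using m by (simp add: field_simps)
  then have "card Bd \<le> 4 * m * \<gamma> * b" using b by (simp only: mult_le_cancel_left_pos)
  then show ?thesis by (simp add: Bd_def m_def b_def)
qed

text \<open>Parts that lose their centre at stage i + 1 are of two kinds. If the neighbourhood of
  the old centre is mostly unexceptional, the part is irregular to many others; these families are
  disjoint for different stages, so one budget \<gamma> |B|^2 pays for all stages together.
  Otherwise the old centre is one of the few exceptional paths, and few vertices lie over those;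
  this is charged to \<open>\<phi> i\<close>. Each kind and the start get \<eta> / 4, and staying
  below \<eta> is what keeps the exceptional vertices under control at the next stage.\<close>

lemma refinement_propagates:
  fixes G :: "'v pair_pre_digraph" and pt :: "nat \<Rightarrow> 'v \<Rightarrow> 'p" and N :: "nat \<Rightarrow> 'p \<Rightarrow> 'p set"
    and s :: "nat \<Rightarrow> 'v \<Rightarrow> 'p \<Rightarrow> bool" and \<gamma> \<eta> \<zeta> :: real and \<beta> \<phi> :: "nat \<Rightarrow> real"
  defines "V \<equiv> pverts G"
  assumes B: "equitable_partition V B" "finite V" "V \<noteq> {}"
    and reg: "card {(U, U') \<in> B \<times> B. \<not> regular_pair G \<gamma> \<gamma> U U'} \<le> \<gamma> * (real (card B))\<^sup>2"
    and P: "\<And>i. i \<le> E \<Longrightarrow> finite (P i)" "\<And>i. i \<le> E \<Longrightarrow> pt i ` V \<subseteq> P i"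
      "\<And>i X. i \<le> E \<Longrightarrow> X \<in> P i \<Longrightarrow> card {x \<in> V. pt i x = X} = h i"
    and N: "\<And>i X. i < E \<Longrightarrow> X \<in> P i \<Longrightarrow> N i X \<subseteq> P i" "\<And>i X. i < E \<Longrightarrow> X \<in> P i \<Longrightarrow> card (N i X) = D i"
    and edge: "\<And>i x y. i < E \<Longrightarrow> x \<in> V \<Longrightarrow> y \<in> V \<Longrightarrow> pt i y \<in> N i (pt i x) \<Longrightarrow>
      (x, y) \<in> parcs G \<longleftrightarrow> s i x (pt i y) = s i y (pt i x)"
    and dist: "\<And>i x x'. i < E \<Longrightarrow> x \<in> V \<Longrightarrow> x' \<in> V \<Longrightarrow> pt i x = pt i x' \<Longrightarrow> pt (Suc i) x \<noteq> pt (Suc i) x' \<Longrightarrow>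
      D i \<le> 4 * card {Y \<in> N i (pt i x). s i x Y \<noteq> s i x' Y}"
    and const: "\<And>i x x' Y. i < E \<Longrightarrow> x \<in> V \<Longrightarrow> x' \<in> V \<Longrightarrow> pt (Suc i) x = pt (Suc i) x' \<Longrightarrow>
      Y \<in> N i (pt i x) \<Longrightarrow> s i x Y = s i x' Y"
    and \<beta>: "\<And>i. \<beta> (Suc i) = \<beta> i + 8 * \<gamma>" "0 \<le> \<beta> 0" "\<beta> E \<le> 1 / 4"
    and \<gamma>: "0 < \<gamma>" "\<gamma> \<le> 1 / 64"
    and exc: "\<And>i w. i < E \<Longrightarrow> (\<And>Y. Y \<in> P i \<Longrightarrow> 0 \<le> w Y \<and> w Y \<le> 1) \<Longrightarrow> sum w (P i) \<le> \<zeta> * card (P i) \<Longrightarrow>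
      card {X \<in> P i. D i < 14 * sum w (N i X)} \<le> \<phi> i * card (P i)"
    and \<zeta>: "2 * \<eta> + \<beta> E \<le> \<zeta>" and \<eta>: "0 < \<eta>"
    and init: "card {U \<in> B. \<forall>X. card {x \<in> U. pt 0 x = X} < (1 - \<beta> 0) * card U} \<le> \<eta> / 4 * card B"
    and \<phi>: "(\<Sum>i<E. 4 * \<phi> i) \<le> \<eta> / 4" "\<And>i. i < E \<Longrightarrow> 0 \<le> \<phi> i"
    and dens: "\<And>i. i < E \<Longrightarrow> 112 * \<gamma> * card (P i) \<le> \<eta> * D i"
  shows "card {U \<in> B. \<exists>i\<le>E. \<forall>X. card {x \<in> U. pt i x = X} < (1 - \<beta> i) * card U} \<le> \<eta> * card B"
proof -
  have part: "partition_on V B" using B(1) by (simp add: equitable_partition_def)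
  have sub: "U' \<subseteq> V" "finite U'" "U' \<noteq> {}" if "U' \<in> B" for U'
    using partition_onD1[OF part] partition_onD3[OF part] B(2) that by (auto intro: finite_subset)
  have finB: "finite B" using partition_onD1[OF part] B(2) by (metis finite_UnionD)
  have Bne: "B \<noteq> {}" using partition_onD1[OF part] B(3) by auto
  define n b where "n = real (card V)" and "b = real (card B)"
  have b: "0 < b" using finB Bne by (simp add: b_def card_gt_0_iff)
  have n: "0 < n" using B by (simp add: n_def card_gt_0_iff)
  have Pne: "P i \<noteq> {}" if "i \<le> E" for i using P(2)[OF that] B(3) by auto
  have nh: "n = h i * card (P i)" if "i \<le> E" for i
  proof -
    have "{x \<in> V. pt i x \<in> P i} = V" using P(2)[OF that] by auto
    then show ?thesis
      using card_fibres[OF B(2) P(1)[OF that] P(3)[OF that]] by (simp add: n_def)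
  qed
  have h: "0 < real (h i)" if "i \<le> E" for i
    using nh[OF that] n by (cases "h i = 0") auto
  have \<beta>lin: "\<beta> i = \<beta> 0 + 8 * \<gamma> * i" for i
    by (induction i) (auto simp: \<beta>(1) algebra_simps)
  have \<beta>mono: "\<beta> i \<le> \<beta> E" if "i \<le> E" for i
    using that \<gamma>(1) by (auto simp: \<beta>lin[of i] \<beta>lin[of E])
  have \<beta>0: "0 \<le> \<beta> i" for i using \<beta>(2) \<gamma>(1) by (simp add: \<beta>lin[of i])
  define bad where "bad i U \<longleftrightarrow> (\<forall>X. card {x \<in> U. pt i x = X} < (1 - \<beta> i) * card U)" for i U
  define Bd where "Bd j = {U \<in> B. \<exists>i\<le>j. bad i U}" for j
  \<comment> \<open>Concentration is lost for the first time after stage \<open>i\<close>; asking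
    for all earlier stages to be good is what makes these families disjoint.\<close>
  define New where "New i = {U \<in> B. (\<forall>k\<le>i. \<not> bad k U) \<and> bad (Suc i) U}" for i
  define Z where "Z i = {y \<in> V. \<exists>U'\<in>B. y \<in> U' \<and> card {y' \<in> U'. pt i y' = pt i y} < (1 - \<beta> i) * card U'}" for i
  \<comment> \<open>The exceptional share of the fibre over \<open>Y\<close>, normalised to a weight
    between 0 and 1 as \<open>exc\<close> expects.\<close>
  define w where "w i Y = real (card {y \<in> Z i. pt i y = Y}) / h i" for i Y
  define F where "F i = {X \<in> P i. D i < 14 * sum (w i) (N i X)}" for i
  define cen where "cen i U = (SOME X. (1 - \<beta> i) * card U \<le> card {x \<in> U. pt i x = X})" for i U
  define NF where "NF i = {U \<in> New i. cen i U \<notin> F i}" for i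
  have cen: "(1 - \<beta> i) * card U \<le> card {x \<in> U. pt i x = cen i U}" if "U \<in> New i" for i U
  proof -
    have "\<not> bad i U" using that by (auto simp: New_def)
    then have "\<exists>X. (1 - \<beta> i) * card U \<le> card {x \<in> U. pt i x = X}" by (auto simp: bad_def not_less)
    then show ?thesis unfolding cen_def by (rule someI_ex)
  qed
  have NewB: "New i \<subseteq> B" for i by (auto simp: New_def)
  have big: "(3/4) * card U \<le> card {x \<in> U. pt i x = cen i U}" if "U \<in> New i" "i \<le> E" for i U
  proof -
    have "(3/4) * card U \<le> (1 - \<beta> i) * card U"
      using \<beta>mono[OF that(2)] \<beta>(3) by (intro mult_right_mono) auto
    then show ?thesis using cen[OF that(1)] by linarith
  qed
  have cenP: "cen i U \<in> P i" if U: "U \<in> New i" "i \<le> E" for i U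
  proof -
    have "U \<in> B" using U NewB by auto
    have "0 < real (card U)" using sub[OF \<open>U \<in> B\<close>] by (simp add: card_gt_0_iff)
    then have "card {x \<in> U. pt i x = cen i U} \<noteq> 0" using big[OF U] by auto
    then obtain x where "x \<in> U" "pt i x = cen i U" by (metis (mono_tags, lifting) card.empty empty_Collect_eq)
    moreover from this have "x \<in> V" using sub(1)[OF \<open>U \<in> B\<close>] by blast
    then have "pt i x \<in> P i" using P(2)[OF U(2)] by blast
    ultimately show ?thesis by simp
  qed
  have wsum: "sum (w i) M = card {y \<in> Z i. pt i y \<in> M} / h i" if "finite M" for i M
  proof -
    have "{y \<in> Z i. pt i y \<in> M} = (\<Union>Y\<in>M. {y \<in> Z i. pt i y = Y})" by auto
    also have "card \<dots> = (\<Sum>Y\<in>M. card {y \<in> Z i. pt i y = Y})"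
      using that B(2) by (intro card_UN_disjoint) (auto simp: Z_def)
    finally show ?thesis by (simp add: w_def sum_divide_distrib)
  qed
  have irr: "4 * \<gamma> * b / \<eta> \<le> card {U' \<in> B. \<not> regular_pair G \<gamma> \<gamma> U U'}" if i: "i < E" and U: "U \<in> NF i" for i U
  proof -
    have UN: "U \<in> New i" using U by (simp add: NF_def)
    have iE: "i \<le> E" using i by simp
    have cP: "cen i U \<in> P i" using cenP[OF UN iE] .
    have finN: "finite (N i (cen i U))" using N(1)[OF i cP] P(1)[OF iE] finite_subset by auto
    have "14 * sum (w i) (N i (cen i U)) \<le> D i" using U cP by (auto simp: NF_def F_def)
    then have few: "14 * card {y \<in> Z i. pt i y \<in> N i (cen i U)} \<le> D i * h i"
      using wsum[OF finN] h[OF iE] by (simp add: field_simps flip: of_nat_mult of_nat_le_iff)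
    have "card (N i (cen i U)) * card B \<le> 28 * card (P i) * card {U' \<in> B. \<not> regular_pair G \<gamma> \<gamma> U U'}"
    proof (rule irregular_partners_of_split_part[where pt = "pt i" and ch = "pt (Suc i)" and s = "s i"
          and \<beta> = "\<beta> i" and X = "cen i U" and Z = "Z i" and h = "h i"])
      show "equitable_partition (pverts G) B" "finite (pverts G)" using B by (auto simp: V_def)
      show "finite (P i)" "pt i ` pverts G \<subseteq> P i" using P iE by (auto simp: V_def)
      show "card {x \<in> pverts G. pt i x = X} = h i" if "X \<in> P i" for X
        using P(3)[OF iE that] by (simp add: V_def)
      show "N i (cen i U) \<subseteq> P i" using N(1)[OF i cP] .
      show "((x, y) \<in> parcs G) = (s i x (pt i y) = s i y (cen i U))"
        if "x \<in> pverts G" "y \<in> pverts G" "pt i x = cen i U" "pt i y \<in> N i (cen i U)" for x y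
        using edge[OF i, of x y] that by (simp add: V_def)
      show "card (N i (cen i U)) \<le> 4 * card {Y \<in> N i (cen i U). s i x Y \<noteq> s i x' Y}"
        if "x \<in> pverts G" "x' \<in> pverts G" "pt i x = cen i U" "pt i x' = cen i U" "pt (Suc i) x \<noteq> pt (Suc i) x'" for x x'
        using dist[OF i, of x x'] that N(2)[OF i cP] by (simp add: V_def)
      show "s i x Y = s i x' Y" if "x \<in> pverts G" "x' \<in> pverts G" "pt i x = cen i U" "pt i x' = cen i U"
        "pt (Suc i) x = pt (Suc i) x'" "Y \<in> N i (cen i U)" for x x' Y
        using const[OF i, of x x' Y] that by (simp add: V_def)
      show "0 < \<gamma>" "\<gamma> \<le> 1 / 64" by (fact \<gamma>)+
      show "\<beta> i \<le> 1 / 4" using \<beta>mono[OF iE] \<beta>(3) by linarith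
      show "U \<in> B" using UN NewB by auto
      show "(1 - \<beta> i) * real (card U) \<le> real (card {x \<in> U. pt i x = cen i U})" using cen[OF UN] .
      show "real (card {x \<in> U. pt i x = cen i U \<and> pt (Suc i) x = c}) < (1 - \<beta> i - 8 * \<gamma>) * real (card U)" for c
      proof -
        have "card {x \<in> U. pt i x = cen i U \<and> pt (Suc i) x = c} \<le> card {x \<in> U. pt (Suc i) x = c}"
          using sub[OF \<open>U \<in> B\<close>] by (intro card_mono) auto
        moreover have "real (card {x \<in> U. pt (Suc i) x = c}) < (1 - \<beta> (Suc i)) * card U"
          using UN by (auto simp: New_def bad_def)
        ultimately show ?thesis by (simp add: \<beta>(1) diff_diff_eq)
      qed
      show "Z i = {y \<in> pverts G. \<exists>U'\<in>B. y \<in> U' \<and> real (card {y' \<in> U'. pt i y' = pt i y}) < (1 - \<beta> i) * real (card U')}"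
        by (simp add: Z_def V_def)
      show "14 * card {y \<in> Z i. pt i y \<in> N i (cen i U)} \<le> card (N i (cen i U)) * h i"
        using few N(2)[OF i cP] by simp
    qed
    then have "real (D i) * b \<le> 28 * real (card (P i)) * real (card {U' \<in> B. \<not> regular_pair G \<gamma> \<gamma> U U'})"
      unfolding N(2)[OF i cP] b_def by (metis of_nat_le_iff of_nat_mult of_nat_numeral)
    then have "(\<eta> * D i) * b \<le> \<eta> * (28 * real (card (P i)) * real (card {U' \<in> B. \<not> regular_pair G \<gamma> \<gamma> U U'}))"
      using \<eta> by simp
    moreover have "(112 * \<gamma> * card (P i)) * b \<le> (\<eta> * D i) * b"
      using dens[OF i] b by (intro mult_right_mono) auto
    ultimately have "(28 * real (card (P i))) * (4 * \<gamma> * b) \<le> (28 * real (card (P i))) * (\<eta> * real (card {U' \<in> B. \<not> regular_pair G \<gamma> \<gamma> U U'}))"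
      by (simp add: algebra_simps)
    moreover have "0 < 28 * real (card (P i))" using P(1)[OF iE] Pne[OF iE] by (simp add: card_gt_0_iff)
    ultimately have "4 * \<gamma> * b \<le> \<eta> * real (card {U' \<in> B. \<not> regular_pair G \<gamma> \<gamma> U U'})"
      by (simp only: mult_le_cancel_left_pos)
    then show ?thesis using \<eta> by (simp add: field_simps)
  qed
  have NFB: "NF i \<subseteq> B" for i using NewB by (auto simp: NF_def)
  have finNF: "finite (NF i)" for i using NFB finB finite_subset by blast
  have NFtotal: "(\<Sum>i<E. real (card (NF i))) \<le> \<eta> / 4 * b"
  proof -
    have disj: "NF i \<inter> NF j = {}" if "i < j" for i j
    proof -
      have "Suc i \<le> j" using that by simp
      then show ?thesis by (auto simp: NF_def New_def)
    qed
    have card_UN: "card (\<Union>i<E. NF i) = (\<Sum>i<E. card (NF i))"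
      using disj finNF by (intro card_UN_disjoint) (auto, metis disjoint_iff nat_neq_iff)
    have "(\<Sum>i<E. real (card (NF i))) * (4 * \<gamma> * b / \<eta>) = (\<Sum>U\<in>(\<Union>i<E. NF i). 4 * \<gamma> * b / \<eta>)"
      using card_UN by (simp flip: of_nat_sum)
    also have "\<dots> \<le> (\<Sum>U\<in>(\<Union>i<E. NF i). real (card {U' \<in> B. \<not> regular_pair G \<gamma> \<gamma> U U'}))"
      using irr by (intro sum_mono) auto
    also have "\<dots> \<le> \<gamma> * (real (card B))\<^sup>2"
      using finB reg NFB by (intro sum_irregular_partners_le) auto
    finally have "(4 * \<gamma> * b / \<eta>) * (\<Sum>i<E. real (card (NF i))) \<le> (4 * \<gamma> * b / \<eta>) * (\<eta> / 4 * b)"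
      using \<eta> by (simp add: b_def power2_eq_square algebra_simps)
    moreover have "0 < 4 * \<gamma> * b / \<eta>" using \<gamma> b \<eta> by simp
    ultimately show ?thesis by (simp only: mult_le_cancel_left_pos)
  qed
  have step: "card (New i) \<le> real (card (NF i)) + 4 * \<phi> i * b" if i: "i < E" and Bdi: "card (Bd i) \<le> \<eta> * b" for i
  proof -
    have iE: "i \<le> E" using i by simp
    have "card (Z i) \<le> (2 * \<eta> + \<beta> i) * card V"
    proof (rule card_exceptional_vertices_le[OF B(1,2)])
      show "0 \<le> \<beta> i" "0 \<le> \<eta>" using \<beta>0 \<eta> by auto
      have "{U \<in> B. \<forall>X. card {x \<in> U. pt i x = X} < (1 - \<beta> i) * card U} \<subseteq> Bd i"
        by (auto simp: Bd_def bad_def)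
      then have "card {U \<in> B. \<forall>X. card {x \<in> U. pt i x = X} < (1 - \<beta> i) * card U} \<le> card (Bd i)"
        using finB by (intro card_mono) (auto simp: Bd_def)
      then show "card {U \<in> B. \<forall>X. card {x \<in> U. pt i x = X} < (1 - \<beta> i) * card U} \<le> \<eta> * card B"
        using Bdi unfolding b_def by linarith
    qed (simp add: Z_def)
    also have "\<dots> \<le> \<zeta> * card V" using \<zeta> \<beta>mono[OF iE] by (intro mult_right_mono) auto
    finally have Zi: "card (Z i) \<le> \<zeta> * n" by (simp add: n_def)
    have "card (F i) \<le> \<phi> i * card (P i)"
      unfolding F_def
    proof (rule exc[OF i])
      fix Y assume Y: "Y \<in> P i"
      have "card {y \<in> Z i. pt i y = Y} \<le> card {y \<in> V. pt i y = Y}"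
        using B(2) by (intro card_mono) (auto simp: Z_def)
      then show "0 \<le> w i Y \<and> w i Y \<le> 1" using P(3)[OF iE Y] h[OF iE] by (simp add: w_def)
    next
      have "{y \<in> Z i. pt i y \<in> P i} = Z i" using P(2)[OF iE] by (auto simp: Z_def)
      then show "sum (w i) (P i) \<le> \<zeta> * card (P i)"
        using Zi h[OF iE] wsum[OF P(1)[OF iE]] by (simp add: nh[OF iE] field_simps)
    qed
    then have Fi: "h i * card (F i) \<le> \<phi> i * n"
      using h[OF iE] by (simp add: nh[OF iE] algebra_simps)
    \<comment> \<open>The cores of the parts centred in \<open>F i\<close> are disjoint and have at
      least 3/8 of the average part size: 3/4 from concentration and 1/2 from equitability.\<close>
    have "(\<Sum>U\<in>New i - NF i. (3/8) * (n / b)) \<le> (\<Sum>U\<in>New i - NF i. real (card {x \<in> U. pt i x = cen i U}))"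
    proof (rule sum_mono)
      fix U assume U: "U \<in> New i - NF i"
      then have "U \<in> B" using NewB by auto
      have "n / b \<le> 2 * card U"
        using equitable_partition_card_le(2)[OF B(1,2) \<open>U \<in> B\<close>] b by (simp add: n_def b_def field_simps)
      then show "(3/8) * (n / b) \<le> real (card {x \<in> U. pt i x = cen i U})"
        using big[of U i] U iE by auto
    qed
    also have "\<dots> = real (card (\<Union>U\<in>New i - NF i. {x \<in> U. pt i x = cen i U}))"
    proof -
      have finNew: "finite (New i - NF i)" using finite_subset[OF NewB finB] by simp
      have dis: "A \<inter> C = {}" if "A \<in> New i" "C \<in> New i" "A \<noteq> C" for A C
        using partition_onD2[OF part] that NewB by (meson disjointD subsetD)
      have "card (\<Union>U\<in>New i - NF i. {x \<in> U. pt i x = cen i U}) =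
          (\<Sum>U\<in>New i - NF i. card {x \<in> U. pt i x = cen i U})"
      proof (intro card_UN_disjoint ballI impI finNew)
        fix U assume "U \<in> New i - NF i"
        then have "U \<in> B" using NewB by auto
        then show "finite {x \<in> U. pt i x = cen i U}" using sub by simp
      next
        fix A C assume "A \<in> New i - NF i" "C \<in> New i - NF i" "A \<noteq> C"
        then have "A \<inter> C = {}" using dis by blast
        then show "{x \<in> A. pt i x = cen i A} \<inter> {x \<in> C. pt i x = cen i C} = {}" by blast
      qed
      then show ?thesis by simp
    qed
    also have "\<dots> \<le> card {x \<in> V. pt i x \<in> F i}"
    proof -
      have "(\<Union>U\<in>New i - NF i. {x \<in> U. pt i x = cen i U}) \<subseteq> {x \<in> V. pt i x \<in> F i}"
      proof
        fix x assume "x \<in> (\<Union>U\<in>New i - NF i. {x \<in> U. pt i x = cen i U})"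
        then obtain U where U: "U \<in> New i" "U \<notin> NF i" "x \<in> U" "pt i x = cen i U" by auto
        moreover from this have "x \<in> V" using sub(1)[of U] NewB[of i] by blast
        ultimately show "x \<in> {x \<in> V. pt i x \<in> F i}" by (auto simp: NF_def)
      qed
      then show ?thesis using B(2) by (simp add: card_mono)
    qed
    also have "\<dots> = h i * card (F i)"
    proof -
      have "card {x \<in> V. pt i x \<in> F i} = h i * card (F i)"
        using P(1,3)[OF iE] by (intro card_fibres B(2)) (auto simp: F_def)
      then show ?thesis by simp
    qed
    also have "\<dots> \<le> \<phi> i * n" by (rule Fi)
    finally have "n * (card (New i - NF i) * (3 / 8)) \<le> n * (\<phi> i * b)"
      using b by (simp add: field_simps)
    then have "card (New i - NF i) * (3 / 8) \<le> \<phi> i * b" using n by (simp only: mult_le_cancel_left_pos)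
    moreover have "0 \<le> \<phi> i * b" using \<phi>(2)[OF i] b by simp
    ultimately have "real (card (New i - NF i)) \<le> 4 * \<phi> i * b" by linarith
    moreover have "card (New i) \<le> card (NF i) + card (New i - NF i)"
      by (metis NF_def Un_Diff_cancel2 card_Un_le le_trans card_mono finNF finite_Diff finite_UnI finite_subset[OF NewB finB] sup_ge1 Un_commute)
    ultimately show ?thesis by linarith
  qed
  have Bd0: "card (Bd 0) \<le> \<eta> / 4 * b"
    using init by (simp add: Bd_def bad_def b_def)
  \<comment> \<open>A running sum is carried instead of the bound \<eta> b. At every step it is
    completed to all \<open>E\<close> stages to see that \<open>Bd j\<close> has at most \<eta> b
    members, the condition under which \<open>step\<close> applies.\<close>
  have "card (Bd j) \<le> \<eta> / 4 * b + (\<Sum>i<j. real (card (NF i)) + 4 * \<phi> i * b)" if "j \<le> E" for j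
    using that
  proof (induction j)
    case 0
    then show ?case using Bd0 by simp
  next
    case (Suc j)
    have "(\<Sum>i<j. real (card (NF i)) + 4 * \<phi> i * b) \<le> (\<Sum>i<E. real (card (NF i)) + 4 * \<phi> i * b)"
      using Suc.prems \<phi>(2) b by (intro sum_mono2) auto
    also have "\<dots> = (\<Sum>i<E. real (card (NF i))) + (\<Sum>i<E. 4 * \<phi> i) * b"
      by (simp add: sum.distrib sum_distrib_right)
    also have "\<dots> \<le> \<eta> / 4 * b + \<eta> / 4 * b"
      using NFtotal \<phi>(1) b by (intro add_mono mult_right_mono) auto
    finally have "card (Bd j) \<le> \<eta> / 4 * b + (\<eta> / 4 * b + \<eta> / 4 * b)"
      using Suc by linarith
    also have "\<dots> \<le> \<eta> * b" using \<eta> b by simp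
    finally have 1: "card (New j) \<le> real (card (NF j)) + 4 * \<phi> j * b"
      using Suc.prems by (intro step) auto
    have "Bd (Suc j) \<subseteq> Bd j \<union> New j"
      by (auto simp: Bd_def New_def le_Suc_eq)
    then have "card (Bd (Suc j)) \<le> card (Bd j \<union> New j)"
      using finB by (intro card_mono) (auto simp: Bd_def New_def)
    also have "\<dots> \<le> card (Bd j) + card (New j)" by (rule card_Un_le)
    finally show ?case using 1 Suc by simp
  qed
  from this[of E] have "card (Bd E) \<le> \<eta> / 4 * b + ((\<Sum>i<E. real (card (NF i))) + (\<Sum>i<E. 4 * \<phi> i) * b)"
    by (simp add: sum.distrib sum_distrib_right)
  also have "\<dots> \<le> \<eta> / 4 * b + (\<eta> / 4 * b + \<eta> / 4 * b)"
    using NFtotal \<phi>(1) b by (intro add_mono mult_right_mono) auto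
  also have "\<dots> \<le> \<eta> * b" using \<eta> b by simp
  finally show ?thesis by (simp add: Bd_def bad_def b_def)
qed

section \<open>Mean square density over the cells of a partition\<close>

lemma card_eq_sum_cells:
  assumes "partition_on V A" "finite V" "R \<subseteq> V \<times> V"
  shows "real (card R) = (\<Sum>U\<in>A. \<Sum>U'\<in>A. real (card (R \<inter> U \<times> U')))"
proof -
  have V: "V = \<Union>A" using partition_onD1[OF assms(1)] .
  have finA: "finite A" using V assms(2) by (metis finite_UnionD)
  have finR: "finite R" using assms(2,3) finite_subset by blast
  have disj: "U = U'" if "U \<in> A" "U' \<in> A" "x \<in> U" "x \<in> U'" for U U' x
    using partition_onD2[OF assms(1)] that by (metis IntI disjointD empty_iff)
  have "R = (\<Union>p\<in>A \<times> A. R \<inter> fst p \<times> snd p)" using assms(3) V by fastforce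
  then have "card R = card (\<Union>p\<in>A \<times> A. R \<inter> fst p \<times> snd p)" by simp
  also have "\<dots> = (\<Sum>p\<in>A \<times> A. card (R \<inter> fst p \<times> snd p))"
  proof (intro card_UN_disjoint ballI impI)
    fix p p' assume "p \<in> A \<times> A" "p' \<in> A \<times> A" "p \<noteq> p'"
    then show "R \<inter> fst p \<times> snd p \<inter> (R \<inter> fst p' \<times> snd p') = {}"
      using disj by (cases p; cases p') auto
  qed (use finA finR in auto)
  also have "\<dots> = (\<Sum>U\<in>A. \<Sum>U'\<in>A. card (R \<inter> U \<times> U'))"
    by (simp add: sum.cartesian_product case_prod_beta)
  finally show ?thesis by simp
qed

lemma mean_square_density_eq:
  assumes "finite (pverts G)" "pverts G \<noteq> {}"
  shows "mean_square_density G A * (real (card (pverts G)))\<^sup>2 =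
    (\<Sum>U\<in>A. \<Sum>U'\<in>A. (real (card (parcs G \<inter> U \<times> U')))\<^sup>2 / (real (card U) * real (card U')))"
proof -
  define n where "n = real (card (pverts G))"
  have n: "n \<noteq> 0" using assms by (simp add: n_def)
  have "(density G U U')\<^sup>2 * (card U / n) * (card U' / n) * n\<^sup>2 =
      (real (card (parcs G \<inter> U \<times> U')))\<^sup>2 / (real (card U) * real (card U'))" for U U'
  proof -
    have eq: "{(x, y) \<in> U \<times> U'. (x, y) \<in> parcs G} = parcs G \<inter> U \<times> U'" by auto
    show ?thesis
      unfolding density_def eq using n
      by (cases "card U = 0 \<or> card U' = 0") (auto simp: field_simps power2_eq_square)
  qed
  then show ?thesis
    unfolding mean_square_density_def n_def[symmetric] by (simp add: sum_distrib_right)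
qed

text \<open>The reference value \<open>card (parcs G)\<close> would be attained if all densities
  were 0 or 1. Each pair of \<open>T\<close>, being seen at density about 1/2, loses 1/4 against it,
  the variance of a fair bit; \<Delta> absorbs the imbalance.\<close>

lemma mean_square_density_le_of_balanced:
  fixes G :: "'v pair_pre_digraph"
  defines "V \<equiv> pverts G"
  assumes "finite V" "V \<noteq> {}" "parcs G \<subseteq> V \<times> V" "T \<subseteq> V \<times> V" and A: "partition_on V A"
    and bal: "\<And>U U'. U \<in> A \<Longrightarrow> U' \<in> A \<Longrightarrow>
      \<bar>real (card (parcs G \<inter> T \<inter> U \<times> U')) - real (card (T \<inter> U \<times> U')) / 2\<bar> \<le> \<Delta>"
  shows "mean_square_density G A * (real (card V))\<^sup>2 \<le> card (parcs G) - card T / 4 + 3 * (real (card A))\<^sup>2 * \<Delta>"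
proof -
  have sub: "U \<subseteq> V" "finite U" "U \<noteq> {}" if "U \<in> A" for U
    using partition_onD1[OF A] partition_onD3[OF A] assms(2) that by (auto intro: finite_subset)
  have finE: "finite (parcs G)" using assms(2,4) finite_subset by blast
  have finT: "finite T" using assms(2,5) finite_subset by blast
  have cell: "(real (card (parcs G \<inter> U \<times> U')))\<^sup>2 / (real (card U) * real (card U')) \<le>
      real (card (parcs G \<inter> U \<times> U')) - real (card (T \<inter> U \<times> U')) / 4 + 3 * \<Delta>"
    if U: "U \<in> A" "U' \<in> A" for U U'
  proof -
    define N e \<tau> e2 where "N = real (card U) * real (card U')" and "e = real (card (parcs G \<inter> U \<times> U'))"
      and "\<tau> = real (card (T \<inter> U \<times> U'))" and "e2 = real (card (parcs G \<inter> T \<inter> U \<times> U'))"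
    define e1 where "e1 = real (card (parcs G \<inter> U \<times> U' - T))"
    have N: "0 < N" using sub[OF U(1)] sub[OF U(2)] by (simp add: N_def card_gt_0_iff)
    have e: "e = e1 + e2"
    proof -
      have "parcs G \<inter> U \<times> U' = (parcs G \<inter> U \<times> U' - T) \<union> (parcs G \<inter> T \<inter> U \<times> U')" by auto
      then have "card (parcs G \<inter> U \<times> U') = card (parcs G \<inter> U \<times> U' - T) + card (parcs G \<inter> T \<inter> U \<times> U')"
        using finE by (subst card_Un_disjoint[symmetric]) auto
      then show ?thesis by (simp add: e_def e1_def e2_def)
    qed
    have e1N: "e1 + \<tau> \<le> N"
    proof -
      have "card ((parcs G \<inter> U \<times> U' - T) \<union> (T \<inter> U \<times> U')) \<le> card (U \<times> U')"
        using sub[OF U(1)] sub[OF U(2)] by (intro card_mono) auto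
      moreover have "card ((parcs G \<inter> U \<times> U' - T) \<union> (T \<inter> U \<times> U')) = card (parcs G \<inter> U \<times> U' - T) + card (T \<inter> U \<times> U')"
        using finE finT by (intro card_Un_disjoint) auto
      ultimately show ?thesis
        by (simp add: e1_def \<tau>_def N_def card_cartesian_product flip: of_nat_add of_nat_mult)
    qed
    have e2\<tau>: "e2 \<le> \<tau>" using finT by (auto simp: e2_def \<tau>_def intro!: card_mono)
    have pos: "0 \<le> e1" "0 \<le> e2" "0 \<le> \<tau>" by (auto simp: e1_def e2_def \<tau>_def)
    define \<delta> where "\<delta> = e2 - \<tau> / 2"
    have \<delta>: "\<bar>\<delta>\<bar> \<le> \<Delta>" using bal[OF U] by (simp add: \<delta>_def e2_def \<tau>_def)
    define H where "H = e1 + \<tau> / 2"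
    have eH: "e = H + \<delta>" by (simp add: e H_def \<delta>_def)
    have HN: "H \<le> N" "e \<le> N" "0 \<le> H" "0 \<le> e" using e1N e2\<tau> pos by (auto simp: H_def e)
    \<comment> \<open>Cauchy-Schwarz against a fictitious split of the cell into \<open>e1\<close>
      pairs of density 1, \<tau> pairs of density 1/2 and a rest of density 0.\<close>
    have "H\<^sup>2 \<le> (e1 + \<tau>) * (e1 + \<tau> / 4)"
      using pos by (simp add: H_def power2_eq_square algebra_simps)
    also have "\<dots> \<le> N * (e1 + \<tau> / 4)" using e1N pos by (intro mult_right_mono) auto
    finally have H2: "H\<^sup>2 \<le> N * (e1 + \<tau> / 4)" .
    have "e\<^sup>2 = H\<^sup>2 + (e + H) * \<delta>" by (simp add: eH power2_eq_square algebra_simps)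
    also have "\<dots> \<le> N * (e1 + \<tau> / 4) + (2 * N) * \<bar>\<delta>\<bar>"
    proof -
      have "(e + H) * \<delta> \<le> (e + H) * \<bar>\<delta>\<bar>" using HN by (intro mult_left_mono) auto
      also have "\<dots> \<le> (2 * N) * \<bar>\<delta>\<bar>" using HN by (intro mult_right_mono) auto
      finally show ?thesis using H2 by linarith
    qed
    also have "\<dots> = N * (e1 + \<tau> / 4 + 2 * \<bar>\<delta>\<bar>)" by (simp add: algebra_simps)
    finally have "e\<^sup>2 / N \<le> e1 + \<tau> / 4 + 2 * \<bar>\<delta>\<bar>" using N by (simp add: divide_le_eq mult.commute)
    also have "\<dots> \<le> e - \<tau> / 4 + 3 * \<Delta>"
    proof -
      have "2 * \<bar>\<delta>\<bar> \<le> \<delta> + 3 * \<Delta>" using \<delta> by (simp add: abs_if split: if_splits)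
      moreover have "e2 = \<tau> / 2 + \<delta>" by (simp add: \<delta>_def)
      ultimately show ?thesis unfolding e by simp
    qed
    finally show ?thesis by (simp add: N_def e_def \<tau>_def)
  qed
  have "mean_square_density G A * (real (card V))\<^sup>2 \<le>
    (\<Sum>U\<in>A. \<Sum>U'\<in>A. real (card (parcs G \<inter> U \<times> U')) - real (card (T \<inter> U \<times> U')) / 4 + 3 * \<Delta>)"
    using assms(2,3) cell unfolding V_def by (subst mean_square_density_eq) (auto intro!: sum_mono)
  also have "\<dots> = (\<Sum>U\<in>A. \<Sum>U'\<in>A. real (card (parcs G \<inter> U \<times> U')))
     - (\<Sum>U\<in>A. \<Sum>U'\<in>A. real (card (T \<inter> U \<times> U'))) / 4 + (\<Sum>U\<in>A. \<Sum>U'\<in>A. 3 * \<Delta>)"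
    by (simp only: sum.distrib sum_subtractf sum_divide_distrib)
  also have "\<dots> = card (parcs G) - card T / 4 + (\<Sum>U\<in>A. \<Sum>U'\<in>A. 3 * \<Delta>)"
    by (simp only: card_eq_sum_cells[OF A assms(2) assms(4)] card_eq_sum_cells[OF A assms(2) assms(5)])
  also have "(\<Sum>U\<in>A. \<Sum>U'\<in>A. 3 * \<Delta>) = 3 * (real (card A))\<^sup>2 * \<Delta>"
    by (simp add: power2_eq_square)
  finally show ?thesis .
qed

text \<open>A cell with \<open>e\<close> edges among \<open>N\<close> pairs falls short of the
  reference value \<open>e\<close> by e (N - e) / N. This is at most N / 4 in any case and at most
  \<theta> N for a nearly pure cell.\<close>

lemma mean_square_density_ge_of_pure:
  fixes G :: "'v pair_pre_digraph" and \<theta> :: real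
  defines "V \<equiv> pverts G"
  assumes "finite V" "V \<noteq> {}" "parcs G \<subseteq> V \<times> V" and B: "partition_on V B" and "0 \<le> \<theta>"
    and pure: "\<And>U U'. U \<in> B \<Longrightarrow> U' \<in> B \<Longrightarrow> (U, U') \<notin> Bad \<Longrightarrow>
      card (parcs G \<inter> U \<times> U') \<le> \<theta> * (card U * card U') \<or> card (U \<times> U' - parcs G) \<le> \<theta> * (card U * card U')"
  shows "card (parcs G) - \<theta> * (real (card V))\<^sup>2 - (\<Sum>U\<in>B. \<Sum>U'\<in>B. of_bool ((U, U') \<in> Bad) * (real (card U) * real (card U'))) / 4
     \<le> mean_square_density G B * (real (card V))\<^sup>2"
proof -
  have sub: "U \<subseteq> V" "finite U" "U \<noteq> {}" if "U \<in> B" for U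
    using partition_onD1[OF B] partition_onD3[OF B] assms(2) that by (auto intro: finite_subset)
  have finE: "finite (parcs G)" using assms(2,4) finite_subset by blast
  have cell: "real (card (parcs G \<inter> U \<times> U')) - \<theta> * (real (card U) * real (card U')) -
      of_bool ((U, U') \<in> Bad) * (real (card U) * real (card U')) / 4
      \<le> (real (card (parcs G \<inter> U \<times> U')))\<^sup>2 / (real (card U) * real (card U'))"
    if U: "U \<in> B" "U' \<in> B" for U U'
  proof -
    define N e where "N = real (card U) * real (card U')" and "e = real (card (parcs G \<inter> U \<times> U'))"
    have N: "0 < N" using sub[OF U(1)] sub[OF U(2)] by (simp add: N_def card_gt_0_iff)
    have eN: "e + card (U \<times> U' - parcs G) = N"
    proof -
      have "U \<times> U' = (parcs G \<inter> U \<times> U') \<union> (U \<times> U' - parcs G)" by auto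
      then have "card (U \<times> U') = card (parcs G \<inter> U \<times> U') + card (U \<times> U' - parcs G)"
        using sub[OF U(1)] sub[OF U(2)] finE by (subst card_Un_disjoint[symmetric]) auto
      then show ?thesis by (simp add: e_def N_def card_cartesian_product flip: of_nat_add of_nat_mult)
    qed
    have e0: "0 \<le> e" "e \<le> N" using eN by (auto simp: e_def)
    have "e - \<theta> * N - of_bool ((U, U') \<in> Bad) * N / 4 \<le> e\<^sup>2 / N"
    proof (cases "(U, U') \<in> Bad")
      case True
      have "0 \<le> (e - N / 2)\<^sup>2" by simp
      then have "(e - N / 4) * N \<le> e\<^sup>2" by (simp add: power2_eq_square algebra_simps)
      then have "e - N / 4 \<le> e\<^sup>2 / N" using N by (simp add: pos_le_divide_eq)
      moreover have "0 \<le> \<theta> * N" using assms(6) N by simp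
      ultimately show ?thesis using True by simp
    next
      case False
      have "e \<le> \<theta> * N \<or> N - e \<le> \<theta> * N"
        using pure[OF U False] eN by (auto simp: e_def N_def)
      then have "e * (N - e) \<le> N * (\<theta> * N)"
      proof
        assume "e \<le> \<theta> * N"
        then have "e * (N - e) \<le> (\<theta> * N) * N" using e0 assms(6) N by (intro mult_mono) auto
        then show ?thesis by (simp add: mult.commute)
      next
        assume "N - e \<le> \<theta> * N"
        then show ?thesis using e0 assms(6) N by (intro mult_mono) auto
      qed
      then have "(e - \<theta> * N) * N \<le> e\<^sup>2" by (simp add: power2_eq_square algebra_simps)
      then show ?thesis using N False by (simp add: pos_le_divide_eq)
    qed
    then show ?thesis by (simp add: N_def e_def)
  qed
  have VV: "(\<Sum>U\<in>B. \<Sum>U'\<in>B. real (card U) * real (card U')) = (real (card V))\<^sup>2"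
  proof -
    have "card V = (\<Sum>X\<in>B. card X)"
      using product_partition[OF B] sub by blast
    then show ?thesis by (simp add: power2_eq_square sum_product)
  qed
  have "card (parcs G) - \<theta> * (real (card V))\<^sup>2 - (\<Sum>U\<in>B. \<Sum>U'\<in>B. of_bool ((U, U') \<in> Bad) * (real (card U) * real (card U'))) / 4
    = (\<Sum>U\<in>B. \<Sum>U'\<in>B. real (card (parcs G \<inter> U \<times> U')) - \<theta> * (real (card U) * real (card U')) -
      of_bool ((U, U') \<in> Bad) * (real (card U) * real (card U')) / 4)"
    by (simp only: card_eq_sum_cells[OF B assms(2) assms(4)] VV[symmetric] sum_subtractf sum_distrib_left sum_divide_distrib)
  also have "\<dots> \<le> mean_square_density G B * (real (card V))\<^sup>2"
    using assms(2,3) cell unfolding V_def by (subst mean_square_density_eq) (auto intro!: sum_mono)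
  finally show ?thesis .
qed

section \<open>Codes and touching relations\<close>

text \<open>Exponential moments: weighting every element by 1/3, the weight that makes a quarter of
  \<open>N\<close> the typical size, each counted set has weight at least (1/3)^(D/4), and all sets
  together have (4/3)^D. Taking eighth powers reduces the rest to 2 (4/3)^8 9 < 2^8.\<close>

lemma card_small_subsets_bound:
  fixes N :: "'p set"
  assumes "finite N" "N \<noteq> {}"
  shows "2 powr (card N / 8) * card {T \<in> Pow N. 4 * card T < card N} < 2 ^ card N"
proof -
  define D where "D = card N"
  have D: "0 < D" using assms by (simp add: D_def card_gt_0_iff)
  define b where "b = real (card {T \<in> Pow N. 4 * card T < card N})"
  have "b * (1/3) powr (D / 4) = (\<Sum>T\<in>{T \<in> Pow N. 4 * card T < card N}. (1/3) powr (D / 4))"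
    by (simp add: b_def)
  also have "\<dots> \<le> (\<Sum>T\<in>{T \<in> Pow N. 4 * card T < card N}. (1/3) ^ card T)"
  proof (rule sum_mono)
    fix T assume "T \<in> {T \<in> Pow N. 4 * card T < card N}"
    then have "real (card T) \<le> D / 4" by (simp add: D_def)
    then have "(1/3 :: real) powr (D / 4) \<le> (1/3) powr (card T)" by (intro powr_mono') auto
    then show "(1/3 :: real) powr (D / 4) \<le> (1/3) ^ card T" by (simp add: powr_realpow)
  qed
  also have "\<dots> \<le> (\<Sum>T\<in>Pow N. (1/3) ^ card T)"
    using assms by (intro sum_mono2) auto
  also have "\<dots> = (4/3) ^ D"
    using prod_add[OF assms(1), of "\<lambda>_. 1/3 :: real" "\<lambda>_. 1"] by (simp add: D_def)
  finally have "b * (1/3) powr (D / 4) \<le> (4/3) ^ D" .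
  then have "b * (1/3) powr (D / 4) * 3 powr (D / 4) \<le> (4/3) ^ D * 3 powr (D / 4)"
    by (rule mult_right_mono) simp
  moreover have "(1/3 :: real) powr (D / 4) * 3 powr (D / 4) = 1"
    by (simp flip: powr_mult)
  then have "b * (1/3) powr (D / 4) * 3 powr (D / 4) = b" by (simp only: mult.assoc mult_1_right)
  ultimately have b: "b \<le> (4/3) ^ D * 3 powr (D / 4)" by linarith
  define \<rho> :: real where "\<rho> = 2 powr (1/8) * (4/3) * 3 powr (1/4)"
  have \<rho>8: "\<rho> ^ 8 = 2 * (4/3) ^ 8 * 9"
  proof -
    have "(2 powr (1/8) :: real) ^ 8 = 2" by (simp add: powr_powr flip: powr_realpow)
    moreover have "(3 powr (1/4) :: real) ^ 8 = 9" by (simp add: powr_powr flip: powr_realpow)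
    ultimately show ?thesis unfolding \<rho>_def power_mult_distrib by simp
  qed
  have "\<rho> < 2"
  proof (rule power_less_imp_less_base[of \<rho> 8])
    show "\<rho> ^ 8 < 2 ^ 8" unfolding \<rho>8 by (simp add: power_divide)
  qed simp
  have "2 powr (D / 8) * b \<le> 2 powr (D / 8) * ((4/3) ^ D * 3 powr (D / 4))"
    using b by (intro mult_left_mono) auto
  also have "\<dots> = \<rho> ^ D"
  proof -
    have "(2 powr (1/8) :: real) ^ D = 2 powr (D / 8)" "(3 powr (1/4) :: real) ^ D = 3 powr (D / 4)"
      by (simp_all add: powr_powr flip: powr_realpow)
    then show ?thesis unfolding \<rho>_def power_mult_distrib by simp
  qed
  also have "\<dots> < 2 ^ D" using \<open>\<rho> < 2\<close> D by (intro power_strict_mono) (auto simp: \<rho>_def)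
  finally show ?thesis by (simp add: b_def D_def)
qed

text \<open>Greedy Gilbert-Varshamov argument: a further codeword exists as long as the balls around
  the earlier ones do not cover the power set. Symmetric difference with \<open>C c\<close>
  translates a ball into the family of small sets.\<close>

lemma code_exists:
  fixes N :: "'p set"
  assumes "finite N" "real M \<le> 2 powr (card N / 8)"
  shows "\<exists>C :: nat \<Rightarrow> 'p set. (\<forall>c<M. C c \<subseteq> N) \<and>
    (\<forall>c<M. \<forall>c'<M. c \<noteq> c' \<longrightarrow> card N \<le> 4 * card (sym_diff (C c) (C c')))"
proof (cases "N = {}")
  case True
  then show ?thesis by (intro exI[of _ "\<lambda>_. {}"]) simp
next
  case False
  define b where "b = card {T \<in> Pow N. 4 * card T < card N}"
  have "real M * b < 2 ^ card N"
    using mult_right_mono[OF assms(2), of "real b"] card_small_subsets_bound[OF assms(1) False]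
    unfolding b_def by linarith
  then have Mb: "M * b < 2 ^ card N"
    by (metis of_nat_less_iff of_nat_mult of_nat_numeral of_nat_power)
  have "m \<le> M \<Longrightarrow> \<exists>C. (\<forall>c<m. C c \<subseteq> N) \<and>
    (\<forall>c<m. \<forall>c'<m. c \<noteq> c' \<longrightarrow> card N \<le> 4 * card (sym_diff (C c) (C c')))" for m
  proof (induction m)
    case 0 then show ?case by simp
  next
    case (Suc m)
    then obtain C where C: "\<forall>c<m. C c \<subseteq> N"
      "\<forall>c<m. \<forall>c'<m. c \<noteq> c' \<longrightarrow> card N \<le> 4 * card (sym_diff (C c) (C c'))" by auto
    define ball where "ball c = {T \<in> Pow N. 4 * card (sym_diff (C c) T) < card N}" for c
    have ball: "card (ball c) \<le> b" if "c < m" for c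
    proof -
      have "inj_on (sym_diff (C c)) (ball c)" by (intro inj_onI) blast
      moreover have "sym_diff (C c) ` ball c \<subseteq> {T \<in> Pow N. 4 * card T < card N}"
        using C that by (auto simp: ball_def)
      ultimately show ?thesis unfolding b_def using assms(1) by (intro card_inj_on_le) auto
    qed
    have "card (\<Union>c<m. ball c) \<le> (\<Sum>c<m. card (ball c))" by (intro card_UN_le) auto
    also have "\<dots> \<le> (\<Sum>c<m. b)" using ball by (intro sum_mono) auto
    also have "\<dots> \<le> M * b" using Suc.prems by simp
    also have "\<dots> < card (Pow N)" using Mb assms(1) by (simp add: card_Pow)
    finally have "\<not> Pow N \<subseteq> (\<Union>c<m. ball c)"
      using card_mono[of "\<Union>c<m. ball c" "Pow N"] assms(1) by (auto simp: ball_def)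
    then obtain T where "T \<in> Pow N" "T \<notin> (\<Union>c<m. ball c)" by blast
    then have T: "T \<subseteq> N" "\<And>c. c < m \<Longrightarrow> card N \<le> 4 * card (sym_diff (C c) T)"
      unfolding ball_def by (auto simp: not_less)
    have T': "card N \<le> 4 * card (sym_diff T (C c))" if "c < m" for c
      using T(2)[OF that] by (simp add: Un_commute)
    show ?case
      by (rule exI[of _ "C(m := T)"]) (use C T T' in \<open>auto simp: less_Suc_eq\<close>)
  qed
  from this[of M] show ?thesis by simp
qed

section \<open>Pseudorandom touching relations on labels\<close>

lemma card_PiE_fixed_value:
  assumes "u < Q" "v < q"
  shows "card {g \<in> {..<Q} \<rightarrow>\<^sub>E {..<q}. g u = v} = (q::nat) ^ (Q - 1)"
proof -
  have "{g \<in> {..<Q} \<rightarrow>\<^sub>E {..<q}. g u = v} = PiE {..<Q} (\<lambda>i. if i = u then {v} else {..<q})"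
  proof (intro set_eqI iffI)
    fix g assume "g \<in> {g \<in> {..<Q} \<rightarrow>\<^sub>E {..<q}. g u = v}"
    then show "g \<in> PiE {..<Q} (\<lambda>i. if i = u then {v} else {..<q})" by (auto simp: PiE_iff)
  next
    fix g assume g: "g \<in> PiE {..<Q} (\<lambda>i. if i = u then {v} else {..<q})"
    have "g i \<in> {..<q}" if "i \<in> {..<Q}" for i
      using PiE_mem[OF g that] assms(2) by (cases "i = u") auto
    moreover have "g u = v" using PiE_mem[OF g, of u] assms(1) by simp
    moreover have "g \<in> extensional {..<Q}" using g by (simp add: PiE_iff)
    ultimately show "g \<in> {g \<in> {..<Q} \<rightarrow>\<^sub>E {..<q}. g u = v}" by (simp add: PiE_iff)
  qed
  also have "card \<dots> = (\<Prod>i<Q. card (if i = u then {v} else {..<q}))"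
    by (simp add: card_PiE)
  also have "\<dots> = (\<Prod>i\<in>{..<Q} - {u}. q)"
    using assms by (subst prod.remove[of _ u]) (auto intro!: prod.cong)
  also have "\<dots> = q ^ (Q - 1)" using assms by simp
  finally show ?thesis .
qed

text \<open>The sum over all functions factors into a product over their arguments, and the factor
  at \<open>u\<close> vanishes. This is the independence of two values of a random function; only
  one of the two factors has to be centred.\<close>

lemma sum_PiE_orthogonal:
  fixes f g :: "nat \<Rightarrow> real" and Q q :: nat
  assumes "u < Q" "u' < Q" "u \<noteq> u'" "(\<Sum>y<q. f y) = 0"
  shows "(\<Sum>h\<in>{..<Q} \<rightarrow>\<^sub>E {..<q::nat}. f (h u) * g (h u')) = 0"
proof -
  define F where "F i = (if i = u then f else if i = u' then g else (\<lambda>_. 1))" for i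
  have "(\<Prod>i<Q. F i (h i)) = f (h u) * g (h u')" for h
  proof -
    have "(\<Prod>i<Q. F i (h i)) = F u (h u) * (\<Prod>i\<in>{..<Q} - {u}. F i (h i))"
      using assms by (intro prod.remove) auto
    also have "(\<Prod>i\<in>{..<Q} - {u}. F i (h i)) = F u' (h u') * (\<Prod>i\<in>{..<Q} - {u} - {u'}. F i (h i))"
      using assms by (intro prod.remove) auto
    also have "(\<Prod>i\<in>{..<Q} - {u} - {u'}. F i (h i)) = 1"
      by (intro prod.neutral) (auto simp: F_def)
    finally show ?thesis using assms by (simp add: F_def)
  qed
  then have "(\<Sum>h\<in>{..<Q} \<rightarrow>\<^sub>E {..<q}. f (h u) * g (h u')) = (\<Sum>h\<in>{..<Q} \<rightarrow>\<^sub>E {..<q}. \<Prod>i<Q. F i (h i))"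
    by simp
  also have "\<dots> = (\<Prod>i<Q. \<Sum>y<q. F i y)"
    by (subst prod_sum_PiE) auto
  also have "\<dots> = 0"
    using assms by (intro prod_zero) (auto simp: F_def intro!: bexI[of _ u])
  finally show ?thesis .
qed

lemma touching_relation_exists:
  fixes Q q :: nat
  assumes "1 \<le> Q" "1 \<le> q"
  defines "M \<equiv> Q * q ^ Q" and "d \<equiv> Q * q ^ (Q - 1)"
  shows "\<exists>R :: nat \<Rightarrow> nat \<Rightarrow> bool. (\<forall>c c'. R c c' = R c' c) \<and> (\<forall>c<M. card {c'. c' < M \<and> R c c'} = d) \<and>
    (\<forall>w :: nat \<Rightarrow> real. (\<forall>c<M. 0 \<le> w c \<and> w c \<le> 1) \<longrightarrow> 56 * sum w {..<M} \<le> M \<longrightarrow>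
      Q * card {c. c < M \<and> d < 14 * sum w {c'. c' < M \<and> R c c'}} \<le> 400 * M)"
proof -
  \<comment> \<open>Labels are pairs \<open>(u, g)\<close>. For fixed \<open>u\<close> the touched weight is a sum over
    \<open>u'\<close> of functions of the independent values \<open>g u'\<close>, so Chebyshev's inequality applies.\<close>
  define F where "F = {..<Q} \<rightarrow>\<^sub>E {..<q}"
  define I where "I = {..<Q} \<times> F"
  \<comment> \<open>The condition is symmetric in the two labels, and for given \<open>p\<close> and
    u' it accepts exactly one value of g' at u. So touching behaves like an event of probability 1 /
    q.\<close>
  define R0 :: "nat \<times> (nat \<Rightarrow> nat) \<Rightarrow> nat \<times> (nat \<Rightarrow> nat) \<Rightarrow> bool" where
    "R0 p p' \<longleftrightarrow> (snd p (fst p') + snd p' (fst p)) mod q = 0" for p p'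
  have finF: "finite F" by (auto simp: F_def intro: finite_PiE)
  have cardF: "card F = q ^ Q" by (simp add: F_def card_PiE)
  have finI: "finite I" and cardI: "card I = M"
    using finF cardF by (auto simp: I_def M_def card_cartesian_product)
  have symR: "R0 p p' = R0 p' p" for p p' by (simp add: R0_def add.commute)
  have neg: "(a + v) mod q = 0 \<longleftrightarrow> v = (q - a) mod q" if "a < q" "v < q" for a v
  proof (cases "a + v < q")
    case True
    then show ?thesis using that by (cases "a = 0") auto
  next
    case False
    then have "(a + v) mod q = a + v - q" using that by (simp add: le_mod_geq)
    then show ?thesis using that False by auto
  qed
  have Fq: "g u < q" if "g \<in> F" "u < Q" for g u using that by (auto simp: F_def PiE_iff)
  have fib: "card {g \<in> F. (a + g u) mod q = 0} = q ^ (Q - 1)" if "a < q" "u < Q" for a u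
  proof -
    have "{g \<in> F. (a + g u) mod q = 0} = {g \<in> F. g u = (q - a) mod q}"
      by (intro Collect_cong conj_cong refl neg that(1) Fq that(2))
    then show ?thesis using card_PiE_fixed_value[OF that(2), of "(q - a) mod q" q] assms(2) by (simp add: F_def)
  qed
  have sumR: "(\<Sum>p'\<in>{p' \<in> I. R0 (u, g) p'}. w p') = (\<Sum>u'<Q. \<Sum>g'\<in>{g' \<in> F. (g u' + g' u) mod q = 0}. w (u', g'))"
    for u g and w :: "nat \<times> (nat \<Rightarrow> nat) \<Rightarrow> real"
  proof -
    have "{p' \<in> I. R0 (u, g) p'} = (SIGMA u':{..<Q}. {g' \<in> F. (g u' + g' u) mod q = 0})"
      by (auto simp: I_def R0_def)
    then show ?thesis using finF by (simp add: sum.Sigma)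
  qed
  have deg: "card {p' \<in> I. R0 p p'} = d" if pI: "p \<in> I" for p
  proof -
    obtain u g where p: "p = (u, g)" "u < Q" "g \<in> F" using pI by (cases p) (auto simp: I_def)
    have "real (card {p' \<in> I. R0 p p'}) = (\<Sum>p'\<in>{p' \<in> I. R0 (u, g) p'}. 1)" by (simp add: p)
    also have "\<dots> = (\<Sum>u'<Q. \<Sum>g'\<in>{g' \<in> F. (g u' + g' u) mod q = 0}. 1)" by (rule sumR)
    also have "\<dots> = (\<Sum>u'<Q. real (q ^ (Q - 1)))"
      using fib Fq p by (intro sum.cong) auto
    also have "\<dots> = real d" by (simp add: d_def)
    finally show ?thesis by (simp only: of_nat_eq_iff)
  qed
  define e where "e = real (q ^ (Q - 1))"
  have e: "0 < e" using assms by (simp add: e_def)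
  have qe: "real q * e = q ^ Q" using assms by (simp add: e_def flip: power_Suc)
  have exc: "Q * card {p \<in> I. d < 14 * sum w {p' \<in> I. R0 p p'}} \<le> 400 * M"
    if w: "\<And>p. p \<in> I \<Longrightarrow> 0 \<le> w p \<and> w p \<le> 1" and wM: "56 * sum w I \<le> M" for w :: "nat \<times> (nat \<Rightarrow> nat) \<Rightarrow> real"
  proof -
    have one: "Q * real (card {g \<in> F. d < 14 * sum w {p' \<in> I. R0 (u, g) p'}}) \<le> 400 * real q ^ Q" if u: "u < Q" for u
    proof -
      define H where "H u' y = (\<Sum>g'\<in>{g' \<in> F. (y + g' u) mod q = 0}. w (u', g'))" for u' y
      define W where "W u' = (\<Sum>g'\<in>F. w (u', g'))" for u'
      \<comment> \<open>The touched weight over u' depends on \<open>g\<close> only through y = g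
        u'. Its mean over \<open>y\<close> is \<open>W u' / q\<close>, so \<open>K u'\<close> is
        centred.\<close>
      define K where "K u' y = H u' y - W u' / q" for u' y
      have w': "0 \<le> w (u', g') \<and> w (u', g') \<le> 1" if "u' < Q" "g' \<in> F" for u' g'
        using w that by (auto simp: I_def)
      have sumK: "(\<Sum>y<q. K u' y) = 0" for u'
      proof -
        have "(\<Sum>y<q. H u' y) = (\<Sum>y<q. \<Sum>g'\<in>F. if (y + g' u) mod q = 0 then w (u', g') else 0)"
          using finF by (simp add: H_def sum.inter_filter)
        also have "\<dots> = (\<Sum>g'\<in>F. \<Sum>y<q. if (y + g' u) mod q = 0 then w (u', g') else 0)"
          by (rule sum.swap)
        also have "\<dots> = (\<Sum>g'\<in>F. \<Sum>y<q. if y = (q - g' u) mod q then w (u', g') else 0)"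
        proof (intro sum.cong refl)
          fix g' y assume "g' \<in> F" "y \<in> {..<q}"
          then have "(y + g' u) mod q = 0 \<longleftrightarrow> y = (q - g' u) mod q"
            using neg[OF Fq[OF _ u], of g' y] by (simp only: add.commute lessThan_iff)
          then show "(if (y + g' u) mod q = 0 then w (u', g') else 0) = (if y = (q - g' u) mod q then w (u', g') else 0)"
            by simp
        qed
        also have "\<dots> = W u'" using assms by (simp add: W_def)
        finally show ?thesis using assms by (simp add: K_def sum_subtractf)
      qed
      have Kb: "(K u' y)\<^sup>2 \<le> e\<^sup>2" if "u' < Q" "y < q" for u' y
      proof -
        have "0 \<le> H u' y" unfolding H_def using w' that by (intro sum_nonneg) auto
        moreover have "H u' y \<le> (\<Sum>g'\<in>{g' \<in> F. (y + g' u) mod q = 0}. 1)"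
          unfolding H_def using w' that by (intro sum_mono) auto
        then have "H u' y \<le> e" using fib[OF that(2) u] by (simp add: e_def)
        moreover have "0 \<le> W u' / q" unfolding W_def using w' that by (intro divide_nonneg_nonneg sum_nonneg) auto
        moreover have "W u' \<le> (\<Sum>g'\<in>F. 1)" unfolding W_def using w' that by (intro sum_mono) auto
        then have "W u' / q \<le> e" using assms qe cardF by (simp add: divide_le_eq mult.commute)
        ultimately have "\<bar>K u' y\<bar> \<le> e" by (auto simp: K_def)
        then show ?thesis using e by (intro power2_le_iff_abs_le[THEN iffD2]) auto
      qed
      have S: "sum w {p' \<in> I. R0 (u, g) p'} = (\<Sum>u'<Q. K u' (g u')) + sum w I / q" for g
      proof -
        have "sum w I = (\<Sum>u'<Q. W u')" using finF by (simp add: I_def W_def sum.cartesian_product)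
        then show ?thesis unfolding sumR
          by (simp add: K_def H_def sum_subtractf sum_divide_distrib)
      qed
      have var: "(\<Sum>g\<in>F. (\<Sum>u'<Q. K u' (g u'))\<^sup>2) \<le> Q * (q ^ Q * e\<^sup>2)"
      proof -
        have "(\<Sum>g\<in>F. (\<Sum>u'<Q. K u' (g u'))\<^sup>2) = (\<Sum>g\<in>F. \<Sum>u'<Q. \<Sum>u''<Q. K u' (g u') * K u'' (g u''))"
          by (simp add: power2_eq_square sum_product)
        also have "\<dots> = (\<Sum>u'<Q. \<Sum>g\<in>F. \<Sum>u''<Q. K u' (g u') * K u'' (g u''))"
          by (rule sum.swap)
        also have "\<dots> = (\<Sum>u'<Q. \<Sum>u''<Q. \<Sum>g\<in>F. K u' (g u') * K u'' (g u''))"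
          by (intro sum.cong refl sum.swap)
        also have "\<dots> = (\<Sum>u'<Q. \<Sum>u''<Q. if u'' = u' then (\<Sum>g\<in>F. (K u' (g u'))\<^sup>2) else 0)"
          using sum_PiE_orthogonal[OF _ _ _ sumK] unfolding F_def
          by (intro sum.cong refl) (auto simp: power2_eq_square)
        also have "\<dots> = (\<Sum>u'<Q. \<Sum>g\<in>F. (K u' (g u'))\<^sup>2)" by simp
        also have "\<dots> \<le> (\<Sum>u'<Q. \<Sum>g\<in>F. e\<^sup>2)"
          using Kb Fq by (intro sum_mono) auto
        also have "\<dots> = Q * (q ^ Q * e\<^sup>2)" by (simp add: cardF)
        finally show ?thesis .
      qed
      define X where "X = {g \<in> F. d < 14 * sum w {p' \<in> I. R0 (u, g) p'}}"
      have Qe: "real d = Q * e" by (simp add: d_def e_def)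
      have wq: "56 * (sum w I / q) \<le> Q * e"
      proof -
        have "56 * sum w I \<le> Q * (q * e)" using wM by (simp add: M_def qe)
        then show ?thesis using assms by (simp add: field_simps)
      qed
      \<comment> \<open>Chebyshev: an exceptional \<open>g\<close> exceeds d / 14 while the mean is
        at most d / 56, a deviation of at least 3 d / 56. The constant 400 exceeds (56/3)^2.\<close>
      have "card X * (3/56 * (Q * e))\<^sup>2 = (\<Sum>g\<in>X. (3/56 * (Q * e))\<^sup>2)" by simp
      also have "\<dots> \<le> (\<Sum>g\<in>X. (\<Sum>u'<Q. K u' (g u'))\<^sup>2)"
      proof (rule sum_mono)
        fix g assume "g \<in> X"
        then have "3/56 * (Q * e) \<le> (\<Sum>u'<Q. K u' (g u'))"
          using wq by (simp add: X_def S Qe)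
        moreover have "0 \<le> 3/56 * (Q * e)" using e by simp
        ultimately show "(3/56 * (Q * e))\<^sup>2 \<le> (\<Sum>u'<Q. K u' (g u'))\<^sup>2" by (intro power_mono)
      qed
      also have "\<dots> \<le> (\<Sum>g\<in>F. (\<Sum>u'<Q. K u' (g u'))\<^sup>2)"
        using finF by (intro sum_mono2) (auto simp: X_def)
      also note var
      finally have "(Q * e\<^sup>2) * (Q * real (card X) * (9/3136)) \<le> (Q * e\<^sup>2) * q ^ Q"
        by (simp add: power2_eq_square algebra_simps)
      moreover have "0 < Q * e\<^sup>2" using assms e by simp
      ultimately have "Q * real (card X) * (9/3136) \<le> real (q ^ Q)" by (simp only: mult_le_cancel_left_pos)
      then have "Q * real (card X) * (9/3136) \<le> real q ^ Q" by simp
      moreover have "0 \<le> real q ^ Q" by simp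
      ultimately show ?thesis unfolding X_def[symmetric] by linarith
    qed
    have "{p \<in> I. d < 14 * sum w {p' \<in> I. R0 p p'}} = (SIGMA u:{..<Q}. {g \<in> F. d < 14 * sum w {p' \<in> I. R0 (u, g) p'}})"
      by (auto simp: I_def)
    then have "real Q * card {p \<in> I. d < 14 * sum w {p' \<in> I. R0 p p'}} = (\<Sum>u<Q. Q * real (card {g \<in> F. d < 14 * sum w {p' \<in> I. R0 (u, g) p'}}))"
      using finF by (simp add: sum_distrib_left)
    also have "\<dots> \<le> (\<Sum>u<Q. 400 * real q ^ Q)" using one by (intro sum_mono) auto
    also have "\<dots> = 400 * real M" by (simp add: M_def)
    finally have "real (Q * card {p \<in> I. d < 14 * sum w {p' \<in> I. R0 p p'}}) \<le> real (400 * M)" by simp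
    then show ?thesis by (simp only: of_nat_le_iff)
  qed
  \<comment> \<open>The pairs are renumbered by the naturals below \<open>M\<close>, so that paths
    can be lists of naturals; weights are carried over along the bijection.\<close>
  from ex_bij_betw_nat_finite[OF finI] obtain h where "bij_betw h {0..<card I} I" ..
  then have h: "bij_betw h {..<M} I" by (simp only: cardI atLeast0LessThan)
  note inj = bij_betw_imp_inj_on[OF h] and himg = bij_betw_imp_surj_on[OF h]
  have hI: "h c \<in> I" if "c < M" for c
    unfolding himg[symmetric] using that by (intro imageI) simp
  have img: "h ` {c'. c' < M \<and> A (h c')} = {p' \<in> I. A p'}" for A :: "nat \<times> (nat \<Rightarrow> nat) \<Rightarrow> bool"
    unfolding himg[symmetric] by blast
  have injs: "inj_on h {c'. c' < M \<and> A c'}" for A :: "nat \<Rightarrow> bool" using inj by (rule inj_on_subset) auto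
  define R where "R c c' = R0 (h c) (h c')" for c c'
  show ?thesis
  proof (intro exI[of _ R] conjI allI impI)
    show "R c c' = R c' c" for c c' using symR by (simp add: R_def)
    show "card {c'. c' < M \<and> R c c'} = d" if "c < M" for c
      using card_image[OF injs, of "\<lambda>c'. R0 (h c) (h c')"] img[of "R0 (h c)"] deg[OF hI[OF that]]
      by (simp add: R_def)
    fix w :: "nat \<Rightarrow> real" assume w: "\<forall>c<M. 0 \<le> w c \<and> w c \<le> 1" and wM: "56 * sum w {..<M} \<le> M"
    define w0 where "w0 p = w (the_inv_into {..<M} h p)" for p
    have w0: "w0 (h c) = w c" if "c < M" for c
    proof -
      have "the_inv_into {..<M} h (h c) = c" by (rule the_inv_into_f_f[OF inj]) (use that in simp)
      then show ?thesis by (simp only: w0_def)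
    qed
    have tr: "sum w0 (h ` C) = sum w C" if C: "C \<subseteq> {..<M}" for C :: "nat set"
    proof -
      have "sum w0 (h ` C) = sum (w0 \<circ> h) C" using inj_on_subset[OF inj C] by (rule sum.reindex)
      also have "\<dots> = sum w C" using w0 C by (intro sum.cong) auto
      finally show ?thesis .
    qed
    have nb: "{p' \<in> I. R0 (h c) p'} = h ` {c'. c' < M \<and> R c c'}" for c :: nat
      unfolding R_def by (rule img[of "R0 (h c)", symmetric])
    have trR: "sum w0 {p' \<in> I. R0 (h c) p'} = sum w {c'. c' < M \<and> R c c'}" for c :: nat
      unfolding nb by (rule tr) auto
    have "Q * card {p \<in> I. d < 14 * sum w0 {p' \<in> I. R0 p p'}} \<le> 400 * M"
    proof (rule exc)
      fix p assume "p \<in> I"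
      then have "p \<in> h ` {..<M}" by (simp only: himg)
      then show "0 \<le> w0 p \<and> w0 p \<le> 1"
      proof (rule imageE)
        fix c :: nat assume c: "p = h c" "c \<in> {..<M}"
        then have "w0 p = w c" using w0[of c] by simp
        then show ?thesis using w c(2) by simp
      qed
    next
      have "sum w0 I = sum w {..<M}" using tr[of "{..<M}"] by (simp only: himg order_refl)
      then show "56 * sum w0 I \<le> M" using wM by (simp only:)
    qed
    moreover have "card {p \<in> I. d < 14 * sum w0 {p' \<in> I. R0 p p'}} = card {c. c < M \<and> d < 14 * sum w {c'. c' < M \<and> R c c'}}"
    proof -
      have "{p \<in> I. d < 14 * sum w0 {p' \<in> I. R0 p p'}} = h ` {c. c < M \<and> d < 14 * sum w {c'. c' < M \<and> R c c'}}"
        using img[of "\<lambda>p. d < 14 * sum w0 {p' \<in> I. R0 p p'}"] by (simp only: trR)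
      then show ?thesis by (simp only: card_image[OF injs[of "\<lambda>c. d < 14 * sum w {c'. c' < M \<and> R c c'}"]])
    qed
    ultimately show "Q * card {c. c < M \<and> d < 14 * sum w {c'. c' < M \<and> R c c'}} \<le> 400 * M" by (simp only:)
  qed
qed

section \<open>Paths and roles\<close>

text \<open>Paths are stored with the latest label first, so that \<open>drop\<close> yields initial paths; the last entry is the type.\<close>

primrec parts :: "(nat \<Rightarrow> nat) \<Rightarrow> nat \<Rightarrow> nat list set" where
  "parts M 0 = (\<lambda>a. [a]) ` {..<M 0}"
| "parts M (Suc i) = (\<lambda>(c, X). c # X) ` ({..<M (Suc i)} \<times> parts M i)"

lemma finite_parts [simp]: "finite (parts M i)"
  by (induction i) auto

lemma Cons_in_parts_iff [simp]: "c # X \<in> parts M (Suc i) \<longleftrightarrow> c < M (Suc i) \<and> X \<in> parts M i"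
  by auto

lemma parts_SucE:
  assumes "Y \<in> parts M (Suc i)"
  obtains c X where "Y = c # X" "c < M (Suc i)" "X \<in> parts M i"
  using assms by auto

lemma parts_0E:
  assumes "X \<in> parts M 0"
  obtains a where "X = [a]" "a < M 0"
  using assms by auto

lemma card_parts_Suc: "card (parts M (Suc i)) = M (Suc i) * card (parts M i)"
proof -
  have "inj_on (\<lambda>(c, X). c # X) ({..<M (Suc i)} \<times> parts M i)" by (auto intro!: inj_onI)
  then show ?thesis by (simp add: card_image card_cartesian_product)
qed

lemma card_parts_0: "card (parts M 0) = M 0"
  by (simp add: card_image inj_on_def)

lemma drop_in_parts: "X \<in> parts M (i + k) \<Longrightarrow> drop k X \<in> parts M i"
  by (induction k arbitrary: X) auto

lemma card_parts_drop:
  assumes "X \<in> parts M i"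
  shows "card {Y \<in> parts M (i + k). drop k Y = X} = (\<Prod>j<k. M (Suc (i + j)))"
proof (induction k)
  case 0
  have "{Y \<in> parts M i. Y = X} = {X}" using assms by auto
  then show ?case by simp
next
  case (Suc k)
  have "{Y \<in> parts M (i + Suc k). drop (Suc k) Y = X} =
    (\<lambda>(c, X). c # X) ` ({..<M (Suc (i + k))} \<times> {Y \<in> parts M (i + k). drop k Y = X})"
    by (auto elim!: parts_SucE simp: image_iff)
  moreover have "inj_on (\<lambda>(c, X). c # X) ({..<M (Suc (i + k))} \<times> {Y \<in> parts M (i + k). drop k Y = X})"
    by (auto intro!: inj_onI)
  ultimately show ?case using Suc by (simp add: card_image card_cartesian_product)
qed

text \<open>The role of a pair of types is read off the sum of the types modulo \<open>16 t R\<close>: role \<open>0\<close> is reserved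
  for the tower stages, roles \<open>2 l\<close> and \<open>2 l + 1\<close> (\<open>1 \<le> l < t\<close>) for the energy jump of level \<open>l\<close>, pairs of
  role \<open>2 t\<close> are complete, pairs of role at least \<open>7 t\<close> belong to the initial stage, and all others are empty.
  Even sums are empty, which rules out loops.\<close>

definition role :: "nat \<Rightarrow> nat \<Rightarrow> nat \<Rightarrow> nat \<Rightarrow> nat" where
  "role t R a b = (let r = (a + b) mod (16 * t * R) in if even r then 1 else r div 2 div R)"

section \<open>Counting by role and separation of types\<close>

lemma role_commute: "role t R a b = role t R b a"
  by (simp add: role_def add.commute)

lemma role_same: "role t R a a = 1"
proof -
  have "even ((a + a) mod (16 * t * R))" by (simp add: dvd_mod_iff mult.assoc)
  then show ?thesis by (simp add: role_def Let_def)
qed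

lemma card_residue_shift:
  assumes "a < (m::nat)"
  shows "card {b. b < m \<and> Pr ((a + b) mod m)} = card {r. r < m \<and> Pr r}"
proof -
  define f where "f b = (a + b) mod m" for b
  have inj: "inj_on f {..<m}"
  proof (rule inj_onI)
    fix b b' assume b: "b \<in> {..<m}" "b' \<in> {..<m}" "f b = f b'"
    then have eq: "(a + b) mod m = (a + b') mod m" by (simp add: f_def)
    show "b = b'"
    proof (cases "b \<le> b'")
      case True
      then have "m dvd (a + b') - (a + b)" using eq[symmetric] by (subst (asm) mod_eq_dvd_iff_nat) simp_all
      then have "m dvd b' - b" by simp
      then show ?thesis using True b(2) by (auto dest: dvd_imp_le)
    next
      case False
      then have "m dvd (a + b) - (a + b')" using eq by (subst (asm) mod_eq_dvd_iff_nat) simp_all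
      then have "m dvd b - b'" by simp
      then show ?thesis using False b(1) by (auto dest: dvd_imp_le)
    qed
  qed
  have "f ` {..<m} = {..<m}"
    using inj assms by (intro endo_inj_surj) (auto simp: f_def)
  then have img: "f ` {b. b < m \<and> Pr (f b)} = {r. r < m \<and> Pr r}" by auto
  have "inj_on f {b. b < m \<and> Pr (f b)}" using inj by (rule inj_on_subset) auto
  from card_image[OF this] show ?thesis unfolding img by (simp only: f_def)
qed

lemma card_odd_residues:
  "card {r. r < 16 * t * R \<and> odd r \<and> u * R \<le> r div 2 \<and> r div 2 < v * R} = (v - u) * R" if "v \<le> 8 * t"
proof -
  have "{r. r < 16 * t * R \<and> odd r \<and> u * R \<le> r div 2 \<and> r div 2 < v * R} = (\<lambda>j. Suc (2 * j)) ` {u * R..<v * R}"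
  proof (intro equalityI subsetI)
    fix r assume "r \<in> {r. r < 16 * t * R \<and> odd r \<and> u * R \<le> r div 2 \<and> r div 2 < v * R}"
    then show "r \<in> (\<lambda>j. Suc (2 * j)) ` {u * R..<v * R}"
      by (intro image_eqI[of _ _ "r div 2"]) auto
  next
    fix r assume "r \<in> (\<lambda>j. Suc (2 * j)) ` {u * R..<v * R}"
    then obtain j where j: "r = Suc (2 * j)" "u * R \<le> j" "j < v * R" by auto
    have "v * R \<le> 8 * t * R" using that by simp
    then have "2 * j + 2 \<le> 16 * t * R" using j(3) by linarith
    then show "r \<in> {r. r < 16 * t * R \<and> odd r \<and> u * R \<le> r div 2 \<and> r div 2 < v * R}" using j by auto
  qed
  then show ?thesis by (simp add: card_image inj_on_def diff_mult_distrib)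
qed

text \<open>Every role owns \<open>R\<close> odd residues. Role 1 has to be kept out of the range
  because it also absorbs all even sums.\<close>

lemma card_role:
  assumes "a < 16 * t * R" "0 < R" "1 \<notin> {u..<v}" "v \<le> 8 * t"
  shows "card {b. b < 16 * t * R \<and> u \<le> role t R a b \<and> role t R a b < v} = (v - u) * R"
proof -
  define Pr where "Pr r \<longleftrightarrow> odd r \<and> u * R \<le> r div 2 \<and> r div 2 < v * R" for r
  have "u \<le> role t R a b \<and> role t R a b < v \<longleftrightarrow> Pr ((a + b) mod (16 * t * R))" for b
    using assms(2,3) by (auto simp: role_def Let_def Pr_def less_eq_div_iff_mult_less_eq div_less_iff_less_mult)
  then have "card {b. b < 16 * t * R \<and> u \<le> role t R a b \<and> role t R a b < v} = card {r. r < 16 * t * R \<and> Pr r}"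
    using card_residue_shift[OF assms(1), of Pr] by simp
  then show ?thesis using card_odd_residues[OF assms(4)] by (simp add: Pr_def)
qed

lemma role_less:
  assumes "0 < t" "0 < R"
  shows "role t R a b < 8 * t"
proof -
  have "(a + b) mod (16 * t * R) < 16 * t * R" using assms by simp
  then have "(a + b) mod (16 * t * R) div 2 < (8 * t) * R" by simp
  then have "(a + b) mod (16 * t * R) div 2 div R < 8 * t" using assms by (simp add: div_less_iff_less_mult)
  moreover have "1 < 8 * t" using assms(1) by linarith
  ultimately show ?thesis by (simp add: role_def Let_def)
qed

text \<open>Here \<open>d\<close> is the difference a' - a modulo the modulus. The witness puts a +
  b at the last odd residue of role \<open>2 * t\<close>, so that any positive even shift within
  reach leaves that role upwards. An odd \<open>d\<close> makes the other sum even; an even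
  \<open>d\<close> of at most half the modulus moves it by at most 4 t roles, still below
  \<open>7 * t\<close>. This dictates the width of the empty band of roles.\<close>

lemma role_separates_aux:
  assumes t: "0 < t" and R: "0 < R" and a: "a < 16 * t * R" "a' < 16 * t * R"
    and d: "(a' + (16 * t * R - a)) mod (16 * t * R) = d" "0 < d" "odd d \<or> d \<le> 8 * t * R"
  shows "\<exists>b<16 * t * R. role t R a b = 2 * t \<and> (role t R a' b = 1 \<or> 2 * t < role t R a' b \<and> role t R a' b < 7 * t)"
proof -
  define m where "m = 16 * t * R"
  have tR: "0 < t * R" "t * R \<ge> R" using t R by auto
  have K: "2 * t * R = 2 * (t * R)" "7 * t * R = 7 * (t * R)" "8 * t * R = 8 * (t * R)" "16 * t * R = 16 * (t * R)"
    by simp_all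
  define r where "r = Suc (2 * (2 * t * R + R - 1))"
  have rm: "r < m"
    using tR R K unfolding r_def m_def by linarith
  have am: "a < m" "a' < m" using a d tR by (auto simp: m_def)
  define b where "b = (r + (m - a)) mod m"
  have bm: "b < m" using rm by (simp add: b_def)
  have ab: "(a + b) mod m = r"
  proof -
    have "(a + b) mod m = (a + (r + (m - a))) mod m" unfolding b_def by (rule mod_add_right_eq)
    also have "a + (r + (m - a)) = r + m" using am by simp
    finally show ?thesis using rm by simp
  qed
  have a'b: "(a' + b) mod m = (r + d) mod m"
  proof -
    have "(a' + b) mod m = (a' + (r + (m - a))) mod m" unfolding b_def by (rule mod_add_right_eq)
    also have "a' + (r + (m - a)) = r + (a' + (m - a))" by simp
    also have "\<dots> mod m = (r + (a' + (m - a)) mod m) mod m" by (rule mod_add_right_eq[symmetric])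
    finally show ?thesis using d(1) by (simp add: m_def)
  qed
  have "r div 2 = 2 * t * R + R - 1" by (simp add: r_def)
  also have "\<dots> div R = 2 * t"
    using R by (intro div_nat_eqI) (auto simp: algebra_simps)
  finally have "role t R a b = 2 * t" using ab by (simp add: role_def m_def r_def Let_def)
  moreover have "role t R a' b = 1 \<or> 2 * t < role t R a' b \<and> role t R a' b < 7 * t"
  proof (cases "odd d")
    case True
    have "even m" by (simp add: m_def)
    then have "even ((r + d) mod m)" using True by (simp add: r_def dvd_mod_iff)
    then show ?thesis using a'b by (simp add: role_def m_def Let_def)
  next
    case False
    then obtain \<delta> where \<delta>: "d = 2 * \<delta>" by auto
    have "2 * \<delta> \<le> 8 * (t * R)" using d(3) False \<delta> K by simp
    then have "\<delta> \<le> 4 * (t * R)" by linarith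
    then have \<delta>': "1 \<le> \<delta>" "\<delta> \<le> 4 * (t * R)" using d(2) \<delta> by simp_all
    have "r + d = Suc (2 * (2 * t * R + R - 1 + \<delta>))" by (simp add: r_def \<delta>)
    moreover have lt: "2 * t * R + R - 1 + \<delta> < 7 * t * R" using \<delta>' tR R K by linarith
    moreover have "Suc (2 * x) < m" if "x < 7 * t * R" for x
      using that K tR unfolding m_def by linarith
    note this[OF lt]
    ultimately have 1: "(a' + b) mod m = Suc (2 * (2 * t * R + R - 1 + \<delta>))" using a'b by simp
    have "2 * t + 1 \<le> (2 * t * R + R - 1 + \<delta>) div R"
      using R \<delta>' by (simp add: less_eq_div_iff_mult_less_eq algebra_simps)
    moreover have "(2 * t * R + R - 1 + \<delta>) div R < 7 * t"
      using R lt by (simp add: div_less_iff_less_mult)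
    ultimately show ?thesis using 1 by (simp add: role_def m_def Let_def)
  qed
  ultimately show ?thesis using bm by (auto simp: m_def)
qed

text \<open>The two cyclic differences of \<open>a\<close> and a' add up to the modulus, so one of
  them is at most half of it. Which one it is decides which type sees the complete role, hence the
  disjunction.\<close>

lemma role_separates:
  assumes t: "0 < t" and R: "0 < R" and a: "a < 16 * t * R" "a' < 16 * t * R" "a \<noteq> a'"
  defines "cmpl v \<equiv> v = 2 * t" and "void v \<equiv> v = 1 \<or> 2 * t < v \<and> v < 7 * t"
  shows "\<exists>b<16 * t * R. (cmpl (role t R a b) \<and> void (role t R a' b)) \<or> (cmpl (role t R a' b) \<and> void (role t R a b))"
proof -
  define m where "m = 16 * t * R"
  have am: "a < m" "a' < m" using a by (auto simp: m_def)
  define d d' where "d = (a' + (m - a)) mod m" and "d' = (a + (m - a')) mod m"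
  have dd': "0 < d" "0 < d'" "d + d' = m"
  proof -
    have "(a' < a \<and> d = a' + (m - a) \<and> d' = a - a') \<or> (a < a' \<and> d = a' - a \<and> d' = a + (m - a'))"
    proof (cases "a' < a")
      case True
      have "a + (m - a') = (a - a') + m" using True am by simp
      then have "d' = (a - a') mod m" unfolding d'_def by (simp only: mod_add_self2)
      then show ?thesis using True am by (auto simp: d_def)
    next
      case False
      then have "a < a'" using a by simp
      moreover from this have "a' + (m - a) = (a' - a) + m" using am by simp
      then have "d = (a' - a) mod m" unfolding d_def by (simp only: mod_add_self2)
      ultimately show ?thesis using am by (auto simp: d'_def)
    qed
    then show "0 < d" "0 < d'" "d + d' = m" using am by auto
  qed
  then have "(odd d \<or> d \<le> 8 * t * R) \<or> (odd d' \<or> d' \<le> 8 * t * R)" by (auto simp: m_def)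
  then show ?thesis
  proof
    assume "odd d \<or> d \<le> 8 * t * R"
    from role_separates_aux[OF t R a(1,2) _ _ this] show ?thesis
      using dd' by (auto simp: d_def m_def cmpl_def void_def)
  next
    assume "odd d' \<or> d' \<le> 8 * t * R"
    from role_separates_aux[OF t R a(2,1) _ _ this] show ?thesis
      using dd' by (auto simp: d'_def m_def cmpl_def void_def)
  qed
qed

text \<open>\<open>M 0\<close> counts the types, and every later stage has labels with a relation as
  provided by \<open>touching_relation_exists\<close>. In \<open>touch_exceptional\<close>, 56 = 4 *
  14 says that the average weight is at most a quarter of the threshold.\<close>

locale touching =
  fixes t R :: nat and Q q M :: "nat \<Rightarrow> nat" and touch :: "nat \<Rightarrow> nat \<Rightarrow> nat \<Rightarrow> bool"
  assumes t_pos: "0 < t" and R_pos: "0 < R" and M_0: "M 0 = 16 * t * R"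
    and Q_pos: "\<And>i. 1 \<le> Q (Suc i)" and q_pos: "\<And>i. 1 \<le> q (Suc i)"
    and M_Suc: "\<And>i. M (Suc i) = Q (Suc i) * q (Suc i) ^ Q (Suc i)"
    and touch_sym: "\<And>i c c'. touch i c c' = touch i c' c"
    and touch_degree: "\<And>i c. c < M (Suc i) \<Longrightarrow>
      card {c'. c' < M (Suc i) \<and> touch (Suc i) c c'} = Q (Suc i) * q (Suc i) ^ (Q (Suc i) - 1)"
    and touch_exceptional: "\<And>i (w :: nat \<Rightarrow> real). (\<And>c. c < M (Suc i) \<Longrightarrow> 0 \<le> w c \<and> w c \<le> 1) \<Longrightarrow>
      56 * sum w {..<M (Suc i)} \<le> M (Suc i) \<Longrightarrow>
      Q (Suc i) * card {c. c < M (Suc i) \<and> Q (Suc i) * q (Suc i) ^ (Q (Suc i) - 1) <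
        14 * sum w {c'. c' < M (Suc i) \<and> touch (Suc i) c c'}} \<le> 400 * M (Suc i)"
begin

definition d :: "nat \<Rightarrow> nat" where
  "d i = Q i * q i ^ (Q i - 1)"

primrec untouched_degree :: "nat \<Rightarrow> nat" where
  "untouched_degree 0 = R"
| "untouched_degree (Suc i) = untouched_degree i * (M (Suc i) - d (Suc i))"

primrec degree :: "nat \<Rightarrow> nat" where
  "degree 0 = t * R"
| "degree (Suc i) = untouched_degree i * d (Suc i)"

primrec untouched :: "nat \<Rightarrow> nat list \<Rightarrow> nat list \<Rightarrow> bool" where
  "untouched 0 X Y = (role t R (hd X) (hd Y) = 0)"
| "untouched (Suc i) X Y = (untouched i (tl X) (tl Y) \<and> \<not> touch (Suc i) (hd X) (hd Y))"

text \<open>Stage 0 has its own band of \<open>t\<close> roles starting at \<open>7 * t\<close>,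
  while the later stages consume the pairs of role 0. Hence touched and untouched are disjoint but
  not complementary at stage 0.\<close>

primrec touched :: "nat \<Rightarrow> nat list \<Rightarrow> nat list \<Rightarrow> bool" where
  "touched 0 X Y = (7 * t \<le> role t R (hd X) (hd Y))"
| "touched (Suc i) X Y = (untouched i (tl X) (tl Y) \<and> touch (Suc i) (hd X) (hd Y))"

definition nbhd :: "nat \<Rightarrow> nat list \<Rightarrow> nat list set" where
  "nbhd i X = {Y \<in> parts M i. touched i X Y}"

lemma untouched_sym: "untouched i X Y = untouched i Y X"
proof (induction i arbitrary: X Y)
  case 0
  show ?case by (simp only: untouched.simps role_commute[of t R "hd X"])
next
  case (Suc i)
  show ?case by (simp only: untouched.simps Suc.IH[of "tl X" "tl Y"] touch_sym[of _ "hd X" "hd Y"])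
qed

lemma touched_sym: "touched i X Y = touched i Y X"
proof (cases i)
  case 0
  show ?thesis by (simp only: 0 touched.simps role_commute[of t R "hd X"])
next
  case (Suc i)
  show ?thesis by (simp only: Suc touched.simps untouched_sym[of _ "tl X" "tl Y"] touch_sym[of _ "hd X" "hd Y"])
qed

lemma finite_nbhd [simp]: "finite (nbhd i X)"
  by (simp add: nbhd_def)

lemma d_le_M: "d (Suc i) \<le> M (Suc i)"
proof -
  have "q (Suc i) ^ (Q (Suc i) - 1) \<le> q (Suc i) ^ Q (Suc i)"
    using q_pos[of i] by (intro power_increasing) auto
  then show ?thesis by (simp add: d_def M_Suc)
qed

lemma card_untouched:
  "X \<in> parts M i \<Longrightarrow> card {Y \<in> parts M i. untouched i X Y} = untouched_degree i"
proof (induction i arbitrary: X)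
  case 0
  from this obtain a where a: "X = [a]" "a < M 0" by (rule parts_0E)
  have "{Y \<in> parts M 0. untouched 0 X Y} = (\<lambda>b. [b]) ` {b. b < 16 * t * R \<and> 0 \<le> role t R a b \<and> role t R a b < 1}"
    using a by (auto simp: M_0)
  then have "card {Y \<in> parts M 0. untouched 0 X Y} = card ((\<lambda>b. [b]) ` {b. b < 16 * t * R \<and> 0 \<le> role t R a b \<and> role t R a b < 1})"
    by (rule arg_cong)
  also have "\<dots> = card {b. b < 16 * t * R \<and> 0 \<le> role t R a b \<and> role t R a b < 1}"
    by (rule card_image) (simp add: inj_on_def)
  also have "\<dots> = (1 - 0) * R"
  proof (rule card_role[OF _ R_pos])
    show "a < 16 * t * R" using a(2) by (simp only: M_0)
    show "1 \<le> 8 * t" using t_pos by linarith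
  qed simp
  finally show ?case by simp
next
  case (Suc i)
  from Suc.prems obtain c X0 where X: "X = c # X0" "c < M (Suc i)" "X0 \<in> parts M i" by (rule parts_SucE)
  have "{Y \<in> parts M (Suc i). untouched (Suc i) X Y} = (\<lambda>(c, X). c # X) `
    ({c'. c' < M (Suc i) \<and> \<not> touch (Suc i) c c'} \<times> {Y \<in> parts M i. untouched i X0 Y})"
    using X by auto
  moreover have "inj_on (\<lambda>(c, X). c # X) ({c'. c' < M (Suc i) \<and> \<not> touch (Suc i) c c'} \<times> {Y \<in> parts M i. untouched i X0 Y})"
    by (auto intro!: inj_onI)
  moreover have "card {c'. c' < M (Suc i) \<and> \<not> touch (Suc i) c c'} = M (Suc i) - d (Suc i)"
  proof -
    have "{c'. c' < M (Suc i) \<and> \<not> touch (Suc i) c c'} = {..<M (Suc i)} - {c'. c' < M (Suc i) \<and> touch (Suc i) c c'}"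
      by auto
    then show ?thesis using touch_degree[OF X(2)] by (subst \<open>_ = _ - _\<close>, subst card_Diff_subset) (auto simp: d_def)
  qed
  ultimately show ?case using Suc.IH[OF X(3)] by (simp add: card_image card_cartesian_product)
qed

lemma nbhd_Suc: "X \<in> parts M i \<Longrightarrow> nbhd (Suc i) (c # X) = (\<lambda>(c, X). c # X) `
    ({c'. c' < M (Suc i) \<and> touch (Suc i) c c'} \<times> {Y \<in> parts M i. untouched i X Y})"
  by (auto simp: nbhd_def)

lemma card_nbhd: "X \<in> parts M i \<Longrightarrow> card (nbhd i X) = degree i"
proof (cases i)
  case 0
  assume X: "X \<in> parts M i"
  from this[unfolded 0] obtain a where a: "X = [a]" "a < M 0" by (rule parts_0E)
  have "nbhd 0 X = (\<lambda>b. [b]) ` {b. b < 16 * t * R \<and> 7 * t \<le> role t R a b \<and> role t R a b < 8 * t}"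
    using a role_less[OF t_pos R_pos] by (auto simp: M_0 nbhd_def)
  then have "card (nbhd 0 X) = card ((\<lambda>b. [b]) ` {b. b < 16 * t * R \<and> 7 * t \<le> role t R a b \<and> role t R a b < 8 * t})"
    by (rule arg_cong)
  also have "\<dots> = card {b. b < 16 * t * R \<and> 7 * t \<le> role t R a b \<and> role t R a b < 8 * t}"
    by (rule card_image) (simp add: inj_on_def)
  also have "\<dots> = (8 * t - 7 * t) * R"
  proof (rule card_role[OF _ R_pos])
    show "a < 16 * t * R" using a(2) by (simp only: M_0)
    show "1 \<notin> {7 * t..<8 * t}" using t_pos by simp
  qed simp
  finally show ?thesis using 0 by simp
next
  case (Suc j)
  assume X: "X \<in> parts M i"
  then obtain c X0 where X: "X = c # X0" "c < M (Suc j)" "X0 \<in> parts M j" unfolding Suc by (rule parts_SucE)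
  have "inj_on (\<lambda>(c, X). c # X) ({c'. c' < M (Suc j) \<and> touch (Suc j) c c'} \<times> {Y \<in> parts M j. untouched j X0 Y})"
    by (auto intro!: inj_onI)
  then show ?thesis
    using X Suc card_untouched[OF X(3)] touch_degree[OF X(2)] nbhd_Suc[OF X(3), of c]
    by (simp add: card_image card_cartesian_product d_def)
qed

text \<open>A neighbourhood at stage 0 contains one sixteenth of all types, so a weight of mean
  \<zeta> cannot fill a fourteenth of it once 14 * 16 * \<zeta> is at most 1.\<close>

lemma few_exceptional_0:
  fixes w :: "nat list \<Rightarrow> real" and \<zeta> :: real
  assumes w: "\<And>Y. Y \<in> parts M 0 \<Longrightarrow> 0 \<le> w Y \<and> w Y \<le> (1::real)"
    and sum: "sum w (parts M 0) \<le> \<zeta> * card (parts M 0)" and \<zeta>: "224 * \<zeta> \<le> 1"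
  shows "card {X \<in> parts M 0. degree 0 < 14 * sum w (nbhd 0 X)} = 0"
proof -
  have "14 * sum w (nbhd 0 X) \<le> degree 0" for X
  proof -
    have "sum w (nbhd 0 X) \<le> sum w (parts M 0)"
      using w by (intro sum_mono2) (auto simp: nbhd_def)
    also have "\<dots> \<le> \<zeta> * (16 * t * R)" using sum by (simp only: card_parts_0 M_0)
    finally have "14 * sum w (nbhd 0 X) \<le> (224 * \<zeta>) * (t * R)" by (simp add: algebra_simps)
    also have "\<dots> \<le> 1 * real (t * R)" using \<zeta> by (intro mult_right_mono) auto
    finally show ?thesis by simp
  qed
  then have "{X \<in> parts M 0. degree 0 < 14 * sum w (nbhd 0 X)} = {}" by (auto simp: not_less)
  then show ?thesis by (metis card.empty)
qed

text \<open>With the parent path fixed, averaging the weight over the parent's untouched partners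
  gives a weight on labels alone. The condition on \<zeta> keeps its mean below 1/56 even if all the
  weight sits over these partners, so \<open>touch_exceptional\<close> applies to every parent
  separately.\<close>

lemma few_exceptional_Suc:
  fixes w :: "nat list \<Rightarrow> real" and \<zeta> :: real
  assumes w: "\<And>Y. Y \<in> parts M (Suc i) \<Longrightarrow> 0 \<le> w Y \<and> w Y \<le> (1::real)"
    and sum: "sum w (parts M (Suc i)) \<le> \<zeta> * card (parts M (Suc i))"
    and \<zeta>: "56 * \<zeta> * card (parts M i) \<le> untouched_degree i" and G: "0 < untouched_degree i"
  shows "card {X \<in> parts M (Suc i). degree (Suc i) < 14 * sum w (nbhd (Suc i) X)} \<le> 400 / Q (Suc i) * card (parts M (Suc i))"
proof -
  define g where "g = real (untouched_degree i)"
  have g: "0 < g" using G by (simp add: g_def)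
  have injC: "inj_on (\<lambda>(c, X). c # X) A" for A :: "(nat \<times> nat list) set" by (auto intro!: inj_onI)
  have row: "Q (Suc i) * real (card {c. c < M (Suc i) \<and> degree (Suc i) < 14 * sum w (nbhd (Suc i) (c # X))}) \<le> 400 * M (Suc i)"
    if X: "X \<in> parts M i" for X
  proof -
    define U where "U = {Y \<in> parts M i. untouched i X Y}"
    have U: "finite U" "card U = untouched_degree i" "U \<subseteq> parts M i" using card_untouched[OF X] by (auto simp: U_def)
    define W where "W c' = (\<Sum>Y\<in>U. w (c' # Y)) / g" for c'
    have "Q (Suc i) * card {c. c < M (Suc i) \<and> Q (Suc i) * q (Suc i) ^ (Q (Suc i) - 1) <
        14 * sum W {c'. c' < M (Suc i) \<and> touch (Suc i) c c'}} \<le> 400 * M (Suc i)"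
    proof (rule touch_exceptional)
      fix c' assume c': "c' < M (Suc i)"
      have "0 \<le> (\<Sum>Y\<in>U. w (c' # Y))" using w c' U by (intro sum_nonneg) auto
      moreover have "(\<Sum>Y\<in>U. w (c' # Y)) \<le> (\<Sum>Y\<in>U. 1)" using w c' U by (intro sum_mono) auto
      ultimately show "0 \<le> W c' \<and> W c' \<le> 1" using g U by (simp add: W_def g_def)
    next
      have "sum W {..<M (Suc i)} = (\<Sum>c'<M (Suc i). \<Sum>Y\<in>U. w (c' # Y)) / g"
        by (simp add: W_def sum_divide_distrib)
      also have "(\<Sum>c'<M (Suc i). \<Sum>Y\<in>U. w (c' # Y)) = sum w ((\<lambda>(c, X). c # X) ` ({..<M (Suc i)} \<times> U))"
        by (subst sum.reindex[OF injC]) (auto simp: sum.cartesian_product intro!: sum.cong)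
      also have "\<dots> \<le> sum w (parts M (Suc i))" using w U by (intro sum_mono2) auto
      also have "\<dots> \<le> \<zeta> * (M (Suc i) * card (parts M i))" using sum by (simp only: card_parts_Suc of_nat_mult)
      finally have "56 * sum W {..<M (Suc i)} \<le> 56 * (\<zeta> * (M (Suc i) * card (parts M i)) / g)"
        using g by (simp add: divide_right_mono)
      also have "\<dots> = (56 * \<zeta> * card (parts M i)) * M (Suc i) / g" by simp
      also have "\<dots> \<le> g * M (Suc i) / g" using \<zeta> g by (intro divide_right_mono mult_right_mono) (auto simp: g_def)
      finally show "56 * sum W {..<M (Suc i)} \<le> M (Suc i)" using g by simp
    qed
    moreover have "degree (Suc i) < 14 * sum w (nbhd (Suc i) (c # X)) \<longleftrightarrow>
      Q (Suc i) * q (Suc i) ^ (Q (Suc i) - 1) < 14 * sum W {c'. c' < M (Suc i) \<and> touch (Suc i) c c'}" for c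
    proof -
      have "sum w (nbhd (Suc i) (c # X)) = (\<Sum>c'\<in>{c'. c' < M (Suc i) \<and> touch (Suc i) c c'}. \<Sum>Y\<in>U. w (c' # Y))"
        unfolding nbhd_Suc[OF X] U_def by (subst sum.reindex[OF injC]) (auto simp: sum.cartesian_product intro!: sum.cong)
      also have "\<dots> = g * sum W {c'. c' < M (Suc i) \<and> touch (Suc i) c c'}"
        using g by (simp add: W_def flip: sum_divide_distrib)
      finally have "14 * sum w (nbhd (Suc i) (c # X)) = g * (14 * sum W {c'. c' < M (Suc i) \<and> touch (Suc i) c c'})" by simp
      moreover have "real (degree (Suc i)) = g * real (d (Suc i))" by (simp add: g_def)
      ultimately show ?thesis using g by (simp only: mult_less_cancel_left_pos d_def)
    qed
    ultimately show ?thesis by (simp flip: of_nat_mult)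
  qed
  have "{X \<in> parts M (Suc i). degree (Suc i) < 14 * sum w (nbhd (Suc i) X)} =
    (\<lambda>(X, c). c # X) ` (SIGMA X:parts M i. {c. c < M (Suc i) \<and> degree (Suc i) < 14 * sum w (nbhd (Suc i) (c # X))})"
    by (auto elim!: parts_SucE simp del: parts.simps degree.simps)
  then have "card {X \<in> parts M (Suc i). degree (Suc i) < 14 * sum w (nbhd (Suc i) X)} =
    card (SIGMA X:parts M i. {c. c < M (Suc i) \<and> degree (Suc i) < 14 * sum w (nbhd (Suc i) (c # X))})"
    by (subst \<open>_ = _ ` _\<close>, intro card_image) (auto intro!: inj_onI)
  also have "\<dots> = (\<Sum>X\<in>parts M i. card {c. c < M (Suc i) \<and> degree (Suc i) < 14 * sum w (nbhd (Suc i) (c # X))})"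
    by (simp del: parts.simps degree.simps)
  finally have "Q (Suc i) * real (card {X \<in> parts M (Suc i). degree (Suc i) < 14 * sum w (nbhd (Suc i) X)}) =
    (\<Sum>X\<in>parts M i. Q (Suc i) * real (card {c. c < M (Suc i) \<and> degree (Suc i) < 14 * sum w (nbhd (Suc i) (c # X))}))"
    by (simp only: of_nat_sum sum_distrib_left)
  also have "\<dots> \<le> (\<Sum>X\<in>parts M i. 400 * real (M (Suc i)))" using row by (intro sum_mono) auto
  also have "\<dots> = 400 * real (card (parts M (Suc i)))" by (simp only: card_parts_Suc) simp
  finally show ?thesis using Q_pos[of i] by (simp add: field_simps del: parts.simps degree.simps)
qed

end

section \<open>The graph\<close>

text \<open>Toggling \<open>Y\<close> is an involution of the power set that flips the sign of every
  term.\<close>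

lemma sum_Pow_sign_product:
  assumes "finite K" "Y \<in> K" "Y \<noteq> Y'"
  shows "(\<Sum>k\<in>Pow K. (if Y \<in> k then 1 else -1) * (if Y' \<in> k then 1 else -1 :: real)) = 0"
proof -
  define g where "g k = (if Y \<in> k then 1 else -1) * (if Y' \<in> k then 1 else -1 :: real)" for k
  define f where "f k = sym_diff k {Y}" for k
  have f: "f (f k) = k" for k by (auto simp: f_def)
  have fK: "f k \<in> Pow K" if "k \<in> Pow K" for k using that assms(2) by (auto simp: f_def)
  have "sum g (Pow K) = sum (\<lambda>k. g (f k)) (Pow K)"
    by (rule sum.reindex_bij_witness[where i = f and j = f]) (simp_all only: f fK)
  also have "\<dots> = sum (\<lambda>k. - g k) (Pow K)"
    using assms by (intro sum.cong) (auto simp: g_def f_def)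
  finally have "sum g (Pow K) = - sum g (Pow K)" by (simp add: sum_negf)
  then show ?thesis by (simp add: g_def)
qed

text \<open>The vertices realise every combination of a full path and a key exactly once, so over
  each path the key is a uniformly random set of paths. \<open>lev l\<close> is the stage whose
  paths are looked up in the keys for the energy pairs of level \<open>l\<close>.\<close>

locale tower_graph = touching +
  fixes code :: "nat \<Rightarrow> nat list \<Rightarrow> nat \<Rightarrow> nat list set" and S :: nat and lev :: "nat \<Rightarrow> nat"
    and V :: "nat set" and path :: "nat \<Rightarrow> nat list" and key :: "nat \<Rightarrow> nat list set"
  assumes code_sub: "\<And>i X c. i < S \<Longrightarrow> X \<in> parts M i \<Longrightarrow> c < M (Suc i) \<Longrightarrow> code i X c \<subseteq> nbhd i X"
    and code_dist: "\<And>i X c c'. i < S \<Longrightarrow> X \<in> parts M i \<Longrightarrow> c < M (Suc i) \<Longrightarrow> c' < M (Suc i) \<Longrightarrow> c \<noteq> c' \<Longrightarrow>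
      degree i \<le> 4 * card (sym_diff (code i X c) (code i X c'))"
    and lev: "\<And>l. 1 \<le> l \<Longrightarrow> l < t \<Longrightarrow> 1 \<le> lev l \<and> lev l \<le> S"
    and lev_mono: "\<And>l l'. 1 \<le> l \<Longrightarrow> l \<le> l' \<Longrightarrow> l' < t \<Longrightarrow> lev l \<le> lev l'"
    and finite_V: "finite V"
    and labels: "bij_betw (\<lambda>x. (path x, key x)) V (parts M S \<times> Pow (\<Union>i\<le>S. parts M i))"
begin

definition pt :: "nat \<Rightarrow> nat \<Rightarrow> nat list" where
  "pt i x = drop (S - i) (path x)"

definition bit :: "nat \<Rightarrow> nat \<Rightarrow> nat list \<Rightarrow> bool" where
  "bit i x Y \<longleftrightarrow> Y \<in> code i (pt i x) (hd (pt (Suc i) x))"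

definition rl :: "nat \<Rightarrow> nat \<Rightarrow> nat" where
  "rl x y = role t R (hd (pt 0 x)) (hd (pt 0 y))"

text \<open>The clauses concern disjoint ranges of roles, as touched pairs have role 0 or at least
  \<open>7 * t\<close>. Comparing one bit from each end for equality keeps the relation symmetric
  while fixing either bit lets the other decide. Halving the role gives both roles of a level the
  same rule.\<close>

definition adj :: "nat \<Rightarrow> nat \<Rightarrow> bool" where
  "adj x y \<longleftrightarrow> rl x y = 2 * t \<or>
    (\<exists>i<S. touched i (pt i x) (pt i y) \<and> bit i x (pt i y) = bit i y (pt i x)) \<or>
    (2 \<le> rl x y \<and> rl x y < 2 * t \<and>
      (pt (lev (rl x y div 2)) y \<in> key x) = (pt (lev (rl x y div 2)) x \<in> key y))"

definition G :: "nat pair_pre_digraph" where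
  "G = \<lparr>pverts = V, parcs = {(x, y). x \<in> V \<and> y \<in> V \<and> adj x y}\<rparr>"

lemma pverts_G [simp]: "pverts G = V" and parcs_G: "(x, y) \<in> parcs G \<longleftrightarrow> x \<in> V \<and> y \<in> V \<and> adj x y"
  by (auto simp: G_def)

lemma path_in_parts: "x \<in> V \<Longrightarrow> path x \<in> parts M S"
  using bij_betw_imp_surj_on[OF labels] by blast

lemma pt_in_parts: "x \<in> V \<Longrightarrow> i \<le> S \<Longrightarrow> pt i x \<in> parts M i"
  using drop_in_parts[of "path x" M i "S - i"] path_in_parts by (simp add: pt_def)

lemma drop_pt: "i \<le> j \<Longrightarrow> j \<le> S \<Longrightarrow> drop (j - i) (pt j x) = pt i x"
  by (simp add: pt_def)

lemma tl_pt: "i < S \<Longrightarrow> tl (pt (Suc i) x) = pt i x"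
proof -
  assume "i < S"
  then have "S - i = Suc (S - Suc i)" by (simp add: Suc_diff_Suc)
  then show ?thesis by (simp add: pt_def drop_Suc tl_drop)
qed

lemma pt_Suc:
  assumes "x \<in> V" "i < S"
  shows "pt (Suc i) x = hd (pt (Suc i) x) # pt i x" "hd (pt (Suc i) x) < M (Suc i)"
proof -
  have "pt (Suc i) x \<in> parts M (Suc i)" using assms by (intro pt_in_parts) auto
  then obtain c X where c: "pt (Suc i) x = c # X" "c < M (Suc i)" "X \<in> parts M i" by (rule parts_SucE)
  then show "pt (Suc i) x = hd (pt (Suc i) x) # pt i x" "hd (pt (Suc i) x) < M (Suc i)"
    using tl_pt[OF assms(2), of x] by simp_all
qed

lemma not_untouched_if_touched:
  assumes "touched i X Y" shows "\<not> untouched i X Y"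
  using assms t_pos by (cases i) auto

lemma untouched_parent:
  assumes "untouched (Suc i) (pt (Suc i) x) (pt (Suc i) y)" "i < S"
  shows "untouched i (pt i x) (pt i y)"
  using assms(1) by (simp only: untouched.simps tl_pt[OF assms(2)])

lemma touched_parent:
  assumes "touched (Suc i) (pt (Suc i) x) (pt (Suc i) y)" "i < S"
  shows "untouched i (pt i x) (pt i y)"
  using assms(1) by (simp only: touched.simps tl_pt[OF assms(2)])

lemma untouched_ancestor_add:
  "untouched (i + k) (pt (i + k) x) (pt (i + k) y) \<Longrightarrow> i + k \<le> S \<Longrightarrow> untouched i (pt i x) (pt i y)"
proof (induction k)
  case 0
  then show ?case by (simp only: add_0_right)
next
  case (Suc k)
  have "untouched (i + k) (pt (i + k) x) (pt (i + k) y)"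
  proof (rule untouched_parent)
    show "untouched (Suc (i + k)) (pt (Suc (i + k)) x) (pt (Suc (i + k)) y)"
      using Suc.prems(1) by (simp only: add_Suc_right)
    show "i + k < S" using Suc.prems(2) by simp
  qed
  then show ?case by (rule Suc.IH) (use Suc.prems(2) in simp)
qed

lemma untouched_ancestor:
  assumes "untouched j (pt j x) (pt j y)" "i \<le> j" "j \<le> S"
  shows "untouched i (pt i x) (pt i y)"
proof (rule untouched_ancestor_add)
  have "i + (j - i) = j" using assms(2) by simp
  then show "untouched (i + (j - i)) (pt (i + (j - i)) x) (pt (i + (j - i)) y)" "i + (j - i) \<le> S"
    using assms(1,3) by (simp_all only:)
qed

text \<open>Being touched at stage \<open>j\<close> requires the initial paths to be untouched at
  every earlier stage, so a pair is devoted to at most one stage.\<close>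

lemma touched_unique_aux:
  assumes "touched i (pt i x) (pt i y)" "touched j (pt j x) (pt j y)" "i < j" "j \<le> S"
  shows False
proof -
  obtain k where k: "j = Suc k" using assms(3) by (cases j) auto
  have "untouched k (pt k x) (pt k y)" using assms(2,4) unfolding k by (rule touched_parent[OF _ Suc_le_lessD])
  then have "untouched i (pt i x) (pt i y)" by (rule untouched_ancestor[of k]) (use assms(3,4) in \<open>auto simp: k\<close>)
  then show False using not_untouched_if_touched[OF assms(1)] by simp
qed

lemma touched_unique:
  assumes "touched i (pt i x) (pt i y)" "touched j (pt j x) (pt j y)" "i \<le> S" "j \<le> S"
  shows "i = j"
  using touched_unique_aux[of i x y j] touched_unique_aux[of j x y i] assms by (meson linorder_neqE_nat)

lemma touched_rl:
  assumes "touched i (pt i x) (pt i y)" "i \<le> S"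
  shows "rl x y = 0 \<or> 7 * t \<le> rl x y"
proof (cases i)
  case 0
  then show ?thesis using assms by (simp add: rl_def)
next
  case (Suc k)
  have "untouched k (pt k x) (pt k y)" using assms unfolding Suc by (rule touched_parent[OF _ Suc_le_lessD])
  then have "untouched 0 (pt 0 x) (pt 0 y)" by (rule untouched_ancestor[of k]) (use Suc assms in auto)
  then show ?thesis by (simp add: rl_def)
qed

lemma rl_sym: "rl x y = rl y x"
  by (simp add: rl_def role_commute)

lemma adj_sym: "adj x y = adj y x"
  unfolding adj_def rl_sym[of y x] by (auto simp: touched_sym)

lemma adj_complete: "rl x y = 2 * t \<Longrightarrow> adj x y"
  by (simp add: adj_def)

lemma not_adj_void:
  assumes "rl x y = 1 \<or> 2 * t < rl x y \<and> rl x y < 7 * t" shows "\<not> adj x y"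
proof -
  have "\<not> touched i (pt i x) (pt i y)" if "i < S" for i
    using touched_rl[of i x y] assms that t_pos by auto
  then show ?thesis using assms t_pos by (auto simp: adj_def)
qed

lemma adj_touched:
  assumes "touched i (pt i x) (pt i y)" "i < S"
  shows "adj x y \<longleftrightarrow> bit i x (pt i y) = bit i y (pt i x)"
proof -
  have "(\<exists>j<S. touched j (pt j x) (pt j y) \<and> bit j x (pt j y) = bit j y (pt j x)) \<longleftrightarrow> bit i x (pt i y) = bit i y (pt i x)"
    using touched_unique[OF assms(1)] assms by (metis less_imp_le)
  moreover have "\<not> rl x y = 2 * t" "\<not> (2 \<le> rl x y \<and> rl x y < 2 * t)"
    using touched_rl[OF assms(1)] assms(2) t_pos by auto
  ultimately show ?thesis unfolding adj_def by blast
qed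

lemma adj_energy:
  assumes "2 \<le> rl x y" "rl x y < 2 * t"
  shows "adj x y \<longleftrightarrow> (pt (lev (rl x y div 2)) y \<in> key x) = (pt (lev (rl x y div 2)) x \<in> key y)"
proof -
  have "\<not> touched i (pt i x) (pt i y)" if "i < S" for i
    using touched_rl[of i x y] assms that by auto
  then show ?thesis using assms by (auto simp: adj_def)
qed

lemma not_adj_same: "\<not> adj x x"
  by (intro not_adj_void) (simp add: rl_def role_same)

lemma pair_graph_G: "pair_graph G"
proof
  show "finite (pverts G)" by (simp add: finite_V)
  show "finite (parcs G)" using finite_V by (auto simp: G_def intro: finite_subset[of _ "V \<times> V"])
  show "fst e \<in> pverts G" if "e \<in> parcs G" for e using that by (cases e) (simp add: parcs_G)
  show "snd e \<in> pverts G" if "e \<in> parcs G" for e using that by (cases e) (simp add: parcs_G)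
  show "fst e \<noteq> snd e" if "e \<in> parcs G" for e using that not_adj_same by (cases e) (auto simp: parcs_G)
  have "sym (parcs G)" by (auto simp: sym_def parcs_G adj_sym)
  then show "symmetric (with_proj G)" by (simp add: symmetric_def)
qed

section \<open>Fibres of the paths and orthogonality of the key signs\<close>

lemma M_pos: "1 \<le> M i"
proof (cases i)
  case 0
  then show ?thesis using t_pos R_pos by (simp add: M_0)
next
  case (Suc j)
  then show ?thesis using Q_pos[of j] q_pos[of j] by (simp add: M_Suc)
qed

text \<open>Extensions of a path to stage \<open>S\<close> times the number of keys. It depends on
  the stage only, so each stage cuts the vertex set into equal fibres.\<close>

definition fibre_size :: "nat \<Rightarrow> nat" where
  "fibre_size i = (\<Prod>j<S - i. M (Suc (i + j))) * 2 ^ card (\<Union>i\<le>S. parts M i)"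

lemma fibre_size_pos: "0 < fibre_size i"
  using M_pos by (auto simp: fibre_size_def Suc_le_eq intro!: prod_pos)

lemma fibre_labels:
  assumes "i \<le> S"
  shows "bij_betw (\<lambda>x. (path x, key x)) {x \<in> V. pt i x = X}
    ({p \<in> parts M (i + (S - i)). drop (S - i) p = X} \<times> Pow (\<Union>i\<le>S. parts M i))"
proof -
  define K where "K = (\<Union>i\<le>S. parts M i)"
  have S: "i + (S - i) = S" using assms by simp
  have surj: "(\<lambda>x. (path x, key x)) ` V = parts M S \<times> Pow K"
    using bij_betw_imp_surj_on[OF labels] by (simp only: K_def)
  show ?thesis
    unfolding S K_def[symmetric]
  proof (rule bij_betw_imageI)
    show "inj_on (\<lambda>x. (path x, key x)) {x \<in> V. pt i x = X}"
      using bij_betw_imp_inj_on[OF labels] by (rule inj_on_subset) auto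
    show "(\<lambda>x. (path x, key x)) ` {x \<in> V. pt i x = X} = {p \<in> parts M S. drop (S - i) p = X} \<times> Pow K"
    proof (intro equalityI subsetI)
      fix a assume "a \<in> (\<lambda>x. (path x, key x)) ` {x \<in> V. pt i x = X}"
      then obtain x where x: "x \<in> V" "pt i x = X" "a = (path x, key x)" by auto
      then have "a \<in> parts M S \<times> Pow K" unfolding surj[symmetric] by (intro image_eqI[of _ _ x])
      then show "a \<in> {p \<in> parts M S. drop (S - i) p = X} \<times> Pow K" using x by (simp add: pt_def)
    next
      fix a assume a: "a \<in> {p \<in> parts M S. drop (S - i) p = X} \<times> Pow K"
      then have "a \<in> parts M S \<times> Pow K" by auto
      then have "a \<in> (\<lambda>x. (path x, key x)) ` V" by (simp only: surj)
      then obtain x where "x \<in> V" "a = (path x, key x)" by (rule imageE)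
      then show "a \<in> (\<lambda>x. (path x, key x)) ` {x \<in> V. pt i x = X}"
        using a by (intro image_eqI[of _ _ x]) (auto simp: pt_def)
    qed
  qed
qed

lemma card_fibre:
  assumes "i \<le> S" "X \<in> parts M i"
  shows "card {x \<in> V. pt i x = X} = fibre_size i"
  using bij_betw_same_card[OF fibre_labels[OF assms(1)]] card_parts_drop[OF assms(2), of "S - i"]
  by (simp add: card_cartesian_product card_Pow fibre_size_def)

lemma card_V: "i \<le> S \<Longrightarrow> card V = fibre_size i * card (parts M i)"
proof -
  assume i: "i \<le> S"
  have "{x \<in> V. pt i x \<in> parts M i} = V" using pt_in_parts[OF _ i] by auto
  then show ?thesis using card_fibres[OF finite_V, of "parts M i" "pt i"] card_fibre[OF i] by simp
qed

lemma card_parts_pos: "0 < card (parts M i)"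
  using M_pos by (induction i) (auto simp: card_parts_0 card_parts_Suc Suc_le_eq simp del: parts.simps)

lemma card_parts_mono: "i \<le> j \<Longrightarrow> card (parts M i) \<le> card (parts M j)"
proof (rule lift_Suc_mono_le[where f = "\<lambda>i. card (parts M i)"])
  show "card (parts M n) \<le> card (parts M (Suc n))" for n
    using M_pos[of "Suc n"] by (simp add: card_parts_Suc del: parts.simps)
qed

lemma V_nonempty: "V \<noteq> {}"
proof
  assume "V = {}"
  then have "fibre_size 0 * card (parts M 0) = 0" using card_V[of 0] by simp
  then show False using fibre_size_pos[of 0] card_parts_pos[of 0] by simp
qed

definition sg :: "nat \<Rightarrow> nat list \<Rightarrow> real" where
  "sg x Y = (if Y \<in> key x then 1 else -1)"

text \<open>On a fibre the key still runs through all subsets, independently of how the path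
  continues.\<close>

lemma sum_sg_orthogonal:
  assumes i: "i \<le> S" and Y: "Y \<in> parts M i" "Y' \<in> parts M i" "Y \<noteq> Y'"
  shows "(\<Sum>x | x \<in> V \<and> pt i x = X. sg x Y * sg x Y') = 0"
proof -
  define F where "F p = (if Y \<in> snd p then 1 else -1) * (if Y' \<in> snd p then 1 else -1 :: real)" for p :: "nat list \<times> nat list set"
  have fin: "finite (\<Union>i\<le>S. parts M i)" by simp
  have "(\<Sum>x | x \<in> V \<and> pt i x = X. sg x Y * sg x Y') = (\<Sum>x | x \<in> V \<and> pt i x = X. F (path x, key x))"
    by (simp add: F_def sg_def)
  also have "\<dots> = sum F ({p \<in> parts M (i + (S - i)). drop (S - i) p = X} \<times> Pow (\<Union>i\<le>S. parts M i))"
    by (rule sum.reindex_bij_betw[OF fibre_labels[OF i]])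
  also have "\<dots> = (\<Sum>p\<in>{p \<in> parts M (i + (S - i)). drop (S - i) p = X}. \<Sum>k\<in>Pow (\<Union>i\<le>S. parts M i).
      (if Y \<in> k then 1 else -1) * (if Y' \<in> k then 1 else -1 :: real))"
    unfolding F_def sum.cartesian_product by (intro sum.cong refl) auto
  also have "\<dots> = 0"
    using sum_Pow_sign_product[OF fin, of Y Y'] Y i by (intro sum.neutral) auto
  finally show ?thesis .
qed

text \<open>Row by row, orthogonality of the signs bounds the sum by Cauchy--Schwarz.\<close>

lemma sign_sum_bound:
  fixes c :: "nat list \<Rightarrow> nat list \<Rightarrow> real"
  assumes i: "i \<le> S" and U: "U \<subseteq> V" "U' \<subseteq> V" and c: "\<And>X Y. \<bar>c X Y\<bar> \<le> 1"
  shows "\<bar>\<Sum>x\<in>U. \<Sum>y\<in>U'. c (pt i x) (pt i y) * (sg x (pt i y) * sg y (pt i x))\<bar> \<le>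
    (real (card V))\<^sup>2 / sqrt (card (parts M i))"
proof -
  define P where "P = parts M i"
  define m h where "m = real (card P)" and "h = real (fibre_size i)"
  have finP: "finite P" by (simp add: P_def)
  have m: "0 < m" using card_parts_pos by (simp add: m_def P_def)
  have h: "0 < h" using fibre_size_pos by (simp add: h_def)
  have n: "real (card V) = h * m" using card_V[OF i] by (simp add: h_def m_def P_def)
  have ptP: "pt i x \<in> P" if "x \<in> V" for x using pt_in_parts[OF that i] by (simp add: P_def)
  have fib: "real (card {x \<in> V. pt i x = X}) = h" if "X \<in> P" for X
    using card_fibre[OF i] that by (simp add: P_def h_def)
  have finU: "finite U" "finite U'" using U finite_V finite_subset by auto
  define b where "b X Y = c X Y * (\<Sum>y\<in>{y \<in> U'. pt i y = Y}. sg y X)" for X Y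
  have b: "(b X Y)\<^sup>2 \<le> h\<^sup>2" if "Y \<in> P" for X Y
  proof -
    have "\<bar>\<Sum>y\<in>{y \<in> U'. pt i y = Y}. sg y X\<bar> \<le> (\<Sum>y\<in>{y \<in> U'. pt i y = Y}. \<bar>sg y X\<bar>)" by (rule sum_abs)
    also have "\<dots> \<le> (\<Sum>y\<in>{y \<in> U'. pt i y = Y}. 1)" by (intro sum_mono) (auto simp: sg_def)
    also have "\<dots> = real (card {y \<in> U'. pt i y = Y})" by simp
    also have "\<dots> \<le> real (card {y \<in> V. pt i y = Y})"
      using U finite_V by (intro of_nat_mono card_mono) auto
    finally have "\<bar>\<Sum>y\<in>{y \<in> U'. pt i y = Y}. sg y X\<bar> \<le> h" using fib[OF that] by simp
    then have "\<bar>b X Y\<bar> \<le> 1 * h" unfolding b_def abs_mult using c by (intro mult_mono) auto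
    then show ?thesis using h by (intro power2_le_iff_abs_le[THEN iffD2]) auto
  qed
  \<comment> \<open>Grouping \<open>y\<close> by its path leaves coefficients \<open>b X Y\<close>
    that see only the path \<open>X\<close> of \<open>x\<close>. The key of \<open>x\<close> enters
    through \<open>sg x Y\<close> alone, which is what makes the orthogonality applicable.\<close>
  have inner: "(\<Sum>y\<in>U'. c X (pt i y) * (sg x (pt i y) * sg y X)) = (\<Sum>Y\<in>P. sg x Y * b X Y)" for x X
  proof -
    have "(\<Sum>y\<in>U'. c X (pt i y) * (sg x (pt i y) * sg y X)) =
      (\<Sum>Y\<in>P. \<Sum>y\<in>{y \<in> U'. pt i y = Y}. c X (pt i y) * (sg x (pt i y) * sg y X))"
    proof (rule sum.group[symmetric, OF finU(2) finP])
      show "pt i ` U' \<subseteq> P" using ptP U by auto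
    qed
    also have "\<dots> = (\<Sum>Y\<in>P. sg x Y * b X Y)"
    proof (rule sum.cong[OF refl])
      fix Y assume "Y \<in> P"
      have "(\<Sum>y\<in>{y \<in> U'. pt i y = Y}. c X (pt i y) * (sg x (pt i y) * sg y X)) =
          (\<Sum>y\<in>{y \<in> U'. pt i y = Y}. (sg x Y * c X Y) * sg y X)"
        by (rule sum.cong[OF refl]) simp
      then show "(\<Sum>y\<in>{y \<in> U'. pt i y = Y}. c X (pt i y) * (sg x (pt i y) * sg y X)) = sg x Y * b X Y"
        by (simp only: b_def sum_distrib_left mult.assoc)
    qed
    finally show ?thesis .
  qed
  have row: "(\<Sum>x | x \<in> V \<and> pt i x = X. \<bar>\<Sum>Y\<in>P. sg x Y * b X Y\<bar>) \<le> h\<^sup>2 * sqrt m" if X: "X \<in> P" for X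
  proof -
    define F where "F = {x. x \<in> V \<and> pt i x = X}"
    have F: "finite F" "real (card F) = h" using finite_V fib[OF X] by (auto simp: F_def)
    have "(\<Sum>x\<in>F. (\<Sum>Y\<in>P. sg x Y * b X Y)\<^sup>2) = (\<Sum>x\<in>F. \<Sum>Y\<in>P. \<Sum>Y'\<in>P. (b X Y * b X Y') * (sg x Y * sg x Y'))"
      unfolding power2_eq_square sum_product by (intro sum.cong refl) (simp only: mult_ac)
    also have "\<dots> = (\<Sum>Y\<in>P. \<Sum>x\<in>F. \<Sum>Y'\<in>P. (b X Y * b X Y') * (sg x Y * sg x Y'))" by (rule sum.swap)
    also have "\<dots> = (\<Sum>Y\<in>P. \<Sum>Y'\<in>P. \<Sum>x\<in>F. (b X Y * b X Y') * (sg x Y * sg x Y'))"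
      by (intro sum.cong refl sum.swap)
    also have "\<dots> = (\<Sum>Y\<in>P. \<Sum>Y'\<in>P. if Y' = Y then h * (b X Y)\<^sup>2 else 0)"
    proof (intro sum.cong refl)
      fix Y Y' assume Y: "Y \<in> P" "Y' \<in> P"
      show "(\<Sum>x\<in>F. (b X Y * b X Y') * (sg x Y * sg x Y')) = (if Y' = Y then h * (b X Y)\<^sup>2 else 0)"
      proof (cases "Y' = Y")
        case True
        have "sg x Y * sg x Y = 1" for x by (simp add: sg_def)
        then show ?thesis using True F by (simp add: power2_eq_square)
      next
        case False
        then show ?thesis
          using sum_sg_orthogonal[OF i, of Y Y' X] Y by (simp add: sum_distrib_left[symmetric] F_def P_def)
      qed
    qed
    also have "\<dots> = (\<Sum>Y\<in>P. h * (b X Y)\<^sup>2)" using finP by simp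
    also have "\<dots> \<le> (\<Sum>Y\<in>P. h * h\<^sup>2)" using b h by (intro sum_mono mult_left_mono) auto
    also have "\<dots> = m * (h * h\<^sup>2)" by (simp add: m_def)
    finally have sq: "(\<Sum>x\<in>F. (\<Sum>Y\<in>P. sg x Y * b X Y)\<^sup>2) \<le> m * (h * h\<^sup>2)" .
    \<comment> \<open>Cauchy-Schwarz over the \<open>h\<close> vertices of one row. Summed over
      \<open>m\<close> rows this becomes m h^2 sqrt m, which is |V|^2 / sqrt m.\<close>
    have "(\<Sum>x\<in>F. \<bar>\<Sum>Y\<in>P. sg x Y * b X Y\<bar> * 1)\<^sup>2 \<le> (\<Sum>x\<in>F. \<bar>\<Sum>Y\<in>P. sg x Y * b X Y\<bar>\<^sup>2) * (\<Sum>x\<in>F. 1\<^sup>2)"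
      by (rule Cauchy_Schwarz_ineq_sum)
    also have "\<dots> = (\<Sum>x\<in>F. (\<Sum>Y\<in>P. sg x Y * b X Y)\<^sup>2) * h" using F by simp
    also have "\<dots> \<le> (m * (h * h\<^sup>2)) * h" using sq h by (intro mult_right_mono) auto
    also have "\<dots> = h\<^sup>2 * h\<^sup>2 * m" by (simp only: power2_eq_square mult_ac)
    also have "\<dots> = (h\<^sup>2 * sqrt m)\<^sup>2"
      using m by (simp only: power_mult_distrib real_sqrt_pow2 less_imp_le) (simp only: power2_eq_square)
    finally have "(\<Sum>x\<in>F. \<bar>\<Sum>Y\<in>P. sg x Y * b X Y\<bar>)\<^sup>2 \<le> (h\<^sup>2 * sqrt m)\<^sup>2" by simp
    then have "(\<Sum>x\<in>F. \<bar>\<Sum>Y\<in>P. sg x Y * b X Y\<bar>) \<le> h\<^sup>2 * sqrt m"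
      by (rule power2_le_imp_le) (use m in simp)
    then show ?thesis by (simp add: F_def)
  qed
  have "(\<Sum>x\<in>U. \<Sum>y\<in>U'. c (pt i x) (pt i y) * (sg x (pt i y) * sg y (pt i x))) =
    (\<Sum>x\<in>U. \<Sum>Y\<in>P. sg x Y * b (pt i x) Y)"
    by (intro sum.cong refl inner)
  then have "\<bar>\<Sum>x\<in>U. \<Sum>y\<in>U'. c (pt i x) (pt i y) * (sg x (pt i y) * sg y (pt i x))\<bar> \<le>
    (\<Sum>x\<in>U. \<bar>\<Sum>Y\<in>P. sg x Y * b (pt i x) Y\<bar>)" by (simp only: sum_abs)
  also have "\<dots> \<le> (\<Sum>x\<in>V. \<bar>\<Sum>Y\<in>P. sg x Y * b (pt i x) Y\<bar>)"
    using U finite_V by (intro sum_mono2) auto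
  also have "\<dots> = (\<Sum>X\<in>P. \<Sum>x | x \<in> V \<and> pt i x = X. \<bar>\<Sum>Y\<in>P. sg x Y * b (pt i x) Y\<bar>)"
  proof (rule sum.group[symmetric, OF finite_V finP])
    show "pt i ` V \<subseteq> P" using ptP by auto
  qed
  also have "\<dots> = (\<Sum>X\<in>P. \<Sum>x | x \<in> V \<and> pt i x = X. \<bar>\<Sum>Y\<in>P. sg x Y * b X Y\<bar>)"
    by (rule sum.cong[OF refl], rule sum.cong[OF refl]) simp
  also have "\<dots> \<le> (\<Sum>X\<in>P. h\<^sup>2 * sqrt m)" using row by (intro sum_mono) auto
  also have "\<dots> = m * (h\<^sup>2 * sqrt m)" by (simp add: m_def)
  also have "\<dots> = (real (card V))\<^sup>2 / sqrt (card (parts M i))"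
  proof -
    have "sqrt m * sqrt m = m" using m by simp
    then have "m * (h\<^sup>2 * sqrt m) * sqrt m = m * h\<^sup>2 * m" by (simp only: mult.assoc)
    also have "\<dots> = (real (card V))\<^sup>2" by (simp only: n power2_eq_square mult_ac)
    finally have "m * (h\<^sup>2 * sqrt m) = (real (card V))\<^sup>2 / sqrt m" using m by (intro eq_divide_imp) auto
    then show ?thesis by (simp only: m_def P_def)
  qed
  finally show ?thesis .
qed

text \<open>A role owns \<open>R\<close> of the \<open>16 * t * R\<close> residues; the share is 1 /
  (16 t) and not 1 / (8 t) because the even sums are set apart.\<close>

lemma card_rl_range:
  assumes "1 \<notin> {u..<v}" "v \<le> 8 * t" "u \<le> v"
  shows "real (card {(x, y). x \<in> V \<and> y \<in> V \<and> u \<le> rl x y \<and> rl x y < v}) = (real v - real u) / (16 * t) * (real (card V))\<^sup>2"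
proof -
  have one: "card {y \<in> V. u \<le> rl x y \<and> rl x y < v} = fibre_size 0 * ((v - u) * R)" if x: "x \<in> V" for x
  proof -
    from pt_in_parts[OF x, of 0] have "pt 0 x \<in> parts M 0" by simp
    from this obtain a where a: "pt 0 x = [a]" "a < M 0" by (rule parts_0E)
    define T where "T = {b. b < 16 * t * R \<and> u \<le> role t R a b \<and> role t R a b < v}"
    have Tc: "card T = (v - u) * R"
      unfolding T_def using a assms R_pos by (intro card_role) (auto simp: M_0)
    have sub: "(\<lambda>b. [b]) ` T \<subseteq> parts M 0" by (auto simp: T_def M_0)
    have "{y \<in> V. u \<le> rl x y \<and> rl x y < v} = {y \<in> V. pt 0 y \<in> (\<lambda>b. [b]) ` T}"
    proof (intro Collect_cong conj_cong refl)
      fix y assume y: "y \<in> V"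
      from pt_in_parts[OF y, of 0] have "pt 0 y \<in> parts M 0" by simp
      from this obtain a' where a': "pt 0 y = [a']" "a' < M 0" by (rule parts_0E)
      show "(u \<le> rl x y \<and> rl x y < v) = (pt 0 y \<in> (\<lambda>b. [b]) ` T)"
        using a a' by (auto simp: rl_def T_def M_0)
    qed
    moreover have "card {y \<in> V. pt 0 y \<in> (\<lambda>b. [b]) ` T} = fibre_size 0 * card ((\<lambda>b. [b]) ` T)"
      using sub finite_subset[OF sub] card_fibre[of 0] by (intro card_fibres finite_V) auto
    moreover have "card ((\<lambda>b. [b]) ` T) = card T" by (rule card_image) (simp add: inj_on_def)
    ultimately show ?thesis using Tc by simp
  qed
  have "{(x, y). x \<in> V \<and> y \<in> V \<and> u \<le> rl x y \<and> rl x y < v} = (SIGMA x:V. {y \<in> V. u \<le> rl x y \<and> rl x y < v})" by auto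
  then have "card {(x, y). x \<in> V \<and> y \<in> V \<and> u \<le> rl x y \<and> rl x y < v} = card (SIGMA x:V. {y \<in> V. u \<le> rl x y \<and> rl x y < v})"
    by (rule arg_cong)
  then have "card {(x, y). x \<in> V \<and> y \<in> V \<and> u \<le> rl x y \<and> rl x y < v} = card V * (fibre_size 0 * ((v - u) * R))"
    using finite_V one by simp
  moreover have "real (card V) = fibre_size 0 * (16 * t * R)"
    using card_V[of 0] by (simp only: card_parts_0 M_0 of_nat_mult of_nat_numeral)
  then have "fibre_size 0 * real R = real (card V) / (16 * t)" using t_pos by (simp add: field_simps)
  moreover have "real (card V * (fibre_size 0 * ((v - u) * R))) = real (card V) * (real (v - u) * (fibre_size 0 * real R))"
    by simp
  ultimately have "real (card {(x, y). x \<in> V \<and> y \<in> V \<and> u \<le> rl x y \<and> rl x y < v}) =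
     real (card V) * (real (v - u) * (real (card V) / (16 * t)))" by (simp only:)
  then show ?thesis using assms(3) by (simp add: power2_eq_square of_nat_diff)
qed

end

section \<open>The gap in mean square density\<close>

lemma nearly_constant_cell:
  fixes \<kappa> :: real
  assumes fin: "finite U" "finite U'" and C: "C \<subseteq> U" "C' \<subseteq> U'"
    and big: "(1 - \<kappa>) * card U \<le> card C" "(1 - \<kappa>) * card U' \<le> card C'"
    and const: "\<And>x y. x \<in> C \<Longrightarrow> y \<in> C' \<Longrightarrow> (x, y) \<in> E \<longleftrightarrow> v"
  shows "card (E \<inter> U \<times> U') \<le> 2 * \<kappa> * (card U * card U') \<or> card (U \<times> U' - E) \<le> 2 * \<kappa> * (card U * card U')"
proof -
  have small: "card (U \<times> U' - C \<times> C') \<le> 2 * \<kappa> * (card U * card U')"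
  proof -
    have "U \<times> U' - C \<times> C' \<subseteq> (U - C) \<times> U' \<union> U \<times> (U' - C')" by auto
    then have "card (U \<times> U' - C \<times> C') \<le> card ((U - C) \<times> U' \<union> U \<times> (U' - C'))"
      using fin by (intro card_mono) auto
    also have "\<dots> \<le> card ((U - C) \<times> U') + card (U \<times> (U' - C'))" by (rule card_Un_le)
    also have "\<dots> = (card U - card C) * card U' + card U * (card U' - card C')"
      using C finite_subset[OF C(1) fin(1)] finite_subset[OF C(2) fin(2)]
      by (simp add: card_cartesian_product card_Diff_subset)
    finally have "real (card (U \<times> U' - C \<times> C')) \<le> real ((card U - card C) * card U' + card U * (card U' - card C'))"
      by (simp only: of_nat_le_iff)
    also have "\<dots> = (real (card U) - card C) * card U' + card U * (real (card U') - card C')"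
      using fin C by (simp add: of_nat_diff card_mono)
    also have "\<dots> \<le> (\<kappa> * card U) * card U' + card U * (\<kappa> * card U')"
      using big by (intro add_mono mult_right_mono mult_left_mono) (auto simp: algebra_simps)
    finally show ?thesis by (simp add: algebra_simps)
  qed
  show ?thesis
  proof (cases v)
    case True
    then have "U \<times> U' - E \<subseteq> U \<times> U' - C \<times> C'" using const by auto
    then have "card (U \<times> U' - E) \<le> card (U \<times> U' - C \<times> C')" using fin by (intro card_mono) auto
    then show ?thesis using small by linarith
  next
    case False
    then have "E \<inter> U \<times> U' \<subseteq> U \<times> U' - C \<times> C'" using const by auto
    then have "card (E \<inter> U \<times> U') \<le> card (U \<times> U' - C \<times> C')" using fin by (intro card_mono) auto
    then show ?thesis using small by linarith
  qed
qed

lemma exists_majority: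
  assumes "finite (C :: 'a set)"
  shows "\<exists>\<alpha>. card C \<le> 2 * card {x \<in> C. a x = (\<alpha>::bool)}"
proof -
  have "C = {x \<in> C. a x} \<union> {x \<in> C. \<not> a x}" by auto
  then have c: "card C = card {x \<in> C. a x} + card {x \<in> C. \<not> a x}"
    using assms by (subst card_Un_disjoint[symmetric]) auto
  show ?thesis
  proof (cases "card {x \<in> C. a x} \<ge> card {x \<in> C. \<not> a x}")
    case True
    then show ?thesis using c by (intro exI[of _ True]) simp
  next
    case False
    then show ?thesis using c by (intro exI[of _ False]) simp
  qed
qed

text \<open>The keys are resolved by regularity itself. If the bit \<open>a\<close> took both values
  on a share \<gamma> of \<open>U\<close>, it would form a full and an empty rectangle with the
  majority bit of C'; likewise for \<open>b\<close>. So both bits are nearly constant and the cell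
  is nearly pure.\<close>

lemma regular_sign_pattern_cell:
  fixes G :: "'v pair_pre_digraph" and U U' :: "'v set" and a b :: "'v \<Rightarrow> bool" and \<kappa> \<gamma> :: real
  assumes fin: "finite U" "finite U'" "U \<noteq> {}" "U' \<noteq> {}" and C: "C \<subseteq> U" "C' \<subseteq> U'"
    and big: "(1 - \<kappa>) * card U \<le> card C" "(1 - \<kappa>) * card U' \<le> card C'"
    and edge: "\<And>x y. x \<in> C \<Longrightarrow> y \<in> C' \<Longrightarrow> (x, y) \<in> parcs G \<longleftrightarrow> a x = b y"
    and reg: "regular_pair G \<gamma> \<gamma> U U'" and \<gamma>: "0 < \<gamma>" "\<gamma> \<le> 1 / 8" and \<kappa>: "\<kappa> \<le> 1 / 4"
  shows "card (parcs G \<inter> U \<times> U') \<le> 2 * (\<kappa> + \<gamma>) * (card U * card U') \<or>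
    card (U \<times> U' - parcs G) \<le> 2 * (\<kappa> + \<gamma>) * (card U * card U')"
proof -
  have finC: "finite C" "finite C'" using C fin finite_subset by auto
  have half: "\<gamma> * card W \<le> card {x \<in> D. p x = \<alpha>}"
    if "(1 - \<kappa>) * card W \<le> card D" "card D \<le> 2 * card {x \<in> D. p x = \<alpha>}" for W D :: "'v set" and p :: "'v \<Rightarrow> bool" and \<alpha>
  proof -
    have "(2 * \<gamma>) * card W \<le> (1 - \<kappa>) * card W" using \<gamma> \<kappa> by (intro mult_right_mono) auto
    moreover have "real (card D) \<le> 2 * real (card {x \<in> D. p x = \<alpha>})" using that(2) by linarith
    ultimately show ?thesis using that(1) by linarith
  qed
  obtain \<alpha> where \<alpha>: "card C \<le> 2 * card {x \<in> C. a x = \<alpha>}" using exists_majority[OF finC(1)] ..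
  obtain \<beta> where \<beta>: "card C' \<le> 2 * card {y \<in> C'. b y = \<beta>}" using exists_majority[OF finC(2)] ..
  note \<alpha>' = half[OF big(1) \<alpha>] and \<beta>' = half[OF big(2) \<beta>]
  have \<gamma>1: "\<gamma> < 1" using \<gamma> by simp
  have a: "card {x \<in> C. a x \<noteq> \<alpha>} < \<gamma> * card U"
  proof (rule ccontr)
    assume "\<not> card {x \<in> C. a x \<noteq> \<alpha>} < \<gamma> * card U"
    then have min: "\<gamma> * card U \<le> card {x \<in> C. a x \<noteq> \<alpha>}" by simp
    have lg: "\<gamma> * card U \<le> card {x \<in> C. a x = c}" for c
    proof (cases "c = \<alpha>")
      case True
      then show ?thesis using \<alpha>' by simp
    next
      case False
      then have "{x \<in> C. a x = c} = {x \<in> C. a x \<noteq> \<alpha>}" by (cases c; cases \<alpha>) simp_all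
      then show ?thesis using min by (simp only:)
    qed
    have "\<not> regular_pair G \<gamma> \<gamma> U U'"
    proof (rule not_regular_pairI[where X\<^sub>1 = "{x \<in> C. a x = \<beta>}" and X\<^sub>0 = "{x \<in> C. a x = (\<not> \<beta>)}"
          and Y\<^sub>1 = "{y \<in> C'. b y = \<beta>}" and Y\<^sub>0 = "{y \<in> C'. b y = \<beta>}"])
    qed (use fin C \<gamma> \<gamma>1 lg \<beta>' edge in auto)
    then show False using reg by simp
  qed
  have b: "card {y \<in> C'. b y \<noteq> \<beta>} < \<gamma> * card U'"
  proof (rule ccontr)
    assume "\<not> card {y \<in> C'. b y \<noteq> \<beta>} < \<gamma> * card U'"
    then have min: "\<gamma> * card U' \<le> card {y \<in> C'. b y \<noteq> \<beta>}" by simp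
    have lg: "\<gamma> * card U' \<le> card {y \<in> C'. b y = c}" for c
    proof (cases "c = \<beta>")
      case True
      then show ?thesis using \<beta>' by simp
    next
      case False
      then have "{y \<in> C'. b y = c} = {y \<in> C'. b y \<noteq> \<beta>}" by (cases c; cases \<beta>) simp_all
      then show ?thesis using min by (simp only:)
    qed
    have "\<not> regular_pair G \<gamma> \<gamma> U U'"
    proof (rule not_regular_pairI[where X\<^sub>1 = "{x \<in> C. a x = \<alpha>}" and X\<^sub>0 = "{x \<in> C. a x = \<alpha>}"
          and Y\<^sub>1 = "{y \<in> C'. b y = \<alpha>}" and Y\<^sub>0 = "{y \<in> C'. b y = (\<not> \<alpha>)}"])
    qed (use fin C \<gamma> \<gamma>1 lg \<alpha>' edge in auto)
    then show False using reg by simp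
  qed
  have part: "(1 - (\<kappa> + \<gamma>)) * card W \<le> card {x \<in> D. p x = c}"
    if "(1 - \<kappa>) * card W \<le> card D" "card {x \<in> D. p x \<noteq> c} < \<gamma> * card W" "finite D"
    for W D :: "'v set" and p :: "'v \<Rightarrow> bool" and c
  proof -
    have "D = {x \<in> D. p x = c} \<union> {x \<in> D. p x \<noteq> c}" by auto
    then have "card D = card {x \<in> D. p x = c} + card {x \<in> D. p x \<noteq> c}"
      using that(3) by (subst card_Un_disjoint[symmetric]) auto
    then show ?thesis using that(1,2) by (simp add: algebra_simps)
  qed
  show ?thesis
  proof (rule nearly_constant_cell[where C = "{x \<in> C. a x = \<alpha>}" and C' = "{y \<in> C'. b y = \<beta>}" and v = "\<alpha> = \<beta>"])
    show "(1 - (\<kappa> + \<gamma>)) * card U \<le> card {x \<in> C. a x = \<alpha>}" using part[OF big(1) a finC(1)] .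
    show "(1 - (\<kappa> + \<gamma>)) * card U' \<le> card {y \<in> C'. b y = \<beta>}" using part[OF big(2) b finC(2)] .
  qed (use fin C edge in auto)
qed

section \<open>Separation of types and the energy pairs seen by a coarse partition\<close>

context tower_graph begin

lemma types_separated:
  assumes "a \<in> parts M 0" "a' \<in> parts M 0" "a \<noteq> a'"
  shows "\<exists>b\<in>parts M 0. \<exists>c.
    (\<forall>x\<in>V. \<forall>y\<in>V. pt 0 x = a \<longrightarrow> pt 0 y = b \<longrightarrow> ((x, y) \<in> parcs G \<longleftrightarrow> c)) \<and>
    (\<forall>x\<in>V. \<forall>y\<in>V. pt 0 x = a' \<longrightarrow> pt 0 y = b \<longrightarrow> ((x, y) \<in> parcs G \<longleftrightarrow> \<not> c))"
proof -
  from assms(1) obtain u where u: "a = [u]" "u < M 0" by (rule parts_0E)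
  from assms(2) obtain u' where u': "a' = [u']" "u' < M 0" by (rule parts_0E)
  have ne: "u \<noteq> u'" using assms(3) u u' by simp
  have full: "(x, y) \<in> parcs G" if "x \<in> V" "y \<in> V" "pt 0 x = [v]" "pt 0 y = [w]" "role t R v w = 2 * t" for x y v w
    using that by (simp add: parcs_G adj_complete rl_def)
  have void: "(x, y) \<notin> parcs G" if "x \<in> V" "y \<in> V" "pt 0 x = [v]" "pt 0 y = [w]"
    "role t R v w = 1 \<or> 2 * t < role t R v w \<and> role t R v w < 7 * t" for x y v w
    using that not_adj_void[of x y] by (simp add: parcs_G rl_def)
  from role_separates[OF t_pos R_pos _ _ ne] u(2) u'(2)
  obtain w where w: "w < 16 * t * R" "(role t R u w = 2 * t \<and> (role t R u' w = 1 \<or> 2 * t < role t R u' w \<and> role t R u' w < 7 * t)) \<or>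
      (role t R u' w = 2 * t \<and> (role t R u w = 1 \<or> 2 * t < role t R u w \<and> role t R u w < 7 * t))"
    by (auto simp only: M_0)
  have "[w] \<in> parts M 0" using w(1) by (simp add: M_0)
  moreover from w(2) have "\<exists>c.
    (\<forall>x\<in>V. \<forall>y\<in>V. pt 0 x = a \<longrightarrow> pt 0 y = [w] \<longrightarrow> ((x, y) \<in> parcs G \<longleftrightarrow> c)) \<and>
    (\<forall>x\<in>V. \<forall>y\<in>V. pt 0 x = a' \<longrightarrow> pt 0 y = [w] \<longrightarrow> ((x, y) \<in> parcs G \<longleftrightarrow> \<not> c))"
  proof
    assume w: "role t R u w = 2 * t \<and> (role t R u' w = 1 \<or> 2 * t < role t R u' w \<and> role t R u' w < 7 * t)"
    show ?thesis
      by (rule exI[of _ True]) (use full[of _ _ u w] void[of _ _ u' w] w u u' in blast)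
  next
    assume w: "role t R u' w = 2 * t \<and> (role t R u w = 1 \<or> 2 * t < role t R u w \<and> role t R u w < 7 * t)"
    show ?thesis
      by (rule exI[of _ False]) (use full[of _ _ u' w] void[of _ _ u w] w u u' in blast)
  qed
  ultimately show ?thesis by blast
qed

text \<open>On an energy pair the edge indicator minus 1/2 is half a product of two signs, so
  \<open>sign_sum_bound\<close> applies level by level. All levels from \<open>l\<close> on use
  stages at least \<open>lev l\<close>, where the bound only improves; the factor \<open>t\<close>
  counts levels.\<close>

lemma energy_imbalance:
  assumes l: "1 \<le> l" "l < t" and U: "U \<subseteq> V" "U' \<subseteq> V"
  defines "T \<equiv> {(x, y). x \<in> V \<and> y \<in> V \<and> 2 * l \<le> rl x y \<and> rl x y < 2 * t}"
  shows "\<bar>real (card (parcs G \<inter> T \<inter> U \<times> U')) - real (card (T \<inter> U \<times> U')) / 2\<bar> \<le>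
    t * ((real (card V))\<^sup>2 / sqrt (card (parts M (lev l)))) / 2"
proof -
  have finU: "finite U" "finite U'" using U finite_V finite_subset by auto
  have cardR: "real (card (X \<inter> U \<times> U')) = (\<Sum>x\<in>U. \<Sum>y\<in>U'. of_bool ((x, y) \<in> X))" for X :: "(nat \<times> nat) set"
  proof -
    have "X \<inter> U \<times> U' = (SIGMA x:U. {y \<in> U'. (x, y) \<in> X})" by auto
    then have "card (X \<inter> U \<times> U') = card (SIGMA x:U. {y \<in> U'. (x, y) \<in> X})" by (rule arg_cong)
    then show ?thesis using finU by (simp add: Int_def)
  qed
  \<comment> \<open>\<open>sign_sum_bound\<close> admits weights that are functions of the two
    paths, so the role is recomputed from the types at the end of these paths.\<close>
  define c where "c k i X Y = (of_bool (role t R (hd (drop i X)) (hd (drop i Y)) div 2 = k) :: real)" for k i X Y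
  define F where "F k x y = c k (lev k) (pt (lev k) x) (pt (lev k) y) *
    (sg x (pt (lev k) y) * sg y (pt (lev k) x))" for k x y
  have cell: "of_bool ((x, y) \<in> parcs G \<inter> T) - of_bool ((x, y) \<in> T) / 2 = (\<Sum>k\<in>{l..<t}. F k x y) / 2"
    if xy: "x \<in> V" "y \<in> V" for x y
  proof -
    have F: "F k x y = of_bool (k = rl x y div 2) * (sg x (pt (lev k) y) * sg y (pt (lev k) x))" if "k \<in> {l..<t}" for k
    proof -
      have "lev k \<le> S" using lev[of k] that l by auto
      then have "drop (lev k) (pt (lev k) x) = pt 0 x" "drop (lev k) (pt (lev k) y) = pt 0 y"
        using drop_pt[of 0 "lev k"] by simp_all
      then show ?thesis by (simp add: F_def c_def rl_def eq_commute)
    qed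
    define k0 where "k0 = rl x y div 2"
    have "(\<Sum>k\<in>{l..<t}. F k x y) = (\<Sum>k\<in>{l..<t}. if k = k0 then sg x (pt (lev k0) y) * sg y (pt (lev k0) x) else 0)"
      by (rule sum.cong[OF refl]) (simp add: F k0_def)
    also have "\<dots> = (if k0 \<in> {l..<t} then sg x (pt (lev k0) y) * sg y (pt (lev k0) x) else 0)"
      by simp
    finally have s: "(\<Sum>k\<in>{l..<t}. F k x y) = (if k0 \<in> {l..<t} then sg x (pt (lev k0) y) * sg y (pt (lev k0) x) else 0)" .
    show ?thesis
    proof (cases "k0 \<in> {l..<t}")
      case True
      then have r: "2 * l \<le> rl x y" "rl x y < 2 * t" by (auto simp: k0_def)
      then have T: "(x, y) \<in> T" using xy by (simp add: T_def)
      have "(x, y) \<in> parcs G \<longleftrightarrow> (pt (lev k0) y \<in> key x) = (pt (lev k0) x \<in> key y)"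
        using r l xy unfolding parcs_G k0_def by (subst adj_energy) auto
      then show ?thesis using True T s by (auto simp: sg_def)
    next
      case False
      then have "(x, y) \<notin> T" by (auto simp: T_def k0_def)
      moreover have "(\<Sum>k\<in>{l..<t}. F k x y) = 0" unfolding s using False by (rule if_not_P)
      ultimately show ?thesis by simp
    qed
  qed
  have "real (card (parcs G \<inter> T \<inter> U \<times> U')) - real (card (T \<inter> U \<times> U')) / 2 =
    (\<Sum>x\<in>U. \<Sum>y\<in>U'. of_bool ((x, y) \<in> parcs G \<inter> T) - of_bool ((x, y) \<in> T) / 2)"
    by (simp only: cardR sum_subtractf sum_divide_distrib)
  also have "\<dots> = (\<Sum>x\<in>U. \<Sum>y\<in>U'. (\<Sum>k\<in>{l..<t}. F k x y) / 2)"
    using U by (intro sum.cong refl cell) auto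
  also have "\<dots> = (\<Sum>x\<in>U. \<Sum>y\<in>U'. \<Sum>k\<in>{l..<t}. F k x y) / 2"
    by (simp only: sum_divide_distrib)
  also have "(\<Sum>x\<in>U. \<Sum>y\<in>U'. \<Sum>k\<in>{l..<t}. F k x y) = (\<Sum>k\<in>{l..<t}. \<Sum>x\<in>U. \<Sum>y\<in>U'. F k x y)"
  proof -
    have "(\<Sum>x\<in>U. \<Sum>y\<in>U'. \<Sum>k\<in>{l..<t}. F k x y) = (\<Sum>x\<in>U. \<Sum>k\<in>{l..<t}. \<Sum>y\<in>U'. F k x y)"
      by (rule sum.cong[OF refl], rule sum.swap)
    also have "\<dots> = (\<Sum>k\<in>{l..<t}. \<Sum>x\<in>U. \<Sum>y\<in>U'. F k x y)" by (rule sum.swap)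
    finally show ?thesis .
  qed
  finally have eq: "real (card (parcs G \<inter> T \<inter> U \<times> U')) - real (card (T \<inter> U \<times> U')) / 2 =
    (\<Sum>k\<in>{l..<t}. \<Sum>x\<in>U. \<Sum>y\<in>U'. F k x y) / 2" .
  define K where "K = (real (card V))\<^sup>2 / sqrt (card (parts M (lev l)))"
  have K0: "0 \<le> K" by (simp add: K_def)
  have "\<bar>\<Sum>k\<in>{l..<t}. \<Sum>x\<in>U. \<Sum>y\<in>U'. F k x y\<bar> \<le> (\<Sum>k\<in>{l..<t}. \<bar>\<Sum>x\<in>U. \<Sum>y\<in>U'. F k x y\<bar>)"
    by (rule sum_abs)
  also have "\<dots> \<le> (\<Sum>k\<in>{l..<t}. K)"
  proof (rule sum_mono)
    fix k assume k: "k \<in> {l..<t}"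
    have "\<bar>\<Sum>x\<in>U. \<Sum>y\<in>U'. F k x y\<bar> \<le> (real (card V))\<^sup>2 / sqrt (card (parts M (lev k)))"
      unfolding F_def using k l lev[of k] U by (intro sign_sum_bound) (auto simp: c_def)
    also have "\<dots> \<le> K"
      unfolding K_def
    proof (rule divide_left_mono)
      show "sqrt (card (parts M (lev l))) \<le> sqrt (card (parts M (lev k)))"
        using card_parts_mono[OF lev_mono[of l k]] k l by simp
      show "0 < sqrt (card (parts M (lev k))) * sqrt (card (parts M (lev l)))"
        using card_parts_pos by simp
    qed simp
    finally show "\<bar>\<Sum>x\<in>U. \<Sum>y\<in>U'. F k x y\<bar> \<le> K" .
  qed
  also have "\<dots> = real (t - l) * K" by simp
  also have "\<dots> \<le> t * K" using K0 by (intro mult_right_mono) auto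
  finally show ?thesis unfolding eq K_def by simp
qed

end

text \<open>\<eta> is a common tolerance for scattered parts, for mixed cells and for the loss of
  concentration. The numbers come from \<open>refinement_propagates\<close> with \<zeta> = 3 \<eta>:
  168 = 3 * 56 and 672 = 3 * 224, and 400 / \<open>Q i\<close> is the exceptional share at stage
  \<open>i\<close>.\<close>

locale tower_level = tower_graph +
  fixes l :: nat and B :: "nat set set" and \<gamma> \<eta> :: real
  assumes l: "1 \<le> l" "l < t"
    and B: "equitable_partition V B"
    and regular: "real (card {(U, U') \<in> B \<times> B. \<not> regular_pair G \<gamma> \<gamma> U U'}) \<le> \<gamma> * (real (card B))\<^sup>2"
    and \<gamma>: "0 < \<gamma>" and \<eta>: "0 < \<eta>" "\<eta> \<le> 1 / 672"
    and few_types: "4 * real (card (parts M 0)) * \<gamma> \<le> \<eta> / 4"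
    and few_stages: "real (card (parts M 0)) * \<gamma> + 8 * \<gamma> * lev l \<le> \<eta>"
    and large_Q: "(\<Sum>i<lev l. 4 * (if i = 0 then 0 else 400 / Q i)) \<le> \<eta> / 4"
    and dense: "\<And>i. i < lev l \<Longrightarrow> 112 * \<gamma> * card (parts M i) \<le> \<eta> * degree i"
    and untouched_large: "\<And>i. Suc i < lev l \<Longrightarrow> 168 * \<eta> * card (parts M i) \<le> untouched_degree i"
begin

lemma lev_l: "1 \<le> lev l" "lev l \<le> S"
  using lev[of l] l by auto

lemma \<gamma>_le: "\<gamma> \<le> \<eta>" "\<gamma> \<le> 1 / 64"
proof -
  have "1 * \<gamma> \<le> real (card (parts M 0)) * \<gamma>"
    using card_parts_pos[of 0] \<gamma> by (intro mult_right_mono) auto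
  moreover have "0 \<le> 8 * \<gamma> * lev l" using \<gamma> by simp
  ultimately show "\<gamma> \<le> \<eta>" using few_stages by linarith
  then show "\<gamma> \<le> 1 / 64" using \<eta> by linarith
qed

lemma few_scattered_parts:
  "card {U \<in> B. \<forall>X. card {x \<in> U. pt (lev l) x = X} < (1 - \<eta>) * card U} \<le> \<eta> * card B"
proof -
  \<comment> \<open>The start costs \<gamma> per type and every stage 8 \<gamma>. By
    \<open>few_stages\<close> the total stays within \<eta>, so all thresholds may be relaxed to 1 -
    \<eta> at the end.\<close>
  define \<beta> where "\<beta> i = real (card (parts M 0)) * \<gamma> + 8 * \<gamma> * real i" for i
  have part: "partition_on V B" using B by (simp add: equitable_partition_def)
  have finB: "finite B" using partition_onD1[OF part] finite_V by (metis finite_UnionD)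
  have "card {U \<in> B. \<exists>i\<le>lev l. \<forall>X. card {x \<in> U. pt i x = X} < (1 - \<beta> i) * card U} \<le> \<eta> * card B"
  proof (rule refinement_propagates[where G = G and P = "parts M" and pt = pt and N = nbhd and s = bit and D = degree
        and h = fibre_size and \<zeta> = "3 * \<eta>" and \<phi> = "\<lambda>i. if i = 0 then 0 else 400 / Q i" and \<gamma> = \<gamma>])
    show "equitable_partition (pverts G) B" "finite (pverts G)" "pverts G \<noteq> {}"
      using B finite_V V_nonempty by auto
    show "real (card {(U, U') \<in> B \<times> B. \<not> regular_pair G \<gamma> \<gamma> U U'}) \<le> \<gamma> * (real (card B))\<^sup>2" by (rule regular)
    show "finite (parts M i)" for i by simp
    show "pt i ` pverts G \<subseteq> parts M i" if "i \<le> lev l" for i using pt_in_parts that lev_l by auto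
    show "card {x \<in> pverts G. pt i x = X} = fibre_size i" if "i \<le> lev l" "X \<in> parts M i" for i X
      using card_fibre that lev_l by simp
    show "nbhd i X \<subseteq> parts M i" for i X by (auto simp: nbhd_def)
    show "card (nbhd i X) = degree i" if "X \<in> parts M i" for i X using card_nbhd[OF that] .
    show "((x, y) \<in> parcs G) = (bit i x (pt i y) = bit i y (pt i x))"
      if "i < lev l" "x \<in> pverts G" "y \<in> pverts G" "pt i y \<in> nbhd i (pt i x)" for i x y
      using that adj_touched[of i x y] lev_l by (simp add: parcs_G nbhd_def)
    show "degree i \<le> 4 * card {Y \<in> nbhd i (pt i x). bit i x Y \<noteq> bit i x' Y}"
      if i: "i < lev l" and x: "x \<in> pverts G" "x' \<in> pverts G" and eq: "pt i x = pt i x'" and ne: "pt (Suc i) x \<noteq> pt (Suc i) x'"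
      for i x x'
    proof -
      have iS: "i < S" using i lev_l by simp
      have x: "x \<in> V" "x' \<in> V" using x by auto
      define c c' where "c = hd (pt (Suc i) x)" and "c' = hd (pt (Suc i) x')"
      have c: "c < M (Suc i)" "c' < M (Suc i)" "c \<noteq> c'"
        using pt_Suc[OF x(1) iS] pt_Suc[OF x(2) iS] eq ne by (auto simp: c_def c'_def)
      have X: "pt i x \<in> parts M i" using pt_in_parts[OF x(1)] iS by simp
      have "{Y \<in> nbhd i (pt i x). bit i x Y \<noteq> bit i x' Y} = sym_diff (code i (pt i x) c) (code i (pt i x) c')"
        using code_sub[OF iS X c(1)] code_sub[OF iS X c(2)] by (auto simp: bit_def c_def c'_def eq)
      then show ?thesis using code_dist[OF iS X c] by simp
    qed
    show "bit i x Y = bit i x' Y"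
      if i: "i < lev l" and x: "x \<in> pverts G" "x' \<in> pverts G" and eq: "pt (Suc i) x = pt (Suc i) x'" for i x x' Y
    proof -
      have iS: "i < S" using i lev_l by simp
      have "pt i x = pt i x'" using tl_pt[OF iS, of x] tl_pt[OF iS, of x'] eq by simp
      then show ?thesis using eq by (simp add: bit_def)
    qed
    show "\<beta> (Suc i) = \<beta> i + 8 * \<gamma>" for i by (simp add: \<beta>_def algebra_simps)
    show "0 \<le> \<beta> 0" using \<gamma> by (simp add: \<beta>_def)
    show "\<beta> (lev l) \<le> 1 / 4" using few_stages \<eta> by (simp add: \<beta>_def)
    show "0 < \<gamma>" "\<gamma> \<le> 1 / 64" using \<gamma> \<gamma>_le by auto
    show "2 * \<eta> + \<beta> (lev l) \<le> 3 * \<eta>" using few_stages by (simp add: \<beta>_def)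
    show "0 < \<eta>" by (rule \<eta>)
    show "(\<Sum>i<lev l. 4 * (if i = 0 then 0 else 400 / real (Q i))) \<le> \<eta> / 4" by (rule large_Q)
    show "0 \<le> (if i = 0 then 0 else 400 / real (Q i))" for i by simp
    show "112 * \<gamma> * real (card (parts M i)) \<le> \<eta> * real (degree i)" if "i < lev l" for i using dense[OF that] .
    show "real (card {X \<in> parts M i. real (degree i) < 14 * sum w (nbhd i X)}) \<le> (if i = 0 then 0 else 400 / real (Q i)) * real (card (parts M i))"
      if i: "i < lev l" and w: "\<And>Y. Y \<in> parts M i \<Longrightarrow> 0 \<le> w Y \<and> w Y \<le> 1" and sum: "sum w (parts M i) \<le> 3 * \<eta> * real (card (parts M i))"
      for i and w :: "nat list \<Rightarrow> real"
    proof (cases i)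
      case 0
      have "card {X \<in> parts M 0. real (degree 0) < 14 * sum w (nbhd 0 X)} = 0"
        using w sum \<eta> unfolding 0 by (intro few_exceptional_0[where \<zeta> = "3 * \<eta>"]) auto
      then show ?thesis using 0 by simp
    next
      case (Suc j)
      have u: "168 * \<eta> * card (parts M j) \<le> untouched_degree j" using untouched_large i Suc by simp
      have "0 < 168 * \<eta> * card (parts M j)" using \<eta> card_parts_pos[of j] by simp
      then have "0 < untouched_degree j" using u by linarith
      then show ?thesis
        using w sum u unfolding Suc by (simp only: nat.distinct if_False) (rule few_exceptional_Suc[where \<zeta> = "3 * \<eta>"], auto)
    qed
    have m: "2 * real (card (parts M 0)) * \<gamma> \<le> 1" using few_types \<eta> by linarith
    have "card {U \<in> B. \<forall>X. card {x \<in> U. pt 0 x = X} < (1 - card (parts M 0) * \<gamma>) * card U} \<le> 4 * card (parts M 0) * \<gamma> * card B"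
    proof (rule card_unconcentrated_parts_le[where G = G and P = "parts M 0" and h = "fibre_size 0"])
      show "equitable_partition (pverts G) B" "finite (pverts G)" "pverts G \<noteq> {}"
        using B finite_V V_nonempty by auto
      show "real (card {(U, U') \<in> B \<times> B. \<not> regular_pair G \<gamma> \<gamma> U U'}) \<le> \<gamma> * (real (card B))\<^sup>2" by (rule regular)
      show "finite (parts M 0)" by (rule finite_parts)
      show "pt 0 ` pverts G \<subseteq> parts M 0" using pt_in_parts[of _ 0] by auto
      show "card {x \<in> pverts G. pt 0 x = X} = fibre_size 0" if "X \<in> parts M 0" for X using card_fibre[of 0, OF _ that] by simp
      show "0 < \<gamma>" by (rule \<gamma>)
      show "real (2 * card (parts M 0)) * \<gamma> \<le> 1" using m by simp
      show "\<exists>b\<in>parts M 0. \<exists>c. (\<forall>x\<in>pverts G. \<forall>y\<in>pverts G. pt 0 x = a \<longrightarrow> pt 0 y = b \<longrightarrow> ((x, y) \<in> parcs G) = c) \<and>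
          (\<forall>x\<in>pverts G. \<forall>y\<in>pverts G. pt 0 x = a' \<longrightarrow> pt 0 y = b \<longrightarrow> ((x, y) \<in> parcs G) = (\<not> c))"
        if "a \<in> parts M 0" "a' \<in> parts M 0" "a \<noteq> a'" for a a'
        using types_separated[OF that] by (simp only: pverts_G)
    qed
    also have "real (4 * card (parts M 0)) * \<gamma> * real (card B) \<le> \<eta> / 4 * card B"
      using few_types by (intro mult_right_mono) auto
    finally show "real (card {U \<in> B. \<forall>X. real (card {x \<in> U. pt 0 x = X}) < (1 - \<beta> 0) * real (card U)}) \<le> \<eta> / 4 * real (card B)"
      by (simp add: \<beta>_def)
  qed
  moreover have "{U \<in> B. \<forall>X. card {x \<in> U. pt (lev l) x = X} < (1 - \<eta>) * card U} \<subseteq>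
    {U \<in> B. \<exists>i\<le>lev l. \<forall>X. card {x \<in> U. pt i x = X} < (1 - \<beta> i) * card U}"
  proof -
    have "(1 - \<eta>) * card U \<le> (1 - \<beta> (lev l)) * card U" for U :: "nat set"
      using few_stages by (intro mult_right_mono) (auto simp: \<beta>_def)
    then have "card {x \<in> U. pt (lev l) x = X} < (1 - \<beta> (lev l)) * card U"
      if "card {x \<in> U. pt (lev l) x = X} < (1 - \<eta>) * card U" for U X
      using that by (meson less_le_trans)
    then show ?thesis by blast
  qed
  then have "card {U \<in> B. \<forall>X. card {x \<in> U. pt (lev l) x = X} < (1 - \<eta>) * card U} \<le>
    card {U \<in> B. \<exists>i\<le>lev l. \<forall>X. card {x \<in> U. pt i x = X} < (1 - \<beta> i) * card U}"
    using finB by (intro card_mono) auto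
  ultimately show ?thesis by linarith
qed

definition scattered :: "nat set set" where
  "scattered = {U \<in> B. \<forall>X. card {x \<in> U. pt (lev l) x = X} < (1 - \<eta>) * card U}"

definition centre :: "nat set \<Rightarrow> nat list" where
  "centre U = (SOME X. (1 - \<eta>) * card U \<le> card {x \<in> U. pt (lev l) x = X})"

definition core :: "nat set \<Rightarrow> nat set" where
  "core U = {x \<in> U. pt (lev l) x = centre U}"

text \<open>The role shared by all pairs between the two cores; the types are read off the
  centres.\<close>

definition crole :: "nat set \<Rightarrow> nat set \<Rightarrow> nat" where
  "crole U U' = role t R (hd (drop (lev l) (centre U))) (hd (drop (lev l) (centre U')))"

lemma part_B: "partition_on V B"
  using B by (simp add: equitable_partition_def)

lemma finite_B: "finite B"
  using partition_onD1[OF part_B] finite_V by (metis finite_UnionD)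

lemma in_B: "U \<in> B \<Longrightarrow> U \<subseteq> V" "U \<in> B \<Longrightarrow> finite U" "U \<in> B \<Longrightarrow> U \<noteq> {}"
  using partition_onD1[OF part_B] partition_onD3[OF part_B] finite_V by (auto intro: finite_subset)

lemma card_core: "U \<in> B \<Longrightarrow> U \<notin> scattered \<Longrightarrow> (1 - \<eta>) * card U \<le> card (core U)"
proof -
  assume "U \<in> B" "U \<notin> scattered"
  then have "\<exists>X. (1 - \<eta>) * card U \<le> card {x \<in> U. pt (lev l) x = X}"
    by (auto simp: scattered_def not_less)
  then show ?thesis unfolding core_def centre_def by (rule someI_ex)
qed

lemma pt_core: "x \<in> core U \<Longrightarrow> i \<le> lev l \<Longrightarrow> pt i x = drop (lev l - i) (centre U)"
  using drop_pt[of i "lev l" x] lev_l by (simp add: core_def)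

lemma rl_core: "x \<in> core U \<Longrightarrow> y \<in> core U' \<Longrightarrow> rl x y = crole U U'"
  using pt_core[of x U 0] pt_core[of y U' 0] by (simp add: rl_def crole_def)

lemma core_sub: "core U \<subseteq> U"
  by (auto simp: core_def)

text \<open>Apart from role 0 and the levels beyond \<open>l\<close>, everything is decided between
  two cores: complete and empty roles by the types, the initial stage by the labels of stage 1, and
  the energy pairs of levels up to \<open>l\<close> by regularity.\<close>

lemma pure_cell:
  assumes U: "U \<in> B" "U \<notin> scattered" and U': "U' \<in> B" "U' \<notin> scattered"
    and reg: "regular_pair G \<gamma> \<gamma> U U'"
    and rho: "crole U U' \<noteq> 0" "\<not> (2 * l + 2 \<le> crole U U' \<and> crole U U' < 2 * t)"
  shows "card (parcs G \<inter> U \<times> U') \<le> 4 * \<eta> * (card U * card U') \<or> card (U \<times> U' - parcs G) \<le> 4 * \<eta> * (card U * card U')"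
proof -
  note fin = in_B(2)[OF U(1)] in_B(2)[OF U'(1)]
  note big = card_core[OF U] card_core[OF U']
  have VU: "x \<in> V" if "x \<in> core U" for x using that core_sub in_B(1)[OF U(1)] by auto
  have VU': "x \<in> V" if "x \<in> core U'" for x using that core_sub in_B(1)[OF U'(1)] by auto
  have weaken: "card (parcs G \<inter> U \<times> U') \<le> 4 * \<eta> * (card U * card U') \<or> card (U \<times> U' - parcs G) \<le> 4 * \<eta> * (card U * card U')"
    if "card (parcs G \<inter> U \<times> U') \<le> c * (card U * card U') \<or> card (U \<times> U' - parcs G) \<le> c * (card U * card U')" "c \<le> 4 * \<eta>" for c :: real
  proof -
    have "c * (card U * card U') \<le> 4 * \<eta> * (card U * card U')" using that(2) by (intro mult_right_mono) auto
    then show ?thesis using that(1) by linarith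
  qed
  have const: ?thesis if v: "\<And>x y. x \<in> core U \<Longrightarrow> y \<in> core U' \<Longrightarrow> (x, y) \<in> parcs G \<longleftrightarrow> v" for v
    by (rule weaken[OF nearly_constant_cell[OF fin core_sub core_sub big v]]) (use \<eta> in simp_all)
  consider "crole U U' = 2 * t" | "crole U U' = 1 \<or> 2 * t < crole U U' \<and> crole U U' < 7 * t" |
    "7 * t \<le> crole U U'" | "2 \<le> crole U U'" "crole U U' < 2 * l + 2" "crole U U' < 2 * t"
    using rho l by linarith
  then show ?thesis
  proof cases
    case 1
    show ?thesis
      by (rule const[of True]) (use 1 VU VU' in \<open>simp add: parcs_G adj_complete rl_core\<close>)
  next
    case 2
    show ?thesis
      by (rule const[of False]) (use 2 not_adj_void rl_core in \<open>auto simp: parcs_G\<close>)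
  next
    \<comment> \<open>The codeword used at stage 0 is selected by the label of stage 1, which the
      centre determines because \<open>lev l\<close> is at least 1.\<close>
    case 3
    define X0 X1 Y0 Y1 where "X0 = drop (lev l) (centre U)" and "X1 = drop (lev l - 1) (centre U)"
      and "Y0 = drop (lev l) (centre U')" and "Y1 = drop (lev l - 1) (centre U')"
    show ?thesis
    proof (rule const[of "(Y0 \<in> code 0 X0 (hd X1)) = (X0 \<in> code 0 Y0 (hd Y1))"])
      fix x y assume xy: "x \<in> core U" "y \<in> core U'"
      have "touched 0 (pt 0 x) (pt 0 y)" using 3 rl_core[OF xy] by (simp add: rl_def)
      moreover have "pt 0 x = X0" "pt (Suc 0) x = X1" "pt 0 y = Y0" "pt (Suc 0) y = Y1"
        using pt_core[OF xy(1)] pt_core[OF xy(2)] lev_l by (simp_all add: X0_def X1_def Y0_def Y1_def)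
      ultimately show "(x, y) \<in> parcs G \<longleftrightarrow> ((Y0 \<in> code 0 X0 (hd X1)) = (X0 \<in> code 0 Y0 (hd Y1)))"
        using adj_touched[of 0 x y] lev_l VU[OF xy(1)] VU'[OF xy(2)] by (simp add: parcs_G bit_def)
    qed
  next
    case 4
    define k where "k = crole U U' div 2"
    have k: "1 \<le> k" "k \<le> l" using 4(1,2) unfolding k_def by linarith+
    have levk: "lev k \<le> lev l" using lev_mono[OF k] l by simp
    define X Y where "X = drop (lev l - lev k) (centre U)" and "Y = drop (lev l - lev k) (centre U')"
    have edge: "(x, y) \<in> parcs G \<longleftrightarrow> (Y \<in> key x) = (X \<in> key y)" if xy: "x \<in> core U" "y \<in> core U'" for x y
    proof -
      have r: "2 \<le> rl x y" "rl x y < 2 * t" "rl x y div 2 = k"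
        unfolding rl_core[OF xy] k_def using 4 by simp_all
      have "pt (lev k) x = X" "pt (lev k) y = Y"
        unfolding X_def Y_def by (rule pt_core[OF xy(1) levk], rule pt_core[OF xy(2) levk])
      then have "adj x y \<longleftrightarrow> (Y \<in> key x) = (X \<in> key y)"
        using adj_energy[OF r(1,2)] unfolding r(3) by (simp only:)
      then show ?thesis unfolding parcs_G using VU[OF xy(1)] VU'[OF xy(2)] by blast
    qed
    show ?thesis
    proof (rule weaken)
      show "card (parcs G \<inter> U \<times> U') \<le> 2 * (\<eta> + \<gamma>) * (card U * card U') \<or> card (U \<times> U' - parcs G) \<le> 2 * (\<eta> + \<gamma>) * (card U * card U')"
      proof (rule regular_sign_pattern_cell[where C = "core U" and C' = "core U'" and a = "\<lambda>x. Y \<in> key x" and b = "\<lambda>y. X \<in> key y"])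
        show "finite U" "finite U'" "U \<noteq> {}" "U' \<noteq> {}" using fin in_B(3)[OF U(1)] in_B(3)[OF U'(1)] by auto
        show "core U \<subseteq> U" "core U' \<subseteq> U'" by (rule core_sub)+
        show "(1 - \<eta>) * card U \<le> card (core U)" "(1 - \<eta>) * card U' \<le> card (core U')" by (rule big)+
        show "regular_pair G \<gamma> \<gamma> U U'" by (rule reg)
        show "0 < \<gamma>" "\<gamma> \<le> 1 / 8" "\<eta> \<le> 1 / 4" using \<gamma> \<gamma>_le \<eta> by linarith+
        show "((x, y) \<in> parcs G) = ((Y \<in> key x) = (X \<in> key y))" if "x \<in> core U" "y \<in> core U'" for x y
          using edge[OF that] .
      qed
      show "2 * (\<eta> + \<gamma>) \<le> 4 * \<eta>" using \<gamma>_le by simp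
    qed
  qed
qed

text \<open>Both energies are compared with \<open>card (parcs G)\<close>. \<open>A\<close> loses a
  quarter of the roles from \<open>2 * l\<close> to \<open>2 * t - 1\<close>; \<open>B\<close> loses
  at most a quarter of those from \<open>2 * l + 2\<close> on and of role 0. What remains is a
  quarter of one role. The error 8 \<eta> consists of 3/2 from \<open>A\<close>, 4 from impurity and
  10/4 from the other bad cells.\<close>

lemma energy_gap:
  assumes A: "partition_on V A" and small: "(real (card A))\<^sup>2 * t \<le> \<eta> * sqrt (card (parts M (lev l)))"
  shows "mean_square_density G A + (1 / (64 * t) - 8 * \<eta>) \<le> mean_square_density G B"
proof -
  define n b where "n = real (card V)" and "b = real (card B)"
  have n: "0 < n" using finite_V V_nonempty by (simp add: n_def card_gt_0_iff)
  have t: "0 < real t" using t_pos by simp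
  define E where "E = real (card (parcs G))"
  have GV: "parcs G \<subseteq> V \<times> V" by (auto simp: G_def)
  define T where "T = {(x, y). x \<in> V \<and> y \<in> V \<and> 2 * l \<le> rl x y \<and> rl x y < 2 * t}"
  define T0 where "T0 = {(x, y). x \<in> V \<and> y \<in> V \<and> 0 \<le> rl x y \<and> rl x y < 1}"
  define T1 where "T1 = {(x, y). x \<in> V \<and> y \<in> V \<and> 2 * l + 2 \<le> rl x y \<and> rl x y < 2 * t}"
  have cT: "real (card T) = (2 * real t - 2 * real l) / (16 * real t) * n\<^sup>2"
    unfolding T_def n_def using l by (subst card_rl_range) auto
  have cT0: "real (card T0) = 1 / (16 * real t) * n\<^sup>2"
    unfolding T0_def n_def using l by (subst card_rl_range) auto
  have cT1: "real (card T1) = (2 * real t - 2 * real l - 2) / (16 * real t) * n\<^sup>2"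
    unfolding T1_def n_def using l by (subst card_rl_range) auto
  define \<Delta> where "\<Delta> = t * (n\<^sup>2 / sqrt (card (parts M (lev l)))) / 2"
  have "mean_square_density G A * (real (card (pverts G)))\<^sup>2 \<le> card (parcs G) - card T / 4 + 3 * (real (card A))\<^sup>2 * \<Delta>"
  proof (rule mean_square_density_le_of_balanced)
    show "finite (pverts G)" "pverts G \<noteq> {}" "parcs G \<subseteq> pverts G \<times> pverts G" "T \<subseteq> pverts G \<times> pverts G"
      "partition_on (pverts G) A"
      using finite_V V_nonempty GV A by (auto simp: T_def)
    fix U U' assume "U \<in> A" "U' \<in> A"
    then have "U \<subseteq> V" "U' \<subseteq> V" using partition_onD1[OF A] by auto
    then show "\<bar>real (card (parcs G \<inter> T \<inter> U \<times> U')) - real (card (T \<inter> U \<times> U')) / 2\<bar> \<le> \<Delta>"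
      unfolding T_def \<Delta>_def n_def by (rule energy_imbalance[OF l])
  qed
  then have A1: "mean_square_density G A * n\<^sup>2 \<le> E - card T / 4 + 3 * (real (card A))\<^sup>2 * \<Delta>"
    unfolding n_def E_def pverts_G .
  have A2: "3 * (real (card A))\<^sup>2 * \<Delta> \<le> 3 / 2 * \<eta> * n\<^sup>2"
  proof -
    define q where "q = sqrt (card (parts M (lev l)))"
    have q: "0 < q" using card_parts_pos by (simp add: q_def)
    have "3 * (real (card A))\<^sup>2 * \<Delta> = 3 / 2 * ((real (card A))\<^sup>2 * t) * (n\<^sup>2 / q)" by (simp add: \<Delta>_def q_def)
    also have "\<dots> \<le> 3 / 2 * (\<eta> * q) * (n\<^sup>2 / q)" using small q by (intro mult_right_mono mult_left_mono) (auto simp: q_def)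
    also have "\<dots> = 3 / 2 * \<eta> * n\<^sup>2" using q by simp
    finally show ?thesis .
  qed
  define nom where "nom U U' \<longleftrightarrow> crole U U' = 0 \<or> 2 * l + 2 \<le> crole U U' \<and> crole U U' < 2 * t" for U U'
  define Bad where "Bad = {(U, U'). U \<in> scattered \<or> U' \<in> scattered \<or> \<not> regular_pair G \<gamma> \<gamma> U U' \<or> nom U U'}"
  define mass where "mass = (\<Sum>U\<in>B. \<Sum>U'\<in>B. of_bool ((U, U') \<in> Bad) * (real (card U) * real (card U')))"
  have "card (parcs G) - 4 * \<eta> * (real (card (pverts G)))\<^sup>2 - mass / 4 \<le> mean_square_density G B * (real (card (pverts G)))\<^sup>2"
    unfolding mass_def
  proof (rule mean_square_density_ge_of_pure)
    show "finite (pverts G)" "pverts G \<noteq> {}" "parcs G \<subseteq> pverts G \<times> pverts G" "partition_on (pverts G) B" "0 \<le> 4 * \<eta>"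
      using finite_V V_nonempty GV part_B \<eta> by auto
    fix U U' assume "U \<in> B" "U' \<in> B" "(U, U') \<notin> Bad"
    then show "card (parcs G \<inter> U \<times> U') \<le> 4 * \<eta> * (card U * card U') \<or> card (U \<times> U' - parcs G) \<le> 4 * \<eta> * (card U * card U')"
      using pure_cell[of U U'] by (auto simp: Bad_def nom_def)
  qed
  then have B1: "E - 4 * \<eta> * n\<^sup>2 - mass / 4 \<le> mean_square_density G B * n\<^sup>2"
    unfolding n_def E_def pverts_G .
  have sumV: "(\<Sum>U\<in>B. real (card U)) = n"
    using product_partition[OF part_B] in_B by (simp add: n_def)
  have Ub: "real (card U) * b \<le> 2 * n" if "U \<in> B" for U
    using equitable_partition_card_le(1)[OF B finite_V that] by (simp add: n_def b_def)
  have bpos: "0 < b"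
  proof -
    have "B \<noteq> {}" using partition_onD1[OF part_B] V_nonempty by auto
    then show ?thesis using finite_B by (simp add: b_def card_gt_0_iff)
  qed
  have Ub': "real (card U) \<le> 2 * n / b" if "U \<in> B" for U
    using Ub[OF that] bpos by (simp add: pos_le_divide_eq)
  have scat: "(\<Sum>U\<in>B. of_bool (U \<in> scattered) * real (card U)) \<le> 2 * \<eta> * n"
  proof -
    have "(\<Sum>U\<in>B. of_bool (U \<in> scattered) * real (card U)) = (\<Sum>U\<in>scattered. real (card U))"
      using finite_B by (intro sum.mono_neutral_cong_right) (auto simp: scattered_def)
    also have "\<dots> \<le> (\<Sum>U\<in>scattered. 2 * n / b)" using Ub' by (intro sum_mono) (auto simp: scattered_def)
    also have "\<dots> = real (card scattered) * (2 * n / b)" by simp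
    also have "\<dots> \<le> (\<eta> * b) * (2 * n / b)"
      using few_scattered_parts n bpos unfolding scattered_def[symmetric] b_def[symmetric] by (intro mult_right_mono) auto
    also have "\<dots> = 2 * \<eta> * n" using bpos by simp
    finally show ?thesis .
  qed
  define I where "I = {(U, U') \<in> B \<times> B. \<not> regular_pair G \<gamma> \<gamma> U U'}"
  have irr: "(\<Sum>U\<in>B. \<Sum>U'\<in>B. of_bool ((U, U') \<in> I) * (real (card U) * real (card U'))) \<le> 4 * \<gamma> * n\<^sup>2"
  proof -
    have "(\<Sum>U\<in>B. \<Sum>U'\<in>B. of_bool ((U, U') \<in> I) * (real (card U) * real (card U'))) \<le>
      (\<Sum>U\<in>B. \<Sum>U'\<in>B. of_bool ((U, U') \<in> I) * (2 * n / b * (2 * n / b)))"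
      using Ub' n bpos by (intro sum_mono mult_left_mono mult_mono) auto
    also have "\<dots> = (\<Sum>U\<in>B. \<Sum>U'\<in>B. of_bool ((U, U') \<in> I)) * (2 * n / b * (2 * n / b))"
      by (simp only: sum_distrib_right)
    also have "(\<Sum>U\<in>B. \<Sum>U'\<in>B. of_bool ((U, U') \<in> I)) = real (card I)"
    proof -
      have "I = (SIGMA U:B. {U' \<in> B. (U, U') \<in> I})" by (auto simp: I_def)
      then have "card I = card (SIGMA U:B. {U' \<in> B. (U, U') \<in> I})" by (rule arg_cong)
      then show ?thesis using finite_B by (simp add: Int_def)
    qed
    also have "real (card I) * (2 * n / b * (2 * n / b)) \<le> (\<gamma> * b\<^sup>2) * (2 * n / b * (2 * n / b))"
      using regular n bpos unfolding I_def b_def by (intro mult_right_mono) auto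
    also have "\<dots> = 4 * \<gamma> * n\<^sup>2" using bpos by (simp add: power2_eq_square field_simps)
    finally show ?thesis .
  qed
  \<comment> \<open>Unresolved cells are charged to actual pairs of \<open>T0\<close> and
    \<open>T1\<close>, whose numbers are known exactly; only pairs outside the two cores, a share of
    at most 2 \<eta>, are lost in this.\<close>
  have nomb: "of_bool (U \<notin> scattered \<and> U' \<notin> scattered \<and> nom U U') * (real (card U) * real (card U')) \<le>
      real (card (T0 \<inter> U \<times> U')) + real (card (T1 \<inter> U \<times> U')) + 2 * \<eta> * (real (card U) * real (card U'))"
    if U: "U \<in> B" "U' \<in> B" for U U'
  proof (cases "U \<notin> scattered \<and> U' \<notin> scattered \<and> nom U U'")
    case False
    then have z: "(of_bool (U \<notin> scattered \<and> U' \<notin> scattered \<and> nom U U') :: real) = 0" by simp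
    show ?thesis unfolding z using \<eta> by simp
  next
    case True
    have fin: "finite U" "finite U'" using in_B U by auto
    have sub: "core U \<times> core U' \<subseteq> (T0 \<inter> U \<times> U') \<union> (T1 \<inter> U \<times> U')"
    proof
      fix p assume "p \<in> core U \<times> core U'"
      then obtain x y where p: "p = (x, y)" "x \<in> core U" "y \<in> core U'" by auto
      then have "x \<in> U" "y \<in> U'" "x \<in> V" "y \<in> V" using core_sub in_B(1)[OF U(1)] in_B(1)[OF U(2)] by auto
      then show "p \<in> (T0 \<inter> U \<times> U') \<union> (T1 \<inter> U \<times> U')"
        using True rl_core[OF p(2,3)] by (auto simp: p nom_def T0_def T1_def)
    qed
    have "card (core U \<times> core U') \<le> card ((T0 \<inter> U \<times> U') \<union> (T1 \<inter> U \<times> U'))"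
      using sub fin by (intro card_mono) auto
    also have "\<dots> \<le> card (T0 \<inter> U \<times> U') + card (T1 \<inter> U \<times> U')" by (rule card_Un_le)
    finally have 1: "real (card (core U)) * real (card (core U')) \<le> real (card (T0 \<inter> U \<times> U')) + real (card (T1 \<inter> U \<times> U'))"
      by (simp add: card_cartesian_product flip: of_nat_mult of_nat_add)
    have "((1 - \<eta>) * card U) * ((1 - \<eta>) * card U') \<le> real (card (core U)) * real (card (core U'))"
      using card_core U True \<eta> by (intro mult_mono) auto
    moreover have "(1 - 2 * \<eta>) * (real (card U) * real (card U')) \<le> ((1 - \<eta>) * card U) * ((1 - \<eta>) * card U')"
    proof -
      have "((1 - \<eta>) * card U) * ((1 - \<eta>) * card U') - (1 - 2 * \<eta>) * (real (card U) * real (card U')) = \<eta>\<^sup>2 * (real (card U) * real (card U'))"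
        by (simp add: power2_eq_square algebra_simps)
      moreover have "0 \<le> \<eta>\<^sup>2 * (real (card U) * real (card U'))" by simp
      ultimately show ?thesis by linarith
    qed
    ultimately have "(1 - 2 * \<eta>) * (real (card U) * real (card U')) \<le> real (card (T0 \<inter> U \<times> U')) + real (card (T1 \<inter> U \<times> U'))"
      using 1 by linarith
    then show ?thesis using True by (simp add: algebra_simps)
  qed
  \<comment> \<open>Four sources: scattered first part and scattered second part give 2 \<eta> each,
    irregular pairs 4 \<gamma>, hence at most 4 \<eta>, and unresolved cells 2 \<eta> beyond the two
    exact counts.\<close>
  have "mass \<le> (\<Sum>U\<in>B. \<Sum>U'\<in>B. of_bool (U \<in> scattered) * real (card U) * real (card U') +
      of_bool (U' \<in> scattered) * real (card U') * real (card U) +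
      of_bool ((U, U') \<in> I) * (real (card U) * real (card U')) +
      of_bool (U \<notin> scattered \<and> U' \<notin> scattered \<and> nom U U') * (real (card U) * real (card U')))"
    unfolding mass_def by (intro sum_mono) (auto simp: Bad_def I_def)
  also have "\<dots> \<le> (\<Sum>U\<in>B. \<Sum>U'\<in>B. of_bool (U \<in> scattered) * real (card U) * real (card U') +
      of_bool (U' \<in> scattered) * real (card U') * real (card U) +
      of_bool ((U, U') \<in> I) * (real (card U) * real (card U')) +
      (real (card (T0 \<inter> U \<times> U')) + real (card (T1 \<inter> U \<times> U')) + 2 * \<eta> * (real (card U) * real (card U'))))"
    using nomb by (intro sum_mono add_left_mono) auto
  also have "\<dots> = (\<Sum>U\<in>B. \<Sum>U'\<in>B. of_bool (U \<in> scattered) * real (card U) * real (card U')) +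
      (\<Sum>U\<in>B. \<Sum>U'\<in>B. of_bool (U' \<in> scattered) * real (card U') * real (card U)) +
      (\<Sum>U\<in>B. \<Sum>U'\<in>B. of_bool ((U, U') \<in> I) * (real (card U) * real (card U'))) +
      ((\<Sum>U\<in>B. \<Sum>U'\<in>B. real (card (T0 \<inter> U \<times> U'))) + (\<Sum>U\<in>B. \<Sum>U'\<in>B. real (card (T1 \<inter> U \<times> U'))) +
       (\<Sum>U\<in>B. \<Sum>U'\<in>B. 2 * \<eta> * (real (card U) * real (card U'))))"
    by (simp only: sum.distrib)
  also have "(\<Sum>U\<in>B. \<Sum>U'\<in>B. of_bool (U \<in> scattered) * real (card U) * real (card U')) = (\<Sum>U\<in>B. of_bool (U \<in> scattered) * real (card U)) * n"
    by (simp only: sum_product sumV[symmetric])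
  also have "(\<Sum>U\<in>B. \<Sum>U'\<in>B. of_bool (U' \<in> scattered) * real (card U') * real (card U)) = (\<Sum>U\<in>B. of_bool (U \<in> scattered) * real (card U)) * n"
    by (subst sum.swap) (simp only: sum_product sumV[symmetric])
  also have "(\<Sum>U\<in>B. \<Sum>U'\<in>B. real (card (T0 \<inter> U \<times> U'))) = card T0"
    by (rule card_eq_sum_cells[OF part_B finite_V, symmetric]) (auto simp: T0_def)
  also have "(\<Sum>U\<in>B. \<Sum>U'\<in>B. real (card (T1 \<inter> U \<times> U'))) = card T1"
    by (rule card_eq_sum_cells[OF part_B finite_V, symmetric]) (auto simp: T1_def)
  also have "(\<Sum>U\<in>B. \<Sum>U'\<in>B. 2 * \<eta> * (real (card U) * real (card U'))) = 2 * \<eta> * n\<^sup>2"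
    by (simp only: sum_distrib_left[symmetric] sum_distrib_right[symmetric] sumV power2_eq_square)
  finally have mass: "mass \<le> (2 * \<eta> * n) * n + (2 * \<eta> * n) * n + 4 * \<gamma> * n\<^sup>2 + (card T0 + real (card T1) + 2 * \<eta> * n\<^sup>2)"
    using mult_right_mono[OF scat, of n] n irr by linarith
  have "4 * \<gamma> * n\<^sup>2 \<le> 4 * \<eta> * n\<^sup>2" using \<gamma>_le by (intro mult_right_mono) auto
  then have mass': "mass \<le> 10 * \<eta> * n\<^sup>2 + card T0 + card T1" using mass by (simp add: power2_eq_square)
  define s where "s = n\<^sup>2 / (16 * real t)"
  have "real (card T) = (2 * real t - 2 * real l) * s" "real (card T0) = s"
    "real (card T1) = (2 * real t - 2 * real l - 2) * s"
    unfolding cT cT0 cT1 s_def by simp_all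
  then have TT: "real (card T) - card T0 - card T1 = s" by (simp add: algebra_simps)
  have "(mean_square_density G A + (1 / (64 * t) - 8 * \<eta>)) * n\<^sup>2 = mean_square_density G A * n\<^sup>2 + s / 4 - 8 * (\<eta> * n\<^sup>2)"
    by (simp add: s_def algebra_simps)
  also have "\<dots> \<le> mean_square_density G B * n\<^sup>2"
  proof -
    define e where "e = \<eta> * n\<^sup>2"
    have "3 * (real (card A))\<^sup>2 * \<Delta> \<le> 3 / 2 * e" "E - 4 * e - mass / 4 \<le> mean_square_density G B * n\<^sup>2"
      "mass \<le> 10 * e + card T0 + card T1"
      using A2 B1 mass' unfolding e_def by (simp_all only: mult.assoc)
    then show ?thesis using A1 TT unfolding e_def[symmetric] by linarith
  qed
  finally show ?thesis using n by (simp only: mult_le_cancel_right_pos zero_less_power)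
qed

end

section \<open>Choice of the parameters\<close>

context touching begin

text \<open>The touching density of a stage is therefore 1 / q.\<close>

lemma M_eq: "M (Suc i) = q (Suc i) * d (Suc i)"
proof -
  have "q (Suc i) ^ Q (Suc i) = q (Suc i) * q (Suc i) ^ (Q (Suc i) - 1)"
    using Q_pos[of i] by (cases "Q (Suc i)") auto
  then show ?thesis by (simp add: M_Suc d_def)
qed

text \<open>Every stage leaves the share 1 - 1 / q of the untouched pairs, and the product of these
  factors is at least one minus the sum of the 1 / q. Role 0 starts with a share 1 / (16 t), of
  which half survives.\<close>

lemma card_parts_le_untouched:
  assumes "(\<Sum>j<i. 1 / real (q (Suc j))) \<le> 1 / 2"
  shows "card (parts M i) \<le> 32 * t * untouched_degree i"
proof -
  have "(1 - (\<Sum>j<i. 1 / real (q (Suc j)))) * card (parts M i) \<le> 16 * t * real (untouched_degree i)"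
    if "(\<Sum>j<i. 1 / real (q (Suc j))) \<le> 1 / 2" for i
    using that
  proof (induction i)
    case 0
    show ?case by (simp only: card_parts_0 M_0) simp
  next
    case (Suc i)
    define x where "x = 1 / real (q (Suc i))"
    define s where "s = (\<Sum>j<i. 1 / real (q (Suc j)))"
    have q: "1 \<le> real (q (Suc i))" using q_pos[of i] by simp
    have x: "0 \<le> x" "x \<le> 1" using q by (auto simp: x_def)
    have s: "0 \<le> s" by (auto simp: s_def intro: sum_nonneg)
    have sx: "s + x \<le> 1 / 2" using Suc.prems by (simp add: s_def x_def)
    have IH: "(1 - s) * card (parts M i) \<le> 16 * t * real (untouched_degree i)"
      using Suc.IH sx x unfolding s_def by linarith
    have Md: "real (M (Suc i) - d (Suc i)) = (1 - x) * M (Suc i)"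
      using d_le_M[of i] q by (simp add: of_nat_diff M_eq x_def field_simps)
    have "(1 - (s + x)) * card (parts M (Suc i)) = (1 - (s + x)) * (M (Suc i) * real (card (parts M i)))"
      by (simp only: card_parts_Suc of_nat_mult)
    also have "\<dots> \<le> ((1 - s) * (1 - x)) * (M (Suc i) * real (card (parts M i)))"
      using s x by (intro mult_right_mono) (auto simp: algebra_simps)
    also have "\<dots> = ((1 - s) * real (card (parts M i))) * ((1 - x) * M (Suc i))" by (simp only: mult_ac)
    also have "\<dots> \<le> (16 * t * real (untouched_degree i)) * ((1 - x) * M (Suc i))"
      using IH x by (intro mult_right_mono) auto
    also have "\<dots> = 16 * t * real (untouched_degree (Suc i))" by (simp add: Md)
    finally show ?case by (simp add: s_def x_def)
  qed
  note this[OF assms]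
  moreover have "1 / 2 * real (card (parts M i)) \<le> (1 - (\<Sum>j<i. 1 / real (q (Suc j)))) * card (parts M i)"
    using assms by (intro mult_right_mono) auto
  ultimately have "real (card (parts M i)) \<le> real (32 * t * untouched_degree i)" by simp
  then show ?thesis by (simp only: of_nat_le_iff)
qed

lemma card_parts_le_degree:
  assumes "(\<Sum>j<i. 1 / real (q (Suc j))) \<le> 1 / 2"
  shows "card (parts M (Suc i)) \<le> 32 * t * q (Suc i) * degree (Suc i)"
proof -
  have "card (parts M (Suc i)) = q (Suc i) * d (Suc i) * card (parts M i)"
    by (simp only: card_parts_Suc M_eq)
  also have "\<dots> \<le> q (Suc i) * d (Suc i) * (32 * t * untouched_degree i)"
    using card_parts_le_untouched[OF assms] by (rule mult_le_mono2)
  also have "\<dots> = 32 * t * q (Suc i) * degree (Suc i)" by simp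
  finally show ?thesis .
qed

end

text \<open>A stage of degree \<open>D\<close> admits codes of size \<open>2 powr (D / 8)\<close>, hence \<open>Q\<close> about \<open>sqrt D\<close>; the bound \<open>N\<close> on \<open>q\<close>
  keeps a fraction of order \<open>1 / N\<close> of the pairs touching.\<close>

primrec degree_seq :: "nat \<Rightarrow> nat \<Rightarrow> (nat \<Rightarrow> nat) \<Rightarrow> nat \<Rightarrow> nat \<times> nat" where
  "degree_seq t R N 0 = (t * R, R)"
| "degree_seq t R N (Suc i) = (let D = fst (degree_seq t R N i); u = snd (degree_seq t R N i);
     Q = floor_sqrt D; q = min Q (N (Suc i)) in (u * (Q * q ^ (Q - 1)), u * (Q * q ^ Q - Q * q ^ (Q - 1))))"

text \<open>Room for the codes: with q at most Q and Q^2 at most the degree, it bounds the eighth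
  power of the number of labels by 2^D. It also lets the number of paths beat a fourth power of Q in
  the final estimate.\<close>

lemma power_bound:
  assumes "(1024::nat) \<le> Q"
  shows "Q ^ 16 \<le> 2 ^ Q"
proof -
  define k where "k = Q div 32"
  have Qk: "Q < 32 * (k + 1)" "32 * k \<le> Q" by (auto simp: k_def)
  have k: "32 \<le> k" using assms by (simp add: k_def)
  have "k + 1 \<le> 2 ^ k" by (induction k) auto
  then have k2: "(k + 1) ^ 32 \<le> (2 ^ k) ^ 32" by (rule power_mono) simp
  have "Q ^ 16 \<le> (32 * (k + 1)) ^ 16" using Qk by (intro power_mono) auto
  also have "\<dots> \<le> ((k + 1) * (k + 1)) ^ 16" using k by (intro power_mono mult_le_mono1) auto
  also have "\<dots> = (k + 1) ^ 32" by (simp only: power_mult_distrib power_add[symmetric]) simp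
  also note k2
  also have "(2 ^ k) ^ 32 = (2::nat) ^ (32 * k)" by (simp only: power_mult[symmetric] mult.commute)
  also have "\<dots> \<le> 2 ^ Q" using Qk by (intro power_increasing) auto
  finally show ?thesis .
qed

lemma tower_ge: "i + 1 \<le> tower i"
proof (induction i)
  case (Suc i)
  have "tower i < 2 ^ tower i" by simp
  then show ?case using Suc unfolding tower.simps by linarith
qed simp

lemma tower_ge_power: "2 ^ i \<le> tower i"
proof (cases i)
  case (Suc j)
  show ?thesis
    unfolding Suc tower.simps by (rule power_increasing) (use tower_ge[of j] in simp_all)
qed simp

lemma tower_mono: "i \<le> j \<Longrightarrow> tower i \<le> tower j"
  by (rule lift_Suc_mono_le[of tower]) (simp_all add: less_imp_le)

text \<open>A constant factor in front of the tower survives exponentiation: 2^(b T) exceeds 2^T by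
  at least 2^(b - 1), which is at least 2 b.\<close>

lemma tower_growth_step:
  assumes "b * 2 * T \<le> Q" "(5::nat) \<le> b" "1 \<le> T" "2 ^ (Q div 2) \<le> Q'"
  shows "b * 2 * 2 ^ T \<le> Q'"
proof -
  have "b * 2 \<le> 2 ^ (b - 1)"
  proof -
    have "(n + 5) * 2 \<le> 2 ^ (n + 4)" for n :: nat
    proof (induction n)
      case (Suc n)
      have e: "(2::nat) ^ (Suc n + 4) = 2 * 2 ^ (n + 4)" by (simp only: add_Suc power_Suc)
      have "(Suc n + 5) * 2 \<le> 2 * x" if "(n + 5) * 2 \<le> x" for x :: nat
        using that unfolding add_mult_distrib by (simp add: algebra_simps)
      from this[OF Suc.IH] show ?case unfolding e .
    qed simp
    from this[of "b - 5"] show ?thesis using assms(2) by simp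
  qed
  then have "b * 2 * 2 ^ T \<le> 2 ^ (b - 1) * 2 ^ T" by simp
  also have "\<dots> = 2 ^ (b - 1 + T)" by (simp add: power_add)
  also have "\<dots> \<le> 2 ^ (b * T)"
  proof (rule power_increasing)
    obtain c e where "b = Suc c" "T = Suc e" using assms by (cases b; cases T) auto
    then show "b - 1 + T \<le> b * T" by simp
  qed simp
  also have "\<dots> \<le> 2 ^ (Q div 2)" using assms(1) by (intro power_increasing) auto
  finally show ?thesis using assms(4) by linarith
qed

text \<open>The cap \<open>N\<close> on \<open>q\<close> is a lower bound on the touching density of
  a stage, chosen later to meet the demands of all levels. The growth of \<open>Q\<close> is uniform
  in \<open>N\<close>, since q at least 2 is all it relies on.\<close>

lemma tower_graph_exists:
  fixes t :: nat and N :: "nat \<Rightarrow> nat" and lev :: "nat \<Rightarrow> nat"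
  assumes t: "1 \<le> t" and N: "\<And>i. 2 \<le> N i"
    and lev: "\<And>l. 1 \<le> l \<Longrightarrow> l < t \<Longrightarrow> 1 \<le> lev l \<and> lev l \<le> S"
      "\<And>l l'. 1 \<le> l \<Longrightarrow> l \<le> l' \<Longrightarrow> l' < t \<Longrightarrow> lev l \<le> lev l'"
  shows "\<exists>Q q M touch code V path key. tower_graph t (2 ^ 60 * t) Q q M touch code S lev V path key \<and>
    (\<forall>i. 2 ^ 30 * t * tower i \<le> Q (Suc i)) \<and> (\<forall>i. q (Suc i) = min (Q (Suc i)) (N (Suc i)))"
proof -
  define R where "R = 2 ^ 60 * t"
  define D u where "D i = fst (degree_seq t R N i)" and "u i = snd (degree_seq t R N i)" for i
  define Q where "Q i = (case i of 0 \<Rightarrow> 1 | Suc j \<Rightarrow> floor_sqrt (D j))" for i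
  define q where "q i = min (Q i) (N i)" for i
  define M where "M i = (case i of 0 \<Rightarrow> 16 * t * R | Suc j \<Rightarrow> Q i * q i ^ Q i)" for i
  have QS: "Q (Suc i) = floor_sqrt (D i)" for i by (simp add: Q_def)
  have MS: "M (Suc i) = Q (Suc i) * q (Suc i) ^ Q (Suc i)" for i by (simp add: M_def)
  have DS: "D (Suc i) = u i * (Q (Suc i) * q (Suc i) ^ (Q (Suc i) - 1))" for i
    by (simp add: D_def u_def QS q_def Let_def)
  have uS: "u (Suc i) = u i * (M (Suc i) - Q (Suc i) * q (Suc i) ^ (Q (Suc i) - 1))" for i
    by (simp add: D_def u_def QS q_def Let_def MS)
  have D0: "D 0 = (2 ^ 30 * t)\<^sup>2" by (simp add: D_def R_def power2_eq_square)
  have u0: "u 0 = R" by (simp add: u_def)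
  define a where "a = 2 ^ 30 * t"
  have a: "1024 \<le> a" using t by (simp add: a_def)
  \<comment> \<open>The degree is at least q^Q, hence at least 2^Q, and taking the square root for
    the next stage halves the exponent.\<close>
  have Q2: "2 ^ (Q (Suc i) div 2) \<le> Q (Suc (Suc i))" if Q: "2 \<le> Q (Suc i)" and u: "Q (Suc i) \<le> u i" for i
  proof -
    have q2: "2 \<le> q (Suc i)" "q (Suc i) \<le> Q (Suc i)" using Q N[of "Suc i"] by (auto simp: q_def)
    have "2 ^ Q (Suc i) \<le> q (Suc i) ^ Q (Suc i)" using q2 by (intro power_mono) auto
    also have "\<dots> = q (Suc i) * q (Suc i) ^ (Q (Suc i) - 1)" using Q by (cases "Q (Suc i)") auto
    also have "\<dots> \<le> u i * (Q (Suc i) * q (Suc i) ^ (Q (Suc i) - 1))"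
      using q2 u Q by (intro mult_le_mono) auto
    finally have "2 ^ Q (Suc i) \<le> D (Suc i)" by (simp add: DS)
    moreover have "(2 ^ (Q (Suc i) div 2))\<^sup>2 \<le> (2::nat) ^ Q (Suc i)"
      unfolding power_mult[symmetric] by (intro power_increasing) auto
    ultimately have "(2 ^ (Q (Suc i) div 2))\<^sup>2 \<le> D (Suc i)" by linarith
    then show ?thesis unfolding QS[of "Suc i"] by (simp only: le_floor_sqrt_iff)
  qed
  have grow: "a * tower i \<le> Q (Suc i) \<and> Q (Suc i) \<le> u i" for i
  proof (induction i)
    case 0
    \<comment> \<open>\<open>R = 2 ^ 60 * t\<close> makes the initial degree t R the exact square of
      \<open>2 ^ 30 * t\<close>.\<close>
    have "Q (Suc 0) = a" unfolding QS D0 a_def by (rule floor_sqrt_inverse_power2)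
    moreover have "a \<le> R" using t by (simp add: a_def R_def)
    ultimately show ?case by (simp add: u0)
  next
    case (Suc i)
    have T: "1 \<le> tower i" using tower_ge[of i] by simp
    have "a * 1 \<le> a * tower i" using T by (intro mult_le_mono2)
    then have big: "1024 \<le> Q (Suc i)" using Suc a by linarith
    have "a * tower (Suc i) \<le> Q (Suc (Suc i))"
    proof -
      have "(2 ^ 29 * t) * 2 * 2 ^ tower i \<le> Q (Suc (Suc i))"
      proof (rule tower_growth_step[OF _ _ T])
        show "2 ^ 29 * t * 2 * tower i \<le> Q (Suc i)" using Suc by (simp add: a_def)
        show "5 \<le> 2 ^ 29 * t" using t by simp
        show "2 ^ (Q (Suc i) div 2) \<le> Q (Suc (Suc i))" using big Suc by (intro Q2) auto
      qed
      then show ?thesis by (simp add: a_def)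
    qed
    moreover have "Q (Suc (Suc i)) \<le> u (Suc i)"
    proof -
      \<comment> \<open>As q is at least 2, at most half of the label pairs touch. So the untouched
        degree dominates the new degree, and with it the next \<open>Q\<close>.\<close>
      define e where "e = Q (Suc i) * q (Suc i) ^ (Q (Suc i) - 1)"
      have "2 \<le> q (Suc i)" using big N[of "Suc i"] by (auto simp: q_def)
      then have "2 * e \<le> q (Suc i) * e" by (rule mult_le_mono1)
      moreover have "M (Suc i) = q (Suc i) * e" using big by (cases "Q (Suc i)") (simp_all only: MS e_def diff_Suc_1 power_Suc mult_ac)
      ultimately have "e \<le> M (Suc i) - e" by linarith
      then have "D (Suc i) \<le> u (Suc i)" unfolding DS uS e_def[symmetric] by (rule mult_le_mono2)
      moreover have "Q (Suc (Suc i)) \<le> D (Suc i)" unfolding QS[of "Suc i"] by (rule floor_sqrt_le)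
      ultimately show ?thesis by linarith
    qed
    ultimately show ?case ..
  qed
  have Qbig: "1024 \<le> Q (Suc i)" for i
  proof -
    have "a * 1 \<le> a * tower i" using tower_ge[of i] by (intro mult_le_mono2) simp
    then show ?thesis using grow[of i] a by linarith
  qed
  have q2: "2 \<le> q (Suc i)" for i using Qbig[of i] N[of "Suc i"] by (auto simp: q_def)
  define good where "good i r \<longleftrightarrow> (\<forall>c c'. r c c' = r c' c) \<and>
     (\<forall>c<M (Suc i). card {c'. c' < M (Suc i) \<and> r c c'} = Q (Suc i) * q (Suc i) ^ (Q (Suc i) - 1)) \<and>
     (\<forall>w :: nat \<Rightarrow> real. (\<forall>c<M (Suc i). 0 \<le> w c \<and> w c \<le> 1) \<longrightarrow> 56 * sum w {..<M (Suc i)} \<le> M (Suc i) \<longrightarrow>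
      Q (Suc i) * card {c. c < M (Suc i) \<and> Q (Suc i) * q (Suc i) ^ (Q (Suc i) - 1) < 14 * sum w {c'. c' < M (Suc i) \<and> r c c'}} \<le> 400 * M (Suc i))"
    for i and r :: "nat \<Rightarrow> nat \<Rightarrow> bool"
  define r where "r i = (SOME r. good i r)" for i
  have good: "good i (r i)" for i
  proof -
    have "\<exists>r. good i r"
      unfolding good_def MS using Qbig[of i] q2[of i] by (intro touching_relation_exists) auto
    then show ?thesis unfolding r_def by (rule someI_ex)
  qed
  define touch where "touch i = (case i of 0 \<Rightarrow> (\<lambda>_ _. False) | Suc j \<Rightarrow> r j)" for i
  interpret touching t R Q q M touch
  proof
    show "0 < t" "0 < R" using t by (auto simp: R_def)
    show "M 0 = 16 * t * R" by (simp add: M_def)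
    show "1 \<le> Q (Suc i)" "1 \<le> q (Suc i)" for i using Qbig[of i] q2[of i] by linarith+
    show "M (Suc i) = Q (Suc i) * q (Suc i) ^ Q (Suc i)" for i by (rule MS)
    show "touch i c c' = touch i c' c" for i c c' using good unfolding good_def touch_def by (cases i) auto
    show "card {c'. c' < M (Suc i) \<and> touch (Suc i) c c'} = Q (Suc i) * q (Suc i) ^ (Q (Suc i) - 1)"
      if "c < M (Suc i)" for i c
    proof -
      have "\<forall>c<M (Suc i). card {c'. c' < M (Suc i) \<and> r i c c'} = Q (Suc i) * q (Suc i) ^ (Q (Suc i) - 1)"
        using good[of i] unfolding good_def by (elim conjE)
      then show ?thesis using that unfolding touch_def by auto
    qed
    show "Q (Suc i) * card {c. c < M (Suc i) \<and> Q (Suc i) * q (Suc i) ^ (Q (Suc i) - 1) <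
        14 * sum w {c'. c' < M (Suc i) \<and> touch (Suc i) c c'}} \<le> 400 * M (Suc i)"
      if "\<And>c. c < M (Suc i) \<Longrightarrow> 0 \<le> w c \<and> w c \<le> 1" "56 * sum w {..<M (Suc i)} \<le> M (Suc i)" for i and w :: "nat \<Rightarrow> real"
    proof -
      have "\<forall>w :: nat \<Rightarrow> real. (\<forall>c<M (Suc i). 0 \<le> w c \<and> w c \<le> 1) \<longrightarrow> 56 * sum w {..<M (Suc i)} \<le> M (Suc i) \<longrightarrow>
          Q (Suc i) * card {c. c < M (Suc i) \<and> Q (Suc i) * q (Suc i) ^ (Q (Suc i) - 1) <
            14 * sum w {c'. c' < M (Suc i) \<and> r i c c'}} \<le> 400 * M (Suc i)"
        using good[of i] unfolding good_def by (elim conjE)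
      from this[rule_format, of w] show ?thesis using that unfolding touch_def by simp
    qed
  qed
  have deg: "degree i = D i \<and> untouched_degree i = u i" for i
  proof (induction i)
    case 0
    show ?case by (simp add: D_def u_def)
  next
    case (Suc i)
    then show ?case by (simp add: DS uS d_def)
  qed
  \<comment> \<open>Eighth powers keep the comparison in the naturals: M is at most Q^(Q + 1), 8 (Q
    + 1) is at most 16 Q, and Q^2 is at most D.\<close>
  have cap: "real (M (Suc i)) \<le> 2 powr (D i / 8)" for i
  proof -
    define x where "x = Q (Suc i)"
    have x: "1024 \<le> x" using Qbig by (simp add: x_def)
    have "M (Suc i) \<le> x * x ^ x"
      unfolding MS x_def by (intro mult_le_mono2 power_mono) (auto simp: q_def)
    then have "M (Suc i) ^ 8 \<le> (x ^ Suc x) ^ 8" by (intro power_mono) auto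
    also have "\<dots> = x ^ (8 * Suc x)" by (simp only: power_mult[symmetric] mult.commute)
    also have "\<dots> \<le> x ^ (16 * x)" using x by (intro power_increasing) auto
    also have "\<dots> = (x ^ 16) ^ x" by (simp only: power_mult)
    also have "\<dots> \<le> (2 ^ x) ^ x" using power_bound[OF x] by (intro power_mono) auto
    also have "\<dots> = 2 ^ x\<^sup>2" by (simp only: power_mult[symmetric] power2_eq_square)
    also have "\<dots> \<le> 2 ^ D i" unfolding x_def QS by (intro power_increasing) auto
    finally have "real (M (Suc i) ^ 8) \<le> real (2 ^ D i)" by (simp only: of_nat_le_iff)
    then have "real (M (Suc i)) ^ 8 \<le> 2 ^ D i" by simp
    also have "(2::real) ^ D i = (2 powr (D i / 8)) ^ 8"
      by (simp add: powr_powr flip: powr_realpow)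
    finally show ?thesis by (rule power_le_imp_le_base[of _ 7, simplified]) simp
  qed
  define isc where "isc i X C \<longleftrightarrow> (\<forall>c<M (Suc i). C c \<subseteq> nbhd i X) \<and>
    (\<forall>c<M (Suc i). \<forall>c'<M (Suc i). c \<noteq> c' \<longrightarrow> card (nbhd i X) \<le> 4 * card (sym_diff (C c) (C c')))"
    for i X and C :: "nat \<Rightarrow> nat list set"
  define code where "code i X = (SOME C. isc i X C)" for i X
  have code: "isc i X (code i X)" if "X \<in> parts M i" for i X
  proof -
    have "\<exists>C. isc i X C"
      unfolding isc_def using cap[of i] card_nbhd[OF that] deg[of i] by (intro code_exists) auto
    then show ?thesis unfolding code_def by (rule someI_ex)
  qed
  define K where "K = parts M S \<times> Pow (\<Union>i\<le>S. parts M i)"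
  have "finite K" by (simp add: K_def)
  from ex_bij_betw_nat_finite[OF this] obtain h where h: "bij_betw h {0..<card K} K" ..
  have "tower_graph t R Q q M touch code S lev {0..<card K} (\<lambda>x. fst (h x)) (\<lambda>x. snd (h x))"
  proof
    show "code i X c \<subseteq> nbhd i X" if "i < S" "X \<in> parts M i" "c < M (Suc i)" for i X c
      using code[OF that(2)] that(3) by (simp add: isc_def)
    show "degree i \<le> 4 * card (sym_diff (code i X c) (code i X c'))"
      if "i < S" "X \<in> parts M i" "c < M (Suc i)" "c' < M (Suc i)" "c \<noteq> c'" for i X c c'
      using code[OF that(2)] that card_nbhd[OF that(2)] by (simp add: isc_def)
    show "1 \<le> lev l \<and> lev l \<le> S" if "1 \<le> l" "l < t" for l using lev(1)[OF that] .
    show "lev l \<le> lev l'" if "1 \<le> l" "l \<le> l'" "l' < t" for l l' using lev(2)[OF that] .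
    show "finite {0..<card K}" by simp
    show "bij_betw (\<lambda>x. (fst (h x), snd (h x))) {0..<card K} (parts M S \<times> Pow (\<Union>i\<le>S. parts M i))"
      using h by (simp add: K_def)
  qed
  moreover have "\<forall>i. 2 ^ 30 * t * tower i \<le> Q (Suc i)" using grow by (simp add: a_def)
  moreover have "\<forall>i. q (Suc i) = min (Q (Suc i)) (N (Suc i))" by (simp add: q_def)
  ultimately show ?thesis unfolding R_def by blast
qed

section \<open>Selection of a level and final numerical estimates\<close>

lemma exists_level:
  fixes W :: "nat \<Rightarrow> nat"
  assumes "W 1 \<le> k" "1 \<le> n" "k < W n"
  shows "\<exists>l. 1 \<le> l \<and> l < n \<and> W l \<le> k \<and> k < W (l + 1)"
  using assms(2,3)
proof (induction n rule: dec_induct)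
  case base
  then show ?case using assms(1) by simp
next
  case (step n)
  show ?case
  proof (cases "k < W n")
    case True
    then obtain l where "1 \<le> l" "l < n" "W l \<le> k" "k < W (l + 1)" using step.IH by blast
    then show ?thesis by (intro exI[of _ l]) simp
  next
    case False
    then show ?thesis using step by (intro exI[of _ n]) simp
  qed
qed

lemma sum_half_powers: "(\<Sum>j<n. 1 / (2::real) ^ j) \<le> 2"
proof -
  have "(\<Sum>j<n. 1 / (2::real) ^ j) = 2 - 2 / 2 ^ n"
    by (induction n) (auto simp: field_simps)
  then show ?thesis by simp
qed

theorem theorem1p4:
  fixes \<epsilon> :: real and f :: "nat \<Rightarrow> real" and W :: "nat \<Rightarrow> nat" and t :: nat
  assumes "0 < \<epsilon>" and "\<epsilon> < 1 / 2 ^ 100"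
    and "\<And>n. n \<ge> 1 \<Longrightarrow> 0 < f n \<and> f n < 1"
    and "\<And>m n. 1 \<le> m \<Longrightarrow> m \<le> n \<Longrightarrow> f n \<le> f m"
    and "f 1 \<le> \<epsilon> ^ 6 / 2 ^ 100"
    and "W 1 = 1"
    and "\<And>l. l \<ge> 1 \<Longrightarrow> W (l + 1) = tower (nat \<lfloor>\<epsilon> ^ 5 / 2 ^ 70 / f (W l)\<rfloor>)"
    and "t = nat \<lfloor>1 / (2 ^ 20 * \<epsilon>)\<rfloor>"
  shows "\<exists>G :: nat pair_pre_digraph. pair_graph G \<and>
           (\<forall>A B. equitable_partition (pverts G) A \<and> equitable_partition (pverts G) B \<and>
              mean_square_density G B \<le> mean_square_density G A + \<epsilon> \<and>
              regular_partition G (f (card A)) B \<longrightarrow>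
              card A \<ge> W (t - 1) \<and> card B \<ge> W (t - 1))"
proof -
  define \<kappa> where "\<kappa> = \<epsilon> ^ 5 / 2 ^ 70"
  define \<gamma> where "\<gamma> l = f (W l)" for l
  define s where "s l = nat \<lfloor>\<kappa> / \<gamma> l\<rfloor>" for l
  \<comment> \<open>\<open>W (l + 1)\<close> is the tower at \<open>s l\<close>, and
    \<open>Q (Suc i)\<close> is at least a multiple of the tower at \<open>i\<close>. One stage
    beyond \<open>s l\<close>, the number of labels is thus exponential in something larger than
    \<open>W (l + 1)\<close>.\<close>
  define lev where "lev l = Suc (s l)" for l
  define S where "S = lev (t - 1)"
  define \<tau> where "\<tau> = real t"
  \<comment> \<open>The factor 2^13 makes 8 \<eta> a sixteenth of the gain 1 / (64 t) and covers 168
    * 32 in the check of \<open>untouched_large\<close>.\<close>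
  define \<eta> where "\<eta> = 1 / (2 ^ 13 * \<tau>)"
  have Wrec: "W (l + 1) = tower (s l)" if "1 \<le> l" for l
    using assms(7)[OF that] by (simp add: s_def \<kappa>_def \<gamma>_def)
  have \<tau>le: "\<tau> \<le> 1 / (2 ^ 20 * \<epsilon>)" and t80: "2 ^ 80 \<le> t"
  proof -
    have "2 ^ 100 * \<epsilon> < 1" using assms(2) by (simp add: field_simps)
    then have "2 ^ 80 * (2 ^ 20 * \<epsilon>) \<le> 1" by simp
    then have x: "2 ^ 80 \<le> 1 / (2 ^ 20 * \<epsilon>)" using assms(1) by (simp add: pos_le_divide_eq)
    then show "2 ^ 80 \<le> t" unfolding assms(8) by (intro le_nat_floor) simp
    have "0 \<le> \<lfloor>1 / (2 ^ 20 * \<epsilon>)\<rfloor>" using assms(1) by simp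
    then show "\<tau> \<le> 1 / (2 ^ 20 * \<epsilon>)" unfolding \<tau>_def assms(8) by (simp add: of_int_floor_le)
  qed
  have \<tau>: "1 \<le> \<tau>" using t80 unfolding \<tau>_def by (simp add: order_trans[of 1 "2 ^ 80"])
  have \<epsilon>\<tau>: "\<epsilon> \<le> 1 / (2 ^ 20 * \<tau>)"
    using \<tau>le assms(1) \<tau> by (simp add: field_simps)
  have \<kappa>le: "\<kappa> \<le> 1 / (2 ^ 170 * \<tau> ^ 5)"
  proof -
    have "\<epsilon> ^ 5 \<le> (1 / (2 ^ 20 * \<tau>)) ^ 5" using \<epsilon>\<tau> assms(1) by (intro power_mono) auto
    then show ?thesis by (simp add: \<kappa>_def power_divide power_mult_distrib field_simps)
  qed
  have \<kappa>0: "0 < \<kappa>" using assms(1) by (simp add: \<kappa>_def)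
  have Wpos: "1 \<le> W l" if "1 \<le> l" for l
  proof (cases "l = 1")
    case True
    then show ?thesis using assms(6) by simp
  next
    case False
    then have "W (l - 1 + 1) = tower (s (l - 1))" using that by (intro Wrec) simp
    then show ?thesis using that tower_ge[of "s (l - 1)"] by simp
  qed
  have \<gamma>pos: "0 < \<gamma> l" if "1 \<le> l" for l using assms(3)[OF Wpos[OF that]] by (simp add: \<gamma>_def)
  have \<gamma>f1: "\<gamma> l \<le> f 1" if "1 \<le> l" for l using assms(4)[OF _ Wpos[OF that]] by (simp add: \<gamma>_def)
  have f1: "f 1 \<le> 1 / (2 ^ 220 * \<tau> ^ 6)"
  proof -
    have "\<epsilon> ^ 6 \<le> (1 / (2 ^ 20 * \<tau>)) ^ 6" using \<epsilon>\<tau> assms(1) by (intro power_mono) auto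
    then have "\<epsilon> ^ 6 / 2 ^ 100 \<le> 1 / (2 ^ 220 * \<tau> ^ 6)" by (simp add: power_divide power_mult_distrib field_simps)
    then show ?thesis using assms(5) by linarith
  qed
  have smono: "s l \<le> s l'" if "W l \<le> W l'" "1 \<le> l" "1 \<le> l'" for l l'
  proof -
    have "\<gamma> l' \<le> \<gamma> l" using assms(4)[OF Wpos[OF that(2)] that(1)] by (simp add: \<gamma>_def)
    then have "\<kappa> / \<gamma> l \<le> \<kappa> / \<gamma> l'" using \<kappa>0 \<gamma>pos that by (intro divide_left_mono) auto
    then show ?thesis unfolding s_def by (intro nat_mono floor_mono)
  qed
  \<comment> \<open>Monotonicity of \<open>W\<close> is derived by induction: a larger
    \<open>W l\<close> has a smaller \<open>f\<close> and hence a higher tower in the next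
    step.\<close>
  have Wstep: "W (Suc l) \<le> W (Suc (Suc l))" for l
  proof (induction l)
    case 0
    then show ?case using assms(6) Wpos[of 2] by (simp add: numeral_2_eq_2)
  next
    case (Suc l)
    have "tower (s (Suc l)) \<le> tower (s (Suc (Suc l)))" using Suc by (intro tower_mono smono) auto
    then show ?case using Wrec[of "Suc l"] Wrec[of "Suc (Suc l)"] by simp
  qed
  have Wmono: "W l \<le> W l'" if "1 \<le> l" "l \<le> l'" for l l'
  proof -
    have "W (Suc (l - 1)) \<le> W (Suc (l' - 1))"
      by (rule lift_Suc_mono_le[of "\<lambda>l. W (Suc l)"]) (use Wstep that in auto)
    then show ?thesis using that by simp
  qed
  have levmono: "lev l \<le> lev l'" if "1 \<le> l" "l \<le> l'" for l l'
    unfolding lev_def using smono[OF Wmono[OF that]] that by simp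
  have levS: "1 \<le> lev l \<and> lev l \<le> S" if "1 \<le> l" "l < t" for l
    unfolding S_def using levmono[OF that(1), of "t - 1"] that by (simp add: lev_def)
  \<comment> \<open>Twice the bound on \<kappa>: one half pays for the \<open>s l\<close> stages,
    the other, through the bound on \<open>f 1\<close>, for the extra stage in
    \<open>lev l\<close>.\<close>
  define \<mu> where "\<mu> = 1 / (2 ^ 169 * \<tau> ^ 5)"
  have \<mu>: "0 < \<mu>" using \<tau> by (simp add: \<mu>_def)
  have f1\<mu>: "f 1 \<le> \<mu> / 2"
  proof -
    have "2 ^ 170 * \<tau> ^ 5 \<le> 2 ^ 220 * \<tau> ^ 6" using \<tau> by (intro mult_mono power_increasing) auto
    then have "1 / (2 ^ 220 * \<tau> ^ 6) \<le> 1 / (2 ^ 170 * \<tau> ^ 5)" using \<tau> by (intro divide_left_mono) auto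
    then show ?thesis using f1 by (simp add: \<mu>_def)
  qed
  have \<gamma>lev: "\<gamma> l * lev l \<le> \<mu>" if l: "1 \<le> l" for l
  proof -
    have "0 \<le> \<kappa> / \<gamma> l" using \<kappa>0 \<gamma>pos[OF l] by simp
    then have "real (s l) \<le> \<kappa> / \<gamma> l" by (simp add: s_def)
    then have "\<gamma> l * real (s l) \<le> \<kappa>" using \<gamma>pos[OF l] by (simp add: field_simps)
    moreover have "\<kappa> \<le> \<mu> / 2" using \<kappa>le by (simp add: \<mu>_def)
    moreover have "\<gamma> l \<le> \<mu> / 2" using \<gamma>f1[OF l] f1\<mu> by linarith
    ultimately show ?thesis by (simp add: lev_def algebra_simps)
  qed
  \<comment> \<open>The touching density demanded at stage \<open>i\<close>, added over all levels
    that reach this stage; a sum rather than a maximum lets the order of summation be exchanged in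
    \<open>ysum\<close>. In 2^25, the factor 2^13 is that of \<eta> and 2^12 covers 112 *
    32.\<close>
  define y where "y i = (\<Sum>l\<in>{1..<t}. if i \<le> lev l then 2 ^ 25 * \<tau>\<^sup>2 * \<gamma> l else 0)" for i
  have ynn: "0 \<le> 2 ^ 25 * \<tau>\<^sup>2 * \<gamma> l" if "1 \<le> l" for l
    by (intro mult_nonneg_nonneg less_imp_le[OF \<gamma>pos[OF that]]) simp_all
  have y0: "0 \<le> y i" for i unfolding y_def
  proof (rule sum_nonneg)
    show "0 \<le> (if i \<le> lev l then 2 ^ 25 * \<tau>\<^sup>2 * \<gamma> l else 0)" if "l \<in> {1..<t}" for l
      using ynn[of l] that by (simp only: atLeastLessThan_iff) (cases "i \<le> lev l"; simp only: if_True if_False order_refl)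
  qed
  have yge: "2 ^ 25 * \<tau>\<^sup>2 * \<gamma> l \<le> y i" if "1 \<le> l" "l < t" "i \<le> lev l" for i l
  proof -
    have "(if i \<le> lev l then 2 ^ 25 * \<tau>\<^sup>2 * \<gamma> l else 0) \<le> y i"
      unfolding y_def
    proof (rule member_le_sum)
      show "0 \<le> (if i \<le> lev l' then 2 ^ 25 * \<tau>\<^sup>2 * \<gamma> l' else 0)" if "l' \<in> {1..<t} - {l}" for l'
        using ynn[of l'] that by (simp only: Diff_iff atLeastLessThan_iff split: if_splits) simp
    qed (use that in auto)
    then show ?thesis using that by simp
  qed
  have ysum: "(\<Sum>i\<in>{1..S}. y i) \<le> 1 / 8"
  proof -
    have "(\<Sum>i\<in>{1..S}. y i) = (\<Sum>l\<in>{1..<t}. \<Sum>i\<in>{1..S}. if i \<le> lev l then 2 ^ 25 * \<tau>\<^sup>2 * \<gamma> l else 0)"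
      unfolding y_def by (rule sum.swap)
    also have "\<dots> \<le> (\<Sum>l\<in>{1..<t}. 2 ^ 25 * \<tau>\<^sup>2 * \<mu>)"
    proof (rule sum_mono)
      fix l assume l: "l \<in> {1..<t}"
      have "(\<Sum>i\<in>{1..S}. if i \<le> lev l then 2 ^ 25 * \<tau>\<^sup>2 * \<gamma> l else 0) = (\<Sum>i\<in>{1..lev l}. 2 ^ 25 * \<tau>\<^sup>2 * \<gamma> l)"
        using levS[of l] l by (intro sum.mono_neutral_cong_right) auto
      also have "\<dots> = 2 ^ 25 * \<tau>\<^sup>2 * (\<gamma> l * lev l)" by simp
      also have "\<dots> \<le> 2 ^ 25 * \<tau>\<^sup>2 * \<mu>" using \<gamma>lev[of l] l by (intro mult_left_mono) auto
      finally show "(\<Sum>i\<in>{1..S}. if i \<le> lev l then 2 ^ 25 * \<tau>\<^sup>2 * \<gamma> l else 0) \<le> 2 ^ 25 * \<tau>\<^sup>2 * \<mu>" .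
    qed
    also have "\<dots> = real (t - 1) * (2 ^ 25 * \<tau>\<^sup>2 * \<mu>)" by simp
    also have "\<dots> \<le> \<tau> * (2 ^ 25 * \<tau>\<^sup>2 * \<mu>)" using \<mu> by (intro mult_right_mono) (auto simp: \<tau>_def)
    also have "\<dots> = 1 / (2 ^ 144 * \<tau>\<^sup>2)" using \<tau> by (simp add: \<mu>_def field_simps power2_eq_square eval_nat_numeral)
    also have "\<dots> \<le> 1 / (8 * 1)" using \<tau> by (intro divide_left_mono mult_mono) auto
    finally show ?thesis by simp
  qed
  \<comment> \<open>Beyond \<open>S\<close> the demand is 0 and 1 / y would be 0 by the convention
    for division by zero; the value 2 keeps \<open>N\<close> at least 2 everywhere.\<close>
  define N where "N i = (if 1 \<le> i \<and> i \<le> S then nat \<lfloor>1 / y i\<rfloor> else 2)" for i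
  have ypos: "0 < y i" if "i \<le> S" for i
  proof -
    have "1 \<le> t - 1" "t - 1 < t" using t80 by auto
    then have "0 < 2 ^ 25 * \<tau>\<^sup>2 * \<gamma> (t - 1)" "2 ^ 25 * \<tau>\<^sup>2 * \<gamma> (t - 1) \<le> y i"
      using \<gamma>pos[of "t - 1"] yge[of "t - 1" i] that \<tau> by (auto simp: S_def)
    then show ?thesis by linarith
  qed
  have yle: "y i \<le> 1 / 8" if "1 \<le> i" "i \<le> S" for i
  proof -
    have "y i \<le> (\<Sum>i\<in>{1..S}. y i)" using that y0 by (intro member_le_sum) auto
    then show ?thesis using ysum by linarith
  qed
  have Nb: "2 \<le> N i \<and> real (N i) \<le> 1 / y i \<and> 1 / real (N i) \<le> 2 * y i" if i: "1 \<le> i" "i \<le> S" for i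
  proof -
    define x where "x = 1 / y i"
    have x: "8 \<le> x" using yle[OF i] ypos[OF i(2)] by (simp add: x_def field_simps)
    have Nx: "N i = nat \<lfloor>x\<rfloor>" using i by (simp add: N_def x_def)
    have "8 \<le> \<lfloor>x\<rfloor>" using x by (simp add: le_floor_iff)
    then have "real (N i) = of_int \<lfloor>x\<rfloor>" unfolding Nx by simp
    then have N: "real (N i) \<le> x" "x - 1 < real (N i)" by linarith+
    have "2 \<le> N i" using N x by linarith
    moreover have "1 / real (N i) \<le> 1 / (x / 2)" using N x by (intro divide_left_mono) auto
    ultimately show ?thesis using N by (simp add: x_def)
  qed
  have N2: "2 \<le> N i" for i using Nb[of i] by (cases "1 \<le> i \<and> i \<le> S") (auto simp: N_def)
  have t1: "1 \<le> t" using t80 by simp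
  have lm: "lev l \<le> lev l'" if "1 \<le> l" "l \<le> l'" "l' < t" for l l' by (rule levmono[OF that(1,2)])
  obtain Q q M touch code V path key where tg: "tower_graph t (2 ^ 60 * t) Q q M touch code S lev V path key"
    and Qge: "\<And>i. 2 ^ 30 * t * tower i \<le> Q (Suc i)" and qmin: "\<And>i. q (Suc i) = min (Q (Suc i)) (N (Suc i))"
    using tower_graph_exists[of t N lev S, OF t1 N2 levS lm] by blast
  interpret tower_graph t "2 ^ 60 * t" Q q M touch code S lev V path key by (rule tg)
  have Qinv: "1 / real (Q (Suc j)) \<le> 1 / (2 ^ 30 * \<tau>) * (1 / 2 ^ j)" for j
  proof -
    have "2 ^ 30 * t * 2 ^ j \<le> Q (Suc j)"
      using Qge[of j] mult_le_mono2[OF tower_ge_power[of j], of "2 ^ 30 * t"] by linarith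
    then have "real (2 ^ 30 * t * 2 ^ j) \<le> real (Q (Suc j))" by (simp only: of_nat_le_iff)
    then have "2 ^ 30 * \<tau> * 2 ^ j \<le> real (Q (Suc j))" by (simp add: \<tau>_def)
    moreover have "0 < 2 ^ 30 * \<tau> * 2 ^ j" using \<tau> by simp
    ultimately have "1 / real (Q (Suc j)) \<le> 1 / (2 ^ 30 * \<tau> * 2 ^ j)" by (intro divide_left_mono) auto
    then show ?thesis by simp
  qed
  have Qsum: "(\<Sum>j<i. 1 / real (Q (Suc j))) \<le> 2 / (2 ^ 30 * \<tau>)" for i
  proof -
    have "(\<Sum>j<i. 1 / real (Q (Suc j))) \<le> (\<Sum>j<i. 1 / (2 ^ 30 * \<tau>) * (1 / 2 ^ j))" by (intro sum_mono Qinv)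
    also have "\<dots> = 1 / (2 ^ 30 * \<tau>) * (\<Sum>j<i. 1 / 2 ^ j)" by (simp only: sum_distrib_left)
    also have "\<dots> \<le> 1 / (2 ^ 30 * \<tau>) * 2" using sum_half_powers \<tau> by (intro mult_left_mono) auto
    finally show ?thesis by simp
  qed
  have qsum: "(\<Sum>j<i. 1 / real (q (Suc j))) \<le> 1 / 2" if i: "i \<le> S" for i
  proof -
    \<comment> \<open>The reciprocal of a minimum is at most the sum of the reciprocals, so the
      growth of \<open>Q\<close> and the demands \<open>y\<close> are summed separately.\<close>
    have "(\<Sum>j<i. 1 / real (q (Suc j))) \<le> (\<Sum>j<i. 1 / real (Q (Suc j)) + 2 * y (Suc j))"
    proof (rule sum_mono)
      fix j assume "j \<in> {..<i}"
      then have "1 / real (N (Suc j)) \<le> 2 * y (Suc j)" using Nb[of "Suc j"] i by simp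
      then show "1 / real (q (Suc j)) \<le> 1 / real (Q (Suc j)) + 2 * y (Suc j)"
        using y0[of "Suc j"] by (cases "Q (Suc j) \<le> N (Suc j)") (simp_all add: qmin min_def add_increasing)
    qed
    also have "\<dots> = (\<Sum>j<i. 1 / real (Q (Suc j))) + 2 * (\<Sum>j<i. y (Suc j))"
      by (simp add: sum.distrib sum_distrib_left)
    also have "(\<Sum>j<i. y (Suc j)) = (\<Sum>j\<in>{1..i}. y j)"
      by (rule sum.reindex_bij_witness[of _ "\<lambda>j. j - 1" Suc]) auto
    also have "\<dots> \<le> (\<Sum>j\<in>{1..S}. y j)" using i y0 by (intro sum_mono2) auto
    finally have "(\<Sum>j<i. 1 / real (q (Suc j))) \<le> 2 / (2 ^ 30 * \<tau>) + 2 * (1 / 8)"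
      using Qsum[of i] ysum by linarith
    moreover have "2 / (2 ^ 30 * \<tau>) \<le> 2 / (2 ^ 30 * 1)" using \<tau> by (intro divide_left_mono mult_left_mono) auto
    ultimately show ?thesis by simp
  qed
  have \<eta>0: "0 < \<eta>" using \<tau> by (simp add: \<eta>_def)
  have \<eta>\<tau>: "\<eta> * \<tau> = 1 / 2 ^ 13" using \<tau> by (simp add: \<eta>_def)
  \<comment> \<open>Stated for every \<open>g\<close> up to \<open>\<gamma> l\<close>, because the
    regularity f(card A) may lie far below f(W l) when \<open>card A\<close> is larger than
    \<open>W l\<close>.\<close>
  have gap: "mean_square_density G A + \<epsilon> < mean_square_density G B"
    if l: "1 \<le> l" "l < t" and A: "partition_on V A" "card A < W (l + 1)" and B: "equitable_partition V B"
      and g: "0 < g" "g \<le> \<gamma> l"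
      and reg: "real (card {(U, U') \<in> B \<times> B. \<not> regular_pair G g g U U'}) \<le> g * (real (card B))\<^sup>2"
    for l A B g
  proof -
    have gf1: "g \<le> f 1" using g(2) \<gamma>f1[OF l(1)] by linarith
    have glev: "g * lev l \<le> \<mu>"
    proof -
      have "g * lev l \<le> \<gamma> l * lev l" using g by (intro mult_right_mono) auto
      then show ?thesis using \<gamma>lev[OF l(1)] by linarith
    qed
    \<comment> \<open>There are 2^64 \<tau>^2 types, each costing \<open>g\<close> in the initial
      concentration; the bound of order \<epsilon>^6 on \<open>f 1\<close> is used here.\<close>
    have gt: "2 ^ 64 * \<tau>\<^sup>2 * g \<le> \<eta> / 16"
    proof -
      have "2 ^ 64 * \<tau>\<^sup>2 * g \<le> 2 ^ 64 * \<tau>\<^sup>2 * (1 / (2 ^ 220 * \<tau> ^ 6))"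
        using gf1 f1 by (intro mult_left_mono) auto
      also have "\<dots> = (1 / (2 ^ 17 * \<tau>)) * (1 / (2 ^ 139 * \<tau> ^ 3))"
        using \<tau> by (simp add: field_simps eval_nat_numeral)
      also have "\<dots> \<le> (1 / (2 ^ 17 * \<tau>)) * 1"
      proof (rule mult_left_mono)
        have "1 * 1 \<le> 2 ^ 139 * \<tau> ^ 3" using \<tau> by (intro mult_mono one_le_power) auto
        then show "1 / (2 ^ 139 * \<tau> ^ 3) \<le> 1" using \<tau> by (simp add: divide_le_eq_1)
      qed (use \<tau> in simp)
      finally show ?thesis by (simp add: \<eta>_def)
    qed
    have \<mu>\<eta>: "8 * \<mu> \<le> \<eta> / 2"
    proof -
      have "2 ^ 13 * \<tau> \<le> 2 ^ 165 * \<tau> ^ 5" using \<tau> by (intro mult_mono power_increasing self_le_power) auto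
      then have "1 / (2 ^ 165 * \<tau> ^ 5) \<le> 1 / (2 ^ 13 * \<tau>)" using \<tau> by (intro divide_left_mono) auto
      then show ?thesis using \<tau> by (simp add: \<mu>_def \<eta>_def)
    qed
    have card0: "real (card (parts M 0)) = 2 ^ 64 * \<tau>\<^sup>2"
      by (simp only: card_parts_0 M_0) (simp add: \<tau>_def power2_eq_square)
    have levlS: "lev l \<le> S" using levS[OF l] by simp
    interpret tower_level t "2 ^ 60 * t" Q q M touch code S lev V path key l B g \<eta>
    proof
      show "1 \<le> l" "l < t" "equitable_partition V B" "0 < g" "0 < \<eta>" using l B g \<eta>0 by auto
      show "real (card {(U, U') \<in> B \<times> B. \<not> regular_pair G g g U U'}) \<le> g * (real (card B))\<^sup>2" by (rule reg)
      have "1 / (2 ^ 13 * \<tau>) \<le> 1 / (2 ^ 13 * 1)" using \<tau> by (intro divide_left_mono mult_left_mono) auto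
      then show "\<eta> \<le> 1 / 672" by (simp add: \<eta>_def)
      show "4 * real (card (parts M 0)) * g \<le> \<eta> / 4" unfolding card0 using gt by simp
      have "8 * (g * lev l) \<le> \<eta> / 2" using glev \<mu>\<eta> by linarith
      then show "real (card (parts M 0)) * g + 8 * g * real (lev l) \<le> \<eta>"
        unfolding card0 using gt \<eta>0 by simp
      show "(\<Sum>i<lev l. 4 * (if i = 0 then 0 else 400 / real (Q i))) \<le> \<eta> / 4"
      proof -
        have "(\<Sum>i<lev l. 4 * (if i = 0 then 0 else 400 / real (Q i))) = (\<Sum>j<s l. 1600 * (1 / real (Q (Suc j))))"
          unfolding lev_def by (subst sum.lessThan_Suc_shift) simp
        also have "\<dots> = 1600 * (\<Sum>j<s l. 1 / real (Q (Suc j)))" by (simp only: sum_distrib_left)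
        also have "\<dots> \<le> 1600 * (2 / (2 ^ 30 * \<tau>))" using Qsum by (intro mult_left_mono) auto
        also have "\<dots> \<le> \<eta> / 4" using \<tau> by (simp add: \<eta>_def field_simps)
        finally show ?thesis .
      qed
      show "112 * g * real (card (parts M i)) \<le> \<eta> * real (degree i)" if i: "i < lev l" for i
      proof (cases i)
        case 0
        have d0: "real (degree 0) = 2 ^ 60 * \<tau>\<^sup>2"
          by (simp only: degree.simps) (simp add: \<tau>_def power2_eq_square)
        have "112 * g * 16 \<le> \<eta>"
        proof -
          have "1 * 1 \<le> 2 ^ 50 * \<tau>\<^sup>2" using one_le_power[OF \<tau>, of 2] by (intro mult_mono) auto
          then have "1 * g \<le> (2 ^ 50 * \<tau>\<^sup>2) * g" using g by (intro mult_right_mono) auto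
          then show ?thesis using gt \<eta>0 by simp
        qed
        then have "(112 * g * 16) * (2 ^ 60 * \<tau>\<^sup>2) \<le> \<eta> * (2 ^ 60 * \<tau>\<^sup>2)" by (intro mult_right_mono) auto
        then show ?thesis unfolding 0 card0 d0 by simp
      next
        case (Suc j)
        have iS: "1 \<le> i" "i \<le> S" using i Suc levlS by auto
        have "card (parts M i) \<le> 32 * t * q i * degree i"
          unfolding Suc using qsum[of j] iS Suc by (intro card_parts_le_degree) auto
        then have "real (card (parts M i)) \<le> real (32 * t * q i * degree i)" by (simp only: of_nat_le_iff)
        then have cp: "real (card (parts M i)) \<le> 32 * \<tau> * real (q i) * real (degree i)" by (simp add: \<tau>_def)
        have "q i \<le> N i" unfolding Suc qmin by simp
        then have "real (q i) \<le> 1 / y i" using Nb[OF iS] by linarith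
        then have "real (q i) * y i \<le> 1" using ypos[OF iS(2)] by (simp add: pos_le_divide_eq)
        moreover have "2 ^ 25 * \<tau>\<^sup>2 * g \<le> y i"
        proof -
          have "2 ^ 25 * \<tau>\<^sup>2 * g \<le> 2 ^ 25 * \<tau>\<^sup>2 * \<gamma> l" using g by (intro mult_left_mono) auto
          then show ?thesis using yge[OF l, of i] i by linarith
        qed
        then have "real (q i) * (2 ^ 25 * \<tau>\<^sup>2 * g) \<le> real (q i) * y i" by (intro mult_left_mono) auto
        ultimately have qg: "2 ^ 25 * \<tau>\<^sup>2 * g * real (q i) \<le> 1" by (simp add: mult_ac)
        have "112 * g * real (card (parts M i)) \<le> 112 * g * (32 * \<tau> * real (q i) * real (degree i))"
          using cp g by (intro mult_left_mono) auto
        also have "\<dots> = (3584 * \<tau> * g * real (q i)) * real (degree i)" by simp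
        also have "\<dots> \<le> \<eta> * real (degree i)"
        proof (rule mult_right_mono)
          have "(3584 * \<tau> * g * real (q i)) * (2 ^ 13 * \<tau>) \<le> 2 ^ 25 * \<tau>\<^sup>2 * g * real (q i)"
            using g \<tau> by (simp add: power2_eq_square)
          then have "(3584 * \<tau> * g * real (q i)) * (2 ^ 13 * \<tau>) \<le> 1" using qg by linarith
          then show "3584 * \<tau> * g * real (q i) \<le> \<eta>" using \<tau> by (simp add: \<eta>_def pos_le_divide_eq)
        qed simp
        finally show ?thesis .
      qed
      show "168 * \<eta> * real (card (parts M i)) \<le> real (untouched_degree i)" if i: "Suc i < lev l" for i
      proof -
        have "card (parts M i) \<le> 32 * t * untouched_degree i"
          using qsum[of i] i levlS by (intro card_parts_le_untouched) auto
        then have "real (card (parts M i)) \<le> real (32 * t * untouched_degree i)" by (simp only: of_nat_le_iff)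
        then have "real (card (parts M i)) \<le> 32 * \<tau> * untouched_degree i" by (simp add: \<tau>_def)
        then have "168 * \<eta> * real (card (parts M i)) \<le> 168 * \<eta> * (32 * \<tau> * untouched_degree i)"
          using \<eta>0 by (intro mult_left_mono) auto
        also have "\<dots> = 5376 * (\<eta> * \<tau>) * untouched_degree i" by simp
        also have "\<dots> \<le> untouched_degree i" unfolding \<eta>\<tau> by simp
        finally show ?thesis .
      qed
    qed
    \<comment> \<open>At \<open>lev l\<close> there are at least 2^x paths, hence at least x^4. The
      square root leaves x^2, while \<open>card A\<close> is at most x / (2^30 t).\<close>
    have small: "(real (card A))\<^sup>2 * t \<le> \<eta> * sqrt (card (parts M (lev l)))"
    proof -
      define x where "x = Q (Suc (s l))"
      define T where "T = tower (s l)"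
      have T: "card A \<le> T" "1 \<le> T" using A(2) Wrec[OF l(1)] tower_ge[of "s l"] by (auto simp: T_def)
      have xT: "2 ^ 30 * t * T \<le> x" using Qge[of "s l"] by (simp add: x_def T_def)
      have "2 ^ 30 * 1 * 1 \<le> 2 ^ 30 * t * T" using t1 T by (intro mult_le_mono) auto
      with xT have "2 ^ 30 * 1 * 1 \<le> x" by (rule order_trans[rotated])
      then have x1: "1024 \<le> x" by simp
      have qq: "2 \<le> q (Suc (s l))" using x1 N2[of "Suc (s l)"] by (simp add: qmin x_def)
      have "x ^ 4 \<le> x ^ 16" using x1 by (intro power_increasing) auto
      also have "\<dots> \<le> 2 ^ x" by (rule power_bound[OF x1])
      also have "\<dots> \<le> q (Suc (s l)) ^ x" using qq by (intro power_mono) auto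
      also have "\<dots> \<le> M (Suc (s l))" unfolding M_Suc x_def[symmetric] using x1 by simp
      also have "\<dots> \<le> card (parts M (Suc (s l)))"
        unfolding card_parts_Suc using card_parts_pos[of "s l"] by simp
      finally have "x ^ 4 \<le> card (parts M (lev l))" by (simp add: lev_def)
      then have "real (x ^ 4) \<le> real (card (parts M (lev l)))" by (simp only: of_nat_le_iff)
      then have "((real x)\<^sup>2)\<^sup>2 \<le> real (card (parts M (lev l)))" by (simp add: power_mult[symmetric])
      then have sq: "(real x)\<^sup>2 \<le> sqrt (card (parts M (lev l)))" by (rule real_le_rsqrt)
      have "real (2 ^ 30 * t * T) \<le> real x" using xT by (simp only: of_nat_le_iff)
      then have "2 ^ 30 * \<tau> * real (card A) \<le> real x"
        using T(1) \<tau> order_trans[OF mult_left_mono[of "real (card A)" "real T" "2 ^ 30 * \<tau>"], of "real x"]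
        by (simp add: \<tau>_def)
      then have "(2 ^ 30 * \<tau> * real (card A))\<^sup>2 \<le> (real x)\<^sup>2" using \<tau> by (intro power_mono) auto
      then have "2 ^ 60 * \<tau>\<^sup>2 * (real (card A))\<^sup>2 \<le> sqrt (card (parts M (lev l)))"
        using sq by (simp add: power_mult_distrib)
      then have k: "\<eta> * (2 ^ 60 * \<tau>\<^sup>2 * (real (card A))\<^sup>2) \<le> \<eta> * sqrt (card (parts M (lev l)))"
        using \<eta>0 by (intro mult_left_mono) auto
      have "(real (card A))\<^sup>2 * t = 1 * (\<tau> * (real (card A))\<^sup>2)" unfolding \<tau>_def by (simp only: mult_1 mult.commute)
      also have "\<dots> \<le> (2 ^ 60 * (\<eta> * \<tau>)) * (\<tau> * (real (card A))\<^sup>2)"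
        unfolding \<eta>\<tau> using \<tau> by (intro mult_right_mono) auto
      also have "\<dots> = \<eta> * (2 ^ 60 * \<tau>\<^sup>2 * (real (card A))\<^sup>2)"
        by (simp only: power2_eq_square[of \<tau>] mult_ac)
      finally show ?thesis using k by (rule order_trans)
    qed
    \<comment> \<open>1 / 64 - 8 / 2^13 = 15 / 1024, far above the 2^-20 that bounds \<epsilon>
      \<tau>.\<close>
    have "\<epsilon> < 1 / (64 * t) - 8 * \<eta>"
    proof -
      have "1 / (64 * t) - 8 * \<eta> = 15 / (1024 * \<tau>)" using \<tau> by (simp add: \<eta>_def \<tau>_def field_simps)
      moreover have "1 / (2 ^ 20 * \<tau>) < 15 / (1024 * \<tau>)" using \<tau> by (simp add: field_simps)
      ultimately show ?thesis using \<epsilon>\<tau> by linarith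
    qed
    then show ?thesis using energy_gap[OF A(1) small] by linarith
  qed
  show ?thesis
  proof (intro exI[of _ G] conjI allI impI)
    show "pair_graph G" by (rule pair_graph_G)
    fix A B
    assume H: "equitable_partition (pverts G) A \<and> equitable_partition (pverts G) B \<and>
      mean_square_density G B \<le> mean_square_density G A + \<epsilon> \<and> regular_partition G (f (card A)) B"
    from H have eA: "equitable_partition V A" unfolding pverts_G by (elim conjE)
    from H have B: "equitable_partition V B" unfolding pverts_G by (elim conjE)
    from H have le: "mean_square_density G B \<le> mean_square_density G A + \<epsilon>" by (elim conjE)
    from H have rp: "regular_partition G (f (card A)) B" by (elim conjE)
    have A: "partition_on V A" and B': "partition_on V B"
      using eA B by (simp_all add: equitable_partition_def)
    have reg: "real (card {(U, U') \<in> B \<times> B. \<not> regular_pair G (f (card A)) (f (card A)) U U'}) \<le> f (card A) * (real (card B))\<^sup>2"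
      using rp unfolding regular_partition_def by (elim conjE)
    have "finite A" using partition_onD1[OF A] finite_V by (metis finite_UnionD)
    moreover have "A \<noteq> {}" using partition_onD1[OF A] V_nonempty by auto
    ultimately have k1: "1 \<le> card A" by (simp add: Suc_le_eq card_gt_0_iff)
    have fpos: "0 < f (card A)" using assms(3)[OF k1] by simp
    have fle: "f (card A) \<le> \<gamma> l" if "W l \<le> card A" "1 \<le> l" for l
      using assms(4)[OF Wpos[OF that(2)] that(1)] by (simp add: \<gamma>_def)
    show kA: "W (t - 1) \<le> card A"
    proof (rule ccontr)
      assume "\<not> W (t - 1) \<le> card A"
      then have "\<exists>l. 1 \<le> l \<and> l < t - 1 \<and> W l \<le> card A \<and> card A < W (l + 1)"
        using k1 assms(6) t80 by (intro exists_level) auto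
      then obtain l where l: "1 \<le> l" "l < t - 1" "W l \<le> card A" "card A < W (l + 1)" by blast
      have "l < t" using l(2) by simp
      from gap[OF l(1) this A l(4) B fpos fle[OF l(3,1)] reg] show False using le by linarith
    qed
    show "W (t - 1) \<le> card B"
    proof (rule ccontr)
      assume nB: "\<not> W (t - 1) \<le> card B"
      \<comment> \<open>The level with \<open>l + 1 = t - 1\<close>; sufficient regularity at this
        level comes from the bound on \<open>card A\<close> just obtained.\<close>
      define l where "l = t - 2"
      have l: "1 \<le> l" "l < t" "l + 1 = t - 1" using t80 by (auto simp: l_def)
      have "W l \<le> W (t - 1)" using l by (intro Wmono) auto
      then have Wl: "W l \<le> card A" using kA by linarith
      have "card B < W (l + 1)" using nB unfolding l(3) by simp
      from gap[OF l(1,2) B' this B fpos fle[OF Wl l(1)] reg] show False using assms(1) by linarith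
    qed
  qed
qed

end
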